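(* If the theory ZFC + "there exists a supercompact cardinal" is consistent, then so is the theory ZFC + "there exist a measurable cardinal $\kappa$ and a $\kappa$-complete ultrafilter $\mathscr{U}$ over $\kappa$ such that $\mathscr{D}_\kappa\subseteq\mathscr{U}$ and $\mathrm{Gal}(\mathscr{U},\kappa,\kappa^+)$ fails".
   Context: For an uncountable regular cardinal $\kappa$, $\mathscr{D}_\kappa$ denotes the club filter over $\kappa$, i.e. the filter of all subsets of $\kappa$ containing a closed unbounded subset of $\kappa$. For a filter $\mathscr{F}$ over $\kappa$, $\mathrm{Gal}(\mathscr{F},\kappa,\kappa^+)$ (the Galvin property of $\mathscr{F}$) is the statement: for every indexed family $\{A_\alpha:\alpha\in\kappa^+\}\subseteq\mathscr{F}$ there is $I\in[\kappa^+]^{\kappa}$ (a subset of $\kappa^+$ of cardinality $\kappa$) such that $\bigcap_{\alpha\in I}A_\alpha\in\mathscr{F}$. *)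

theory Defs
  imports Main
begin

section \<open>First-order logic in the language of set theory\<close>

text \<open>Bound variables are de Bruijn indices. The only terms are variables, so substitution of
  terms is renaming of indices.\<close>

datatype fm = Falsum | Mem nat nat | Eq nat nat | Imp fm fm | Forall fm

primrec rename :: "(nat \<Rightarrow> nat) \<Rightarrow> fm \<Rightarrow> fm" where
  "rename r Falsum = Falsum"
| "rename r (Mem i j) = Mem (r i) (r j)"
| "rename r (Eq i j) = Eq (r i) (r j)"
| "rename r (Imp p q) = Imp (rename r p) (rename r q)"
| "rename r (Forall p) = Forall (rename (case_nat 0 (\<lambda>i. Suc (r i))) p)"

primrec fv_below :: "nat \<Rightarrow> fm \<Rightarrow> bool" where
  "fv_below n Falsum \<longleftrightarrow> True"
| "fv_below n (Mem i j) \<longleftrightarrow> i < n \<and> j < n"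
| "fv_below n (Eq i j) \<longleftrightarrow> i < n \<and> j < n"
| "fv_below n (Imp p q) \<longleftrightarrow> fv_below n p \<and> fv_below n q"
| "fv_below n (Forall p) \<longleftrightarrow> fv_below (Suc n) p"

text \<open>Classical natural deduction with equality. In \<open>ForallI\<close> the assumptions are shifted so that
  index 0 is an eigenvariable; \<open>rename (case_nat k (\<lambda>i. i)) p\<close> is the instance of \<open>Forall p\<close> at
  the variable \<open>k\<close>.\<close>

inductive derives :: "fm set \<Rightarrow> fm \<Rightarrow> bool"  (infix "\<turnstile>" 50) where
  Assm:   "p \<in> \<Gamma> \<Longrightarrow> \<Gamma> \<turnstile> p"
| ImpI:   "insert p \<Gamma> \<turnstile> q \<Longrightarrow> \<Gamma> \<turnstile> Imp p q"
| ImpE:   "\<Gamma> \<turnstile> Imp p q \<Longrightarrow> \<Gamma> \<turnstile> p \<Longrightarrow> \<Gamma> \<turnstile> q"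
| Contr:  "insert (Imp p Falsum) \<Gamma> \<turnstile> Falsum \<Longrightarrow> \<Gamma> \<turnstile> p"
| ForallI:   "rename Suc ` \<Gamma> \<turnstile> p \<Longrightarrow> \<Gamma> \<turnstile> Forall p"
| ForallE:   "\<Gamma> \<turnstile> Forall p \<Longrightarrow> \<Gamma> \<turnstile> rename (case_nat k (\<lambda>i. i)) p"
| EqRefl: "\<Gamma> \<turnstile> Eq i i"
| EqSubst: "\<Gamma> \<turnstile> Eq i j \<Longrightarrow> \<Gamma> \<turnstile> rename (case_nat i (\<lambda>i. i)) p
    \<Longrightarrow> \<Gamma> \<turnstile> rename (case_nat j (\<lambda>i. i)) p"

definition consistent :: "fm set \<Rightarrow> bool" where
  "consistent T \<longleftrightarrow> \<not> T \<turnstile> Falsum"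


section \<open>Writing formulas with named variables\<close>

text \<open>To write formulas readably, a variable is named by its de Bruijn level, that is, by the
  number of binders outside the one that binds it. An \<open>sform\<close> maps the number \<open>n\<close> of variables
  in scope (levels \<open>0, \<dots>, n - 1\<close>) to a formula, in which level \<open>x\<close> is index \<open>n - 1 - x\<close>; a
  quantifier binds level \<open>n\<close>. A closed \<open>sform\<close> denotes the sentence obtained at \<open>0\<close>.\<close>

type_synonym sform = "nat \<Rightarrow> fm"

definition fmem :: "nat \<Rightarrow> nat \<Rightarrow> sform"  (infix "\<^bold>\<in>" 50) where
  "(x \<^bold>\<in> y) = (\<lambda>n. Mem (n - 1 - x) (n - 1 - y))"

definition feq :: "nat \<Rightarrow> nat \<Rightarrow> sform"  (infix "\<^bold>=" 50) where
  "(x \<^bold>= y) = (\<lambda>n. Eq (n - 1 - x) (n - 1 - y))"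

definition fimp :: "sform \<Rightarrow> sform \<Rightarrow> sform"  (infixr "\<^bold>\<longrightarrow>" 25) where
  "(P \<^bold>\<longrightarrow> Q) = (\<lambda>n. Imp (P n) (Q n))"

definition fnot :: "sform \<Rightarrow> sform"  ("\<^bold>\<not> _" [40] 40) where
  "(\<^bold>\<not> P) = (\<lambda>n. Imp (P n) Falsum)"

definition fconj :: "sform \<Rightarrow> sform \<Rightarrow> sform"  (infixr "\<^bold>\<and>" 35) where
  "(P \<^bold>\<and> Q) = (\<^bold>\<not> (P \<^bold>\<longrightarrow> \<^bold>\<not> Q))"

definition fdisj :: "sform \<Rightarrow> sform \<Rightarrow> sform"  (infixr "\<^bold>\<or>" 30) where
  "(P \<^bold>\<or> Q) = (\<^bold>\<not> P \<^bold>\<longrightarrow> Q)"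

definition fiff :: "sform \<Rightarrow> sform \<Rightarrow> sform"  (infixr "\<^bold>\<longleftrightarrow>" 25) where
  "(P \<^bold>\<longleftrightarrow> Q) = ((P \<^bold>\<longrightarrow> Q) \<^bold>\<and> (Q \<^bold>\<longrightarrow> P))"

definition fall :: "(nat \<Rightarrow> sform) \<Rightarrow> sform"  (binder "\<^bold>\<forall>" 10) where
  "fall P = (\<lambda>n. Forall (P n (Suc n)))"

definition fex :: "(nat \<Rightarrow> sform) \<Rightarrow> sform"  (binder "\<^bold>\<exists>" 10) where
  "fex P = (\<^bold>\<not> (\<^bold>\<forall>x. \<^bold>\<not> P x))"

definition fex1 :: "(nat \<Rightarrow> sform) \<Rightarrow> sform"  (binder "\<^bold>\<exists>!" 10) where
  "fex1 P = (\<^bold>\<exists>x. P x \<^bold>\<and> (\<^bold>\<forall>y. P y \<^bold>\<longrightarrow> y \<^bold>= x))"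

text \<open>\<open>p\<langle>xs\<rangle>\<close> is the arbitrary formula \<open>p\<close> with its free variables \<open>0, \<dots>, length xs - 1\<close> read as
  the variables \<open>xs\<close>.\<close>

definition finst :: "fm \<Rightarrow> nat list \<Rightarrow> sform"  ("_\<langle>_\<rangle>" [1000, 0] 1000) where
  "p\<langle>xs\<rangle> = (\<lambda>n. rename (\<lambda>i. n - 1 - xs ! i) p)"

text \<open>Universal closure over the variables \<open>0, \<dots>, k - 1\<close>.\<close>

definition univ_closure :: "nat \<Rightarrow> sform \<Rightarrow> fm" where
  "univ_closure k P = (Forall ^^ k) (P k)"


section \<open>Basic set-theoretic notions\<close>

definition fsubset :: "nat \<Rightarrow> nat \<Rightarrow> sform"  (infix "\<^bold>\<subseteq>" 50) where
  "(x \<^bold>\<subseteq> y) = (\<^bold>\<forall>z. z \<^bold>\<in> x \<^bold>\<longrightarrow> z \<^bold>\<in> y)"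

definition nonempty :: "nat \<Rightarrow> sform" where
  "nonempty x = (\<^bold>\<exists>y. y \<^bold>\<in> x)"

definition is_succ :: "nat \<Rightarrow> nat \<Rightarrow> sform" where
  "is_succ s x = (\<^bold>\<forall>z. z \<^bold>\<in> s \<^bold>\<longleftrightarrow> z \<^bold>\<in> x \<^bold>\<or> z \<^bold>= x)"

definition is_upair :: "nat \<Rightarrow> nat \<Rightarrow> nat \<Rightarrow> sform" where
  "is_upair p x y = (\<^bold>\<forall>z. z \<^bold>\<in> p \<^bold>\<longleftrightarrow> z \<^bold>= x \<^bold>\<or> z \<^bold>= y)"

definition is_opair :: "nat \<Rightarrow> nat \<Rightarrow> nat \<Rightarrow> sform" where
  "is_opair p x y = (\<^bold>\<exists>s. \<^bold>\<exists>t. is_upair s x x \<^bold>\<and> is_upair t x y \<^bold>\<and> is_upair p s t)"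

definition maps_to :: "nat \<Rightarrow> nat \<Rightarrow> nat \<Rightarrow> sform" where
  "maps_to f x y = (\<^bold>\<exists>p. is_opair p x y \<^bold>\<and> p \<^bold>\<in> f)"

definition is_function :: "nat \<Rightarrow> nat \<Rightarrow> nat \<Rightarrow> sform" where
  "is_function f a b =
    ((\<^bold>\<forall>p. p \<^bold>\<in> f \<^bold>\<longrightarrow> (\<^bold>\<exists>x. \<^bold>\<exists>y. x \<^bold>\<in> a \<^bold>\<and> y \<^bold>\<in> b \<^bold>\<and> is_opair p x y)) \<^bold>\<and>
     (\<^bold>\<forall>x. x \<^bold>\<in> a \<^bold>\<longrightarrow> (\<^bold>\<exists>!y. maps_to f x y)))"

definition equipotent :: "nat \<Rightarrow> nat \<Rightarrow> sform" where
  "equipotent a b =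
    (\<^bold>\<exists>f. is_function f a b \<^bold>\<and> (\<^bold>\<forall>y. y \<^bold>\<in> b \<^bold>\<longrightarrow> (\<^bold>\<exists>!x. maps_to f x y)))"

definition is_Inter :: "nat \<Rightarrow> nat \<Rightarrow> sform" where
  "is_Inter X S = (\<^bold>\<forall>x. x \<^bold>\<in> X \<^bold>\<longleftrightarrow> (\<^bold>\<forall>Y. Y \<^bold>\<in> S \<^bold>\<longrightarrow> x \<^bold>\<in> Y))"

definition is_Diff :: "nat \<Rightarrow> nat \<Rightarrow> nat \<Rightarrow> sform" where
  "is_Diff Z X Y = (\<^bold>\<forall>x. x \<^bold>\<in> Z \<^bold>\<longleftrightarrow> x \<^bold>\<in> X \<^bold>\<and> \<^bold>\<not> x \<^bold>\<in> Y)"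


section \<open>The axioms of ZFC\<close>

definition extensionality :: sform where
  "extensionality = (\<^bold>\<forall>x. \<^bold>\<forall>y. (\<^bold>\<forall>z. z \<^bold>\<in> x \<^bold>\<longleftrightarrow> z \<^bold>\<in> y) \<^bold>\<longrightarrow> x \<^bold>= y)"

definition foundation :: sform where
  "foundation = (\<^bold>\<forall>x. nonempty x \<^bold>\<longrightarrow> (\<^bold>\<exists>y. y \<^bold>\<in> x \<^bold>\<and> \<^bold>\<not> (\<^bold>\<exists>z. z \<^bold>\<in> x \<^bold>\<and> z \<^bold>\<in> y)))"

definition pairing :: sform where
  "pairing = (\<^bold>\<forall>x. \<^bold>\<forall>y. \<^bold>\<exists>p. is_upair p x y)"

definition union_axiom :: sform where
  "union_axiom = (\<^bold>\<forall>a. \<^bold>\<exists>u. \<^bold>\<forall>x. x \<^bold>\<in> u \<^bold>\<longleftrightarrow> (\<^bold>\<exists>y. y \<^bold>\<in> a \<^bold>\<and> x \<^bold>\<in> y))"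

definition power_set :: sform where
  "power_set = (\<^bold>\<forall>a. \<^bold>\<exists>b. \<^bold>\<forall>x. x \<^bold>\<in> b \<^bold>\<longleftrightarrow> x \<^bold>\<subseteq> a)"

definition infinity :: sform where
  "infinity = (\<^bold>\<exists>w. (\<^bold>\<exists>x. x \<^bold>\<in> w \<^bold>\<and> \<^bold>\<not> nonempty x) \<^bold>\<and>
    (\<^bold>\<forall>x. x \<^bold>\<in> w \<^bold>\<longrightarrow> (\<^bold>\<exists>s. s \<^bold>\<in> w \<^bold>\<and> is_succ s x)))"

definition choice :: sform where
  "choice = (\<^bold>\<forall>a. (\<^bold>\<forall>x. x \<^bold>\<in> a \<^bold>\<longrightarrow> nonempty x) \<^bold>\<longrightarrow>
    (\<^bold>\<exists>f. \<^bold>\<exists>b. is_function f a b \<^bold>\<and> (\<^bold>\<forall>x. \<^bold>\<forall>y. x \<^bold>\<in> a \<^bold>\<and> maps_to f x y \<^bold>\<longrightarrow> y \<^bold>\<in> x)))"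

text \<open>In the two schemes the variables \<open>0, \<dots>, k - 1\<close> of \<open>p\<close> are parameters.\<close>

definition separation :: "nat \<Rightarrow> fm \<Rightarrow> fm" where
  "separation k p = univ_closure k
    (\<^bold>\<forall>a. \<^bold>\<exists>b. \<^bold>\<forall>x. x \<^bold>\<in> b \<^bold>\<longleftrightarrow> x \<^bold>\<in> a \<^bold>\<and> p\<langle>[0..<k] @ [x]\<rangle>)"

definition replacement :: "nat \<Rightarrow> fm \<Rightarrow> fm" where
  "replacement k p = univ_closure k
    ((\<^bold>\<forall>x. \<^bold>\<forall>y. \<^bold>\<forall>z. p\<langle>[0..<k] @ [x, y]\<rangle> \<^bold>\<and> p\<langle>[0..<k] @ [x, z]\<rangle> \<^bold>\<longrightarrow> y \<^bold>= z) \<^bold>\<longrightarrow>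
     (\<^bold>\<forall>a. \<^bold>\<exists>b. \<^bold>\<forall>y. y \<^bold>\<in> b \<^bold>\<longleftrightarrow> (\<^bold>\<exists>x. x \<^bold>\<in> a \<^bold>\<and> p\<langle>[0..<k] @ [x, y]\<rangle>)))"

definition ZFC :: "fm set" where
  "ZFC = {extensionality 0, foundation 0, pairing 0, union_axiom 0, power_set 0, infinity 0, choice 0}
    \<union> {separation k p | k p. fv_below (k + 1) p}
    \<union> {replacement k p | k p. fv_below (k + 2) p}"


section \<open>Ordinals and cardinals\<close>

text \<open>By Foundation, an \<open>\<in>\<close>-linear transitive set is well-ordered by \<open>\<in>\<close>.\<close>

definition ordinal :: "nat \<Rightarrow> sform" where
  "ordinal a = ((\<^bold>\<forall>x. x \<^bold>\<in> a \<^bold>\<longrightarrow> x \<^bold>\<subseteq> a) \<^bold>\<and>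
    (\<^bold>\<forall>x. \<^bold>\<forall>y. x \<^bold>\<in> a \<^bold>\<and> y \<^bold>\<in> a \<^bold>\<longrightarrow> x \<^bold>\<in> y \<^bold>\<or> x \<^bold>= y \<^bold>\<or> y \<^bold>\<in> x))"

definition limit :: "nat \<Rightarrow> sform" where
  "limit a = (ordinal a \<^bold>\<and> nonempty a \<^bold>\<and> (\<^bold>\<forall>x. x \<^bold>\<in> a \<^bold>\<longrightarrow> (\<^bold>\<exists>y. y \<^bold>\<in> a \<^bold>\<and> x \<^bold>\<in> y)))"

definition is_omega :: "nat \<Rightarrow> sform" where
  "is_omega w = (limit w \<^bold>\<and> (\<^bold>\<forall>a. a \<^bold>\<in> w \<^bold>\<longrightarrow> \<^bold>\<not> limit a))"

definition cardinal :: "nat \<Rightarrow> sform" where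
  "cardinal \<kappa> = (ordinal \<kappa> \<^bold>\<and> (\<^bold>\<forall>a. a \<^bold>\<in> \<kappa> \<^bold>\<longrightarrow> \<^bold>\<not> equipotent a \<kappa>))"

definition uncountable_cardinal :: "nat \<Rightarrow> sform" where
  "uncountable_cardinal \<kappa> = (cardinal \<kappa> \<^bold>\<and> (\<^bold>\<exists>w. is_omega w \<^bold>\<and> w \<^bold>\<in> \<kappa>))"

definition is_succ_cardinal :: "nat \<Rightarrow> nat \<Rightarrow> sform" where
  "is_succ_cardinal \<mu> \<kappa> =
    (cardinal \<mu> \<^bold>\<and> \<kappa> \<^bold>\<in> \<mu> \<^bold>\<and> (\<^bold>\<forall>\<nu>. cardinal \<nu> \<^bold>\<and> \<kappa> \<^bold>\<in> \<nu> \<^bold>\<longrightarrow> \<mu> \<^bold>\<subseteq> \<nu>))"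

text \<open>For \<open>\<kappa>\<close> a cardinal this says that \<open>x\<close> has cardinality less than \<open>\<kappa>\<close>.\<close>

definition card_less :: "nat \<Rightarrow> nat \<Rightarrow> sform" where
  "card_less x \<kappa> = (\<^bold>\<exists>a. a \<^bold>\<in> \<kappa> \<^bold>\<and> equipotent a x)"


section \<open>Filters\<close>

definition filter_on :: "nat \<Rightarrow> nat \<Rightarrow> sform" where
  "filter_on F S =
    ((\<^bold>\<forall>X. X \<^bold>\<in> F \<^bold>\<longrightarrow> X \<^bold>\<subseteq> S \<^bold>\<and> nonempty X) \<^bold>\<and> S \<^bold>\<in> F \<^bold>\<and>
     (\<^bold>\<forall>X. \<^bold>\<forall>Y. X \<^bold>\<in> F \<^bold>\<and> X \<^bold>\<subseteq> Y \<^bold>\<and> Y \<^bold>\<subseteq> S \<^bold>\<longrightarrow> Y \<^bold>\<in> F) \<^bold>\<and>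
     (\<^bold>\<forall>X. \<^bold>\<forall>Y. X \<^bold>\<in> F \<^bold>\<and> Y \<^bold>\<in> F \<^bold>\<longrightarrow>
       (\<^bold>\<exists>Z. Z \<^bold>\<in> F \<^bold>\<and> (\<^bold>\<forall>x. x \<^bold>\<in> Z \<^bold>\<longleftrightarrow> x \<^bold>\<in> X \<^bold>\<and> x \<^bold>\<in> Y))))"

definition ultrafilter_on :: "nat \<Rightarrow> nat \<Rightarrow> sform" where
  "ultrafilter_on U S = (filter_on U S \<^bold>\<and>
    (\<^bold>\<forall>X. X \<^bold>\<subseteq> S \<^bold>\<longrightarrow> X \<^bold>\<in> U \<^bold>\<or> (\<^bold>\<exists>Y. Y \<^bold>\<in> U \<^bold>\<and> is_Diff Y S X)))"

definition complete_filter :: "nat \<Rightarrow> nat \<Rightarrow> sform" where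
  "complete_filter \<kappa> F = (\<^bold>\<forall>W. W \<^bold>\<subseteq> F \<^bold>\<and> nonempty W \<^bold>\<and> card_less W \<kappa> \<^bold>\<longrightarrow>
    (\<^bold>\<exists>X. X \<^bold>\<in> F \<^bold>\<and> is_Inter X W))"

definition nonprincipal :: "nat \<Rightarrow> nat \<Rightarrow> sform" where
  "nonprincipal U S = (\<^bold>\<forall>x. x \<^bold>\<in> S \<^bold>\<longrightarrow> \<^bold>\<not> (\<^bold>\<exists>X. X \<^bold>\<in> U \<^bold>\<and> is_upair X x x))"

definition measurable_cardinal :: "nat \<Rightarrow> sform" where
  "measurable_cardinal \<kappa> = (uncountable_cardinal \<kappa> \<^bold>\<and>
    (\<^bold>\<exists>U. ultrafilter_on U \<kappa> \<^bold>\<and> complete_filter \<kappa> U \<^bold>\<and> nonprincipal U \<kappa>))"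

definition is_club :: "nat \<Rightarrow> nat \<Rightarrow> sform" where
  "is_club C \<kappa> = (C \<^bold>\<subseteq> \<kappa> \<^bold>\<and>
    (\<^bold>\<forall>a. a \<^bold>\<in> \<kappa> \<^bold>\<longrightarrow> (\<^bold>\<exists>b. b \<^bold>\<in> C \<^bold>\<and> a \<^bold>\<in> b)) \<^bold>\<and>
    (\<^bold>\<forall>a. a \<^bold>\<in> \<kappa> \<^bold>\<and> limit a \<^bold>\<and> (\<^bold>\<forall>b. b \<^bold>\<in> a \<^bold>\<longrightarrow> (\<^bold>\<exists>c. c \<^bold>\<in> C \<^bold>\<and> c \<^bold>\<in> a \<^bold>\<and> b \<^bold>\<in> c)) \<^bold>\<longrightarrow> a \<^bold>\<in> C))"

definition is_club_filter :: "nat \<Rightarrow> nat \<Rightarrow> sform" where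
  "is_club_filter D \<kappa> =
    (\<^bold>\<forall>X. X \<^bold>\<in> D \<^bold>\<longleftrightarrow> X \<^bold>\<subseteq> \<kappa> \<^bold>\<and> (\<^bold>\<exists>C. is_club C \<kappa> \<^bold>\<and> C \<^bold>\<subseteq> X))"

text \<open>\<open>galvin F \<kappa> \<mu>\<close> is \<open>Gal(F, \<kappa>, \<mu>)\<close>; the indexed family is the function \<open>A\<close>.\<close>

definition galvin :: "nat \<Rightarrow> nat \<Rightarrow> nat \<Rightarrow> sform" where
  "galvin F \<kappa> \<mu> = (\<^bold>\<forall>A. is_function A \<mu> F \<^bold>\<longrightarrow>
    (\<^bold>\<exists>I. I \<^bold>\<subseteq> \<mu> \<^bold>\<and> equipotent \<kappa> I \<^bold>\<and>
      (\<^bold>\<exists>X. X \<^bold>\<in> F \<^bold>\<and>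
        (\<^bold>\<forall>x. x \<^bold>\<in> X \<^bold>\<longleftrightarrow> (\<^bold>\<forall>a. \<^bold>\<forall>Y. a \<^bold>\<in> I \<^bold>\<and> maps_to A a Y \<^bold>\<longrightarrow> x \<^bold>\<in> Y)))))"


section \<open>Supercompact cardinals\<close>

text \<open>\<open>P\<close> is the set of subsets of \<open>l\<close> of cardinality less than \<open>\<kappa>\<close>.\<close>

definition is_Pkl :: "nat \<Rightarrow> nat \<Rightarrow> nat \<Rightarrow> sform" where
  "is_Pkl P \<kappa> l = (\<^bold>\<forall>x. x \<^bold>\<in> P \<^bold>\<longleftrightarrow> x \<^bold>\<subseteq> l \<^bold>\<and> card_less x \<kappa>)"

definition fine :: "nat \<Rightarrow> nat \<Rightarrow> nat \<Rightarrow> sform" where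
  "fine U P l = (\<^bold>\<forall>a. a \<^bold>\<in> l \<^bold>\<longrightarrow>
    (\<^bold>\<exists>X. X \<^bold>\<in> U \<^bold>\<and> (\<^bold>\<forall>x. x \<^bold>\<in> X \<^bold>\<longleftrightarrow> x \<^bold>\<in> P \<^bold>\<and> a \<^bold>\<in> x)))"

text \<open>A function that is regressive (\<open>f(x) \<in> x\<close>) on a set in \<open>U\<close> is constant on a set in \<open>U\<close>.\<close>

definition normal :: "nat \<Rightarrow> nat \<Rightarrow> nat \<Rightarrow> sform" where
  "normal U P l = (\<^bold>\<forall>f. is_function f P l \<^bold>\<and>
    (\<^bold>\<exists>X. X \<^bold>\<in> U \<^bold>\<and> (\<^bold>\<forall>x. x \<^bold>\<in> X \<^bold>\<longleftrightarrow> x \<^bold>\<in> P \<^bold>\<and> (\<^bold>\<exists>y. maps_to f x y \<^bold>\<and> y \<^bold>\<in> x))) \<^bold>\<longrightarrow>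
    (\<^bold>\<exists>a. a \<^bold>\<in> l \<^bold>\<and> (\<^bold>\<exists>X. X \<^bold>\<in> U \<^bold>\<and> (\<^bold>\<forall>x. x \<^bold>\<in> X \<^bold>\<longleftrightarrow> x \<^bold>\<in> P \<^bold>\<and> maps_to f x a))))"

text \<open>The definition through elementary embeddings of the universe is not first-order; the
  following is the standard first-order definition.\<close>

definition supercompact :: "nat \<Rightarrow> sform" where
  "supercompact \<kappa> = (uncountable_cardinal \<kappa> \<^bold>\<and>
    (\<^bold>\<forall>l. ordinal l \<^bold>\<and> \<kappa> \<^bold>\<subseteq> l \<^bold>\<longrightarrow>
      (\<^bold>\<exists>P. \<^bold>\<exists>U. is_Pkl P \<kappa> l \<^bold>\<and> ultrafilter_on U P \<^bold>\<and> complete_filter \<kappa> U \<^bold>\<and>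
        fine U P l \<^bold>\<and> normal U P l)))"


section \<open>The two existence statements\<close>

definition exists_supercompact :: sform where
  "exists_supercompact = (\<^bold>\<exists>\<kappa>. supercompact \<kappa>)"

definition exists_non_Galvin_ultrafilter :: sform where
  "exists_non_Galvin_ultrafilter = (\<^bold>\<exists>\<kappa>. \<^bold>\<exists>U.
    measurable_cardinal \<kappa> \<^bold>\<and> ultrafilter_on U \<kappa> \<^bold>\<and> complete_filter \<kappa> U \<^bold>\<and>
    (\<^bold>\<exists>D. is_club_filter D \<kappa> \<^bold>\<and> D \<^bold>\<subseteq> U) \<^bold>\<and>
    (\<^bold>\<exists>\<mu>. is_succ_cardinal \<mu> \<kappa> \<^bold>\<and> \<^bold>\<not> galvin U \<kappa> \<mu>))"

end

theory Submission
  imports Defs "HOL-Library.Countable"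
begin

text \<open>No forcing is needed: ZFC proves that a supercompact cardinal \<open>\<kappa>\<close> itself carries a
  \<open>\<kappa>\<close>-complete ultrafilter that extends the club filter and is not Galvin. A normal measure on
  \<open>\<kappa>\<close> yields a function on \<open>\<kappa>\<close> all of whose fibres over bounded subsets of \<open>\<kappa>\<^sup>3\<close> are stationary.
  From it, as in Hausdorff's construction, come sets \<open>A\<^sub>\<alpha> \<subseteq> \<kappa>\<close> for \<open>\<alpha> < \<kappa>\<^sup>+\<close> such that the clubs, the
  \<open>A\<^sub>\<alpha>\<close> and the complements of the intersections of \<open>\<kappa>\<close> many of them have the intersection
  property for fewer than \<open>\<kappa>\<close> sets. A fine measure on \<open>P\<^sub>\<kappa>(2\<^sup>\<kappa>)\<close> extends this family to a
  \<open>\<kappa>\<close>-complete ultrafilter, for which \<open>A\<close> refutes the Galvin property. The relative consistency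
  follows by carrying this out in a term model of the first theory, where separation and
  replacement are available for the predicates definable with parameters.\<close>

section \<open>Semantics and soundness\<close>

text \<open>The failure of the Galvin property is built in, since the complement of each
  intersection of \<open>k\<close> many sets of the family is put into the ultrafilter. The burden
  is the intersection property. Fewer than \<open>k\<close> requirements, each naming a club, an
  index and a set \<open>I\<close> of \<open>k\<close> indices, must be met at one point. From each
  \<open>I\<close> one picks an index outside the fewer than \<open>k\<close> named ones; it then
  remains to lie in given clubs and in given sets of the family while avoiding other given ones.
  Hausdorff's trick handles the last two: indices stand for distinct subsets of \<open>k\<close>,
  the differences between fewer than \<open>k\<close> pairs of them show up below one bound, and a
  bounded table records the traces that are to be accepted. A triple is an entry of such a table:
  row, element, membership flag. The clubs are the obstacle. A code for the table has to be found
  inside any given club, so every table needs a stationary set of codes. The cardinal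
  \<open>2^k\<close> enters because the generating family consists of subsets of \<open>k\<close>
  and is indexed by an enumeration of all of them.\<close>

primrec sat :: "('a \<Rightarrow> 'a \<Rightarrow> bool) \<Rightarrow> (nat \<Rightarrow> 'a) \<Rightarrow> fm \<Rightarrow> bool" where
  "sat E e Falsum \<longleftrightarrow> False"
| "sat E e (Mem i j) \<longleftrightarrow> E (e i) (e j)"
| "sat E e (Eq i j) \<longleftrightarrow> e i = e j"
| "sat E e (Imp p q) \<longleftrightarrow> (sat E e p \<longrightarrow> sat E e q)"
| "sat E e (Forall p) \<longleftrightarrow> (\<forall>x. sat E (case_nat x e) p)"

lemma sat_rename: "sat E e (rename r p) = sat E (\<lambda>i. e (r i)) p"
proof (induction p arbitrary: e r)
  case (Forall p)
  have "(\<lambda>i. case_nat x e (case_nat 0 (\<lambda>i. Suc (r i)) i)) = case_nat x (\<lambda>i. e (r i))" for x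
    by (auto split: nat.split)
  then show ?case by (simp add: Forall.IH)
qed auto

lemma case_nat_comp: "(\<lambda>i. e (case i of 0 \<Rightarrow> k | Suc j \<Rightarrow> j)) = case_nat (e k) e"
  by (auto split: nat.split)

lemma soundness:
  assumes "\<Gamma> \<turnstile> p" and "\<forall>q\<in>\<Gamma>. sat E e q"
  shows "sat E e p"
  using assms
proof (induction arbitrary: e)
  case (Contr p \<Gamma>)
  then show ?case by (metis insert_iff sat.simps(1,4))
next
  case (ForallI \<Gamma> p)
  then show ?case by (auto simp: sat_rename)
next
  case (ForallE \<Gamma> p k)
  then show ?case by (simp add: sat_rename case_nat_comp)
next
  case (EqSubst \<Gamma> i j p)
  from EqSubst.IH[of e] EqSubst.prems show ?case by (simp add: sat_rename case_nat_comp)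
qed auto

section \<open>Completeness\<close>

lemma fv_below_mono: "fv_below n p \<Longrightarrow> n \<le> m \<Longrightarrow> fv_below m p"
proof (induction p arbitrary: n m)
  case (Forall p)
  then show ?case by (metis Suc_le_mono fv_below.simps(5))
qed auto

lemma ex_fv_below: "\<exists>n. fv_below n p"
proof (induction p)
  case (Mem i j)
  show ?case by (rule exI[of _ "Suc (i + j)"]) simp
next
  case (Eq i j)
  show ?case by (rule exI[of _ "Suc (i + j)"]) simp
next
  case (Imp p q)
  then obtain m n where "fv_below m p" "fv_below n q" by auto
  then have "fv_below (max m n) (Imp p q)" by (auto intro: fv_below_mono)
  then show ?case ..
next
  case (Forall p)
  then obtain n where "fv_below n p" ..
  then have "fv_below n (Forall p)" by (auto intro: fv_below_mono)
  then show ?case ..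
qed auto

lemma ex_fv_below_finite:
  assumes "finite D"
  shows "\<exists>n. \<forall>p\<in>D. fv_below n p"
  using assms
proof induction
  case (insert q D)
  then obtain n m where "\<forall>p\<in>D. fv_below n p" "fv_below m q"
    using ex_fv_below by blast
  then have "\<forall>p\<in>insert q D. fv_below (max m n) p" by (auto intro: fv_below_mono)
  then show ?case ..
qed auto

lemma rename_cong: "fv_below n p \<Longrightarrow> (\<And>i. i < n \<Longrightarrow> r i = s i) \<Longrightarrow> rename r p = rename s p"
proof (induction p arbitrary: n r s)
  case (Forall p)
  have "rename (case_nat 0 (\<lambda>i. Suc (r i))) p = rename (case_nat 0 (\<lambda>i. Suc (s i))) p"
    by (rule Forall.IH[of "Suc n"]) (use Forall.prems in \<open>auto split: nat.split\<close>)
  then show ?case by simp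
next
  case (Imp p q)
  then show ?case by (metis fv_below.simps(4) rename.simps(4))
qed auto

lemma rename_id [simp]: "rename (\<lambda>i. i) p = p"
proof (induction p)
  case (Forall p)
  have "case_nat 0 (\<lambda>i. Suc i) = (\<lambda>i. i)" by (auto split: nat.split)
  with Forall show ?case by simp
qed auto

lemma rename_rename: "rename r (rename s p) = rename (\<lambda>i. r (s i)) p"
proof (induction p arbitrary: r s)
  case (Forall p)
  have "(\<lambda>i. case_nat 0 (\<lambda>i. Suc (r i)) (case_nat 0 (\<lambda>i. Suc (s i)) i)) = case_nat 0 (\<lambda>i. Suc (r (s i)))"
    by (auto split: nat.split)
  then show ?case by (simp add: Forall.IH)
qed auto

lemma rename_closed: "fv_below 0 p \<Longrightarrow> rename r p = p"
  using rename_cong[of 0 p r "\<lambda>i. i"] by simp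

section \<open>Weakening, compactness and renaming of derivations\<close>

lemma derives_mono: "\<Gamma> \<turnstile> p \<Longrightarrow> \<Gamma> \<subseteq> \<Delta> \<Longrightarrow> \<Delta> \<turnstile> p"
proof (induction arbitrary: \<Delta> rule: derives.induct)
  case (ImpI p \<Gamma> q)
  then show ?case by (meson derives.ImpI insert_mono)
next
  case (Contr p \<Gamma>)
  then show ?case by (meson derives.Contr insert_mono)
next
  case (ForallI \<Gamma> p)
  then show ?case by (meson derives.ForallI image_mono)
qed (blast intro: derives.intros)+

text \<open>Compactness pulls a refutation from the limit of the Henkin chain back to a single
  stage.\<close>

lemma derives_finite: "\<Gamma> \<turnstile> p \<Longrightarrow> \<exists>D. finite D \<and> D \<subseteq> \<Gamma> \<and> D \<turnstile> p"
proof (induction rule: derives.induct)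
  case (Assm p \<Gamma>)
  then show ?case by (intro exI[of _ "{p}"]) (auto intro: derives.Assm)
next
  case (ImpI p \<Gamma> q)
  then obtain D where D: "finite D" "D \<subseteq> insert p \<Gamma>" "D \<turnstile> q" by blast
  have "D - {p} \<turnstile> Imp p q"
    by (rule derives.ImpI, rule derives_mono[OF D(3)]) auto
  with D show ?case by (intro exI[of _ "D - {p}"]) auto
next
  case (ImpE \<Gamma> p q)
  then obtain D D' where "finite D" "D \<subseteq> \<Gamma>" "D \<turnstile> Imp p q" "finite D'" "D' \<subseteq> \<Gamma>" "D' \<turnstile> p" by blast
  then show ?case
    by (intro exI[of _ "D \<union> D'"]) (auto intro: derives.ImpE derives_mono)
next
  case (Contr p \<Gamma>)
  then obtain D where D: "finite D" "D \<subseteq> insert (Imp p Falsum) \<Gamma>" "D \<turnstile> Falsum" by blast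
  have "D - {Imp p Falsum} \<turnstile> p"
    by (rule derives.Contr, rule derives_mono[OF D(3)]) auto
  with D show ?case by (intro exI[of _ "D - {Imp p Falsum}"]) auto
next
  case (ForallI \<Gamma> p)
  then obtain D where D: "finite D" "D \<subseteq> rename Suc ` \<Gamma>" "D \<turnstile> p" by blast
  then obtain D' where "finite D'" "D' \<subseteq> \<Gamma>" "D = rename Suc ` D'"
    by (meson finite_subset_image)
  with D show ?case by (auto intro: derives.ForallI)
next
  case (ForallE \<Gamma> p k)
  then show ?case by (blast intro: derives.ForallE)
next
  case (EqRefl \<Gamma> i)
  show ?case by (intro exI[of _ "{}"]) (auto intro: derives.EqRefl)
next
  case (EqSubst \<Gamma> i j p)
  then obtain D D' where "finite D" "D \<subseteq> \<Gamma>" "D \<turnstile> Eq i j"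
    "finite D'" "D' \<subseteq> \<Gamma>" "D' \<turnstile> rename (case_nat i (\<lambda>i. i)) p" by blast
  then show ?case
    by (intro exI[of _ "D \<union> D'"]) (auto intro: derives.EqSubst derives_mono)
qed

lemma rename_inst: "rename r (rename (case_nat k (\<lambda>i. i)) p) =
    rename (case_nat (r k) (\<lambda>i. i)) (rename (case_nat 0 (\<lambda>i. Suc (r i))) p)"
  unfolding rename_rename by (rule arg_cong[where f="\<lambda>r. rename r p"]) (auto split: nat.split)

lemma derives_rename: "\<Gamma> \<turnstile> p \<Longrightarrow> rename r ` \<Gamma> \<turnstile> rename r p"
proof (induction arbitrary: r rule: derives.induct)
  case (ForallI \<Gamma> p)
  have "rename (case_nat 0 (\<lambda>i. Suc (r i))) ` rename Suc ` \<Gamma> = rename Suc ` rename r ` \<Gamma>"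
    by (simp add: image_image rename_rename)
  with ForallI.IH[of "case_nat 0 (\<lambda>i. Suc (r i))"] show ?case
    by (auto intro: derives.ForallI)
next
  case (ForallE \<Gamma> p k)
  then show ?case unfolding rename_inst by (auto intro: derives.ForallE)
next
  case (EqSubst \<Gamma> i j p)
  from EqSubst.IH(2)[of r] EqSubst.IH(1)[of r] show ?case
    unfolding rename_inst by (auto intro: derives.EqSubst)
next
  case (ImpI p \<Gamma> q)
  from ImpI.IH[of r] show ?case by (auto intro: derives.ImpI)
next
  case (Contr p \<Gamma>)
  from Contr.IH[of r] show ?case by (auto intro: derives.Contr)
qed (auto intro: derives.intros)

lemma derives_cut: "insert p \<Gamma> \<turnstile> q \<Longrightarrow> \<Gamma> \<turnstile> p \<Longrightarrow> \<Gamma> \<turnstile> q"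
  by (meson ImpI ImpE)

text \<open>The fresh index \<open>k\<close> acts as a Henkin constant. The renaming
  \<open>r\<close> moves \<open>k\<close> to 0 and shifts all other indices, so it acts on the
  assumptions like \<open>Suc\<close> and turns the instance at \<open>k\<close> back into
  \<open>p\<close>. A derivation of the instance thus becomes the premise of
  \<open>ForallI\<close>.\<close>

lemma consistent_witness:
  assumes "consistent \<Gamma>" and neg: "Imp (Forall p) Falsum \<in> \<Gamma>"
    and k: "\<And>q. q \<in> \<Gamma> \<Longrightarrow> fv_below k q \<or> fv_below 0 q"
  shows "consistent (insert (Imp (rename (case_nat k (\<lambda>i. i)) p) Falsum) \<Gamma>)"
  unfolding consistent_def
proof
  assume "insert (Imp (rename (case_nat k (\<lambda>i. i)) p) Falsum) \<Gamma> \<turnstile> Falsum"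
  then have d: "\<Gamma> \<turnstile> rename (case_nat k (\<lambda>i. i)) p" by (rule Contr)
  define r where "r = (\<lambda>i. if i = k then 0 else Suc i)"
  have 1: "rename r q = rename Suc q" if "q \<in> \<Gamma>" for q
  proof -
    have "fv_below k q" using k[OF that] fv_below_mono by blast
    then show ?thesis by (rule rename_cong) (simp add: r_def)
  qed
  have "fv_below k (Imp (Forall p) Falsum)" using k[OF neg] fv_below_mono by blast
  then have kp: "fv_below (Suc k) p" by simp
  have "rename r (rename (case_nat k (\<lambda>i. i)) p) = rename (\<lambda>i. i) p"
    unfolding rename_rename by (rule rename_cong[OF kp]) (auto simp: r_def split: nat.split)
  with derives_rename[OF d, of r] 1 have "rename Suc ` \<Gamma> \<turnstile> p" by simp
  then have "\<Gamma> \<turnstile> Forall p" by (rule ForallI)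
  with neg have "\<Gamma> \<turnstile> Falsum" by (meson Assm ImpE)
  with assms(1) show False by (simp add: consistent_def)
qed

text \<open>Variables themselves serve as Henkin constants. A theory of sentences uses none of them
  freely, so the language need not be extended.\<close>

definition henkin :: "fm set \<Rightarrow> bool" where
  "henkin H \<longleftrightarrow> consistent H \<and> (\<forall>p. p \<in> H \<or> insert p H \<turnstile> Falsum) \<and>
    (\<forall>p. Imp (Forall p) Falsum \<in> H \<longrightarrow> (\<exists>k. Imp (rename (case_nat k (\<lambda>i. i)) p) Falsum \<in> H))"

instance fm :: countable by countable_datatype

text \<open>Stage \<open>n\<close> decides the formula with number \<open>n\<close>, and if it
  accepts a negated universal formula it adds a counterexample at once. Only finitely many formulas
  have been added to the sentences of \<open>T\<close> by then, so a fresh index is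
  available.\<close>

lemma ex_henkin:
  assumes con: "consistent T" and closed: "\<And>p. p \<in> T \<Longrightarrow> fv_below 0 p"
  shows "\<exists>H. T \<subseteq> H \<and> henkin H"
proof -
  let ?ok = "\<lambda>p D D'. finite D' \<and> D \<subseteq> D' \<and> consistent (T \<union> D') \<and> (p \<in> D' \<or> insert p (T \<union> D) \<turnstile> Falsum) \<and>
      (\<forall>q. p = Imp (Forall q) Falsum \<and> p \<in> D' \<longrightarrow> (\<exists>k. Imp (rename (case_nat k (\<lambda>i. i)) q) Falsum \<in> D'))"
  have step: "\<exists>D'. ?ok p D D'" if fin: "finite D" and cD: "consistent (T \<union> D)" for p D
  proof (cases "consistent (T \<union> insert p D)")
    case False
    then have bad: "insert p (T \<union> D) \<turnstile> Falsum" by (simp add: consistent_def)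
    then have "p \<notin> D" using cD by (auto simp: consistent_def insert_absorb)
    with bad fin cD show ?thesis by blast
  next
    case True
    show ?thesis
    proof (cases "\<exists>q. p = Imp (Forall q) Falsum")
      case False
      with True fin show ?thesis by (intro exI[of _ "insert p D"]) auto
    next
      case True': True
      then obtain q where q: "p = Imp (Forall q) Falsum" ..
      obtain k where k: "\<forall>p\<in>insert p D. fv_below k p"
        using ex_fv_below_finite[of "insert p D"] fin by auto
      have "consistent (insert (Imp (rename (case_nat k (\<lambda>i. i)) q) Falsum) (T \<union> insert p D))"
        by (rule consistent_witness[OF True]) (use q k closed in auto)
      with q fin show ?thesis
        by (intro exI[of _ "insert (Imp (rename (case_nat k (\<lambda>i. i)) q) Falsum) (insert p D)"]) auto
    qed
  qed
  have "\<exists>f. \<forall>n. (finite (f n) \<and> consistent (T \<union> f n)) \<and> ?ok (from_nat n) (f n) (f (Suc n))"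
  proof (rule dependent_nat_choice)
    show "\<exists>D. finite D \<and> consistent (T \<union> D)" using con by (intro exI[of _ "{}"]) auto
  next
    fix D n
    assume "finite D \<and> consistent (T \<union> D)"
    then show "\<exists>D'. (finite D' \<and> consistent (T \<union> D')) \<and> ?ok (from_nat n) D D'"
      using step[of D "from_nat n"] by blast
  qed
  then obtain f where f: "\<And>n. consistent (T \<union> f n)" and ok: "\<And>n. ?ok (from_nat n) (f n) (f (Suc n))"
    by blast
  have mono: "m \<le> n \<Longrightarrow> f m \<subseteq> f n" for m n
    by (rule lift_Suc_mono_le) (use ok in auto)
  define H where "H = T \<union> (\<Union>n. f n)"
  have sub: "T \<union> f n \<subseteq> H" for n by (auto simp: H_def)
  have fin: "\<exists>n. D \<subseteq> T \<union> f n" if "finite D" "D \<subseteq> H" for D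
    using that
  proof induction
    case (insert q D)
    then obtain n where n: "D \<subseteq> T \<union> f n" by auto
    from insert.prems obtain m where "q \<in> T \<union> f m" by (auto simp: H_def)
    with n mono[of n "max m n"] mono[of m "max m n"] have "insert q D \<subseteq> T \<union> f (max m n)" by auto
    then show ?case ..
  qed auto
  have "consistent H"
    unfolding consistent_def
  proof
    assume "H \<turnstile> Falsum"
    then obtain D where "finite D" "D \<subseteq> H" "D \<turnstile> Falsum" using derives_finite by blast
    with fin f show False by (meson consistent_def derives_mono)
  qed
  moreover have "p \<in> H \<or> insert p H \<turnstile> Falsum" for p
  proof -
    have "p \<in> f (Suc (to_nat p)) \<or> insert p (T \<union> f (to_nat p)) \<turnstile> Falsum"
      using ok[of "to_nat p"] by simp
    then show ?thesis using sub by (meson derives_mono insert_mono subsetD UnI2)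
  qed
  moreover have "\<exists>k. Imp (rename (case_nat k (\<lambda>i. i)) p) Falsum \<in> H" if pH: "Imp (Forall p) Falsum \<in> H" for p
  proof -
    let ?q = "Imp (Forall p) Falsum"
    \<comment> \<open>A member of \<open>H\<close> was not refuted at its own stage, so it was
      accepted there together with a witness.\<close>
    have "\<not> insert ?q (T \<union> f (to_nat ?q)) \<turnstile> Falsum"
      using \<open>consistent H\<close> pH sub[of "to_nat ?q"] unfolding consistent_def
      by (meson derives_mono insert_subset)
    then show ?thesis using ok[of "to_nat ?q"] sub by fastforce
  qed
  ultimately show ?thesis unfolding henkin_def using sub by (intro exI[of _ H]) auto
qed

section \<open>Henkin sets and truth in the term model\<close>

lemma henkin_derives: "henkin H \<Longrightarrow> H \<turnstile> p \<Longrightarrow> p \<in> H"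
  unfolding henkin_def consistent_def using derives_cut by blast

lemma henkin_Falsum: "henkin H \<Longrightarrow> Falsum \<notin> H"
  unfolding henkin_def consistent_def using Assm by blast

lemma henkin_Imp:
  assumes "henkin H"
  shows "Imp p q \<in> H \<longleftrightarrow> (p \<in> H \<longrightarrow> q \<in> H)"
proof
  assume "Imp p q \<in> H"
  then show "p \<in> H \<longrightarrow> q \<in> H" using henkin_derives[OF assms] by (meson Assm ImpE)
next
  assume pq: "p \<in> H \<longrightarrow> q \<in> H"
  have "insert p H \<turnstile> q"
  proof (cases "p \<in> H")
    case True
    with pq show ?thesis by (auto intro: Assm)
  next
    case False
    then have "insert p H \<turnstile> Falsum" using assms by (auto simp: henkin_def)
    then show ?thesis by (meson Contr derives_mono subset_insertI)
  qed
  then show "Imp p q \<in> H" using henkin_derives[OF assms] ImpI by blast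
qed

lemma henkin_Forall:
  assumes "henkin H"
  shows "Forall p \<in> H \<longleftrightarrow> (\<forall>k. rename (case_nat k (\<lambda>i. i)) p \<in> H)"
proof
  assume "Forall p \<in> H"
  then show "\<forall>k. rename (case_nat k (\<lambda>i. i)) p \<in> H"
    by (auto intro: henkin_derives[OF assms] ForallE Assm)
next
  assume "\<forall>k. rename (case_nat k (\<lambda>i. i)) p \<in> H"
  then have "Imp (Forall p) Falsum \<notin> H"
    using assms henkin_Falsum[OF assms] henkin_Imp[OF assms] unfolding henkin_def by blast
  then show "Forall p \<in> H" using henkin_Imp[OF assms] by blast
qed

lemma henkin_Eq:
  assumes "henkin H"
  shows "Eq i i \<in> H"
    and "Eq i j \<in> H \<Longrightarrow> rename (case_nat i (\<lambda>i. i)) p \<in> H \<Longrightarrow> rename (case_nat j (\<lambda>i. i)) p \<in> H"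
    and "Eq i j \<in> H \<Longrightarrow> Eq j i \<in> H"
    and "Eq i j \<in> H \<Longrightarrow> Eq j k \<in> H \<Longrightarrow> Eq i k \<in> H"
    and "Eq i i' \<in> H \<Longrightarrow> Eq j j' \<in> H \<Longrightarrow> Mem i j \<in> H \<Longrightarrow> Mem i' j' \<in> H"
proof -
  show refl: "Eq i i \<in> H" for i using henkin_derives[OF assms] EqRefl by blast
  show subst: "Eq i j \<in> H \<Longrightarrow> rename (case_nat i (\<lambda>i. i)) p \<in> H \<Longrightarrow> rename (case_nat j (\<lambda>i. i)) p \<in> H" for i j p
    by (rule henkin_derives[OF assms], rule EqSubst[of H i j]) (auto intro: Assm)
  \<comment> \<open>In the pattern, index 0 marks the place where \<open>i\<close> is replaced by
    \<open>j\<close>; the indices that stay are shifted by \<open>Suc\<close>.\<close>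
  show sym: "Eq i j \<in> H \<Longrightarrow> Eq j i \<in> H" for i j
    using subst[of i j "Eq 0 (Suc i)"] refl[of i] by simp
  show "Eq i j \<in> H \<Longrightarrow> Eq j k \<in> H \<Longrightarrow> Eq i k \<in> H"
    using subst[of j k "Eq (Suc i) 0"] by simp
  show "Eq i i' \<in> H \<Longrightarrow> Eq j j' \<in> H \<Longrightarrow> Mem i j \<in> H \<Longrightarrow> Mem i' j' \<in> H"
    using subst[of i i' "Mem 0 (Suc j)"] subst[of j j' "Mem (Suc i') 0"] by simp
qed

text \<open>The environment is split into a renaming \<open>r\<close> followed by
  \<open>cls\<close>. The quantifier step, which picks a class, is then absorbed by extending
  \<open>r\<close>.\<close>

lemma henkin_truth:
  assumes H: "henkin H" and surj: "surj cls"
    and eq: "\<And>i j. cls i = cls j \<longleftrightarrow> Eq i j \<in> H"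
    and mem: "\<And>i j. E (cls i) (cls j) \<longleftrightarrow> Mem i j \<in> H"
  shows "sat E (\<lambda>i. cls (r i)) p \<longleftrightarrow> rename r p \<in> H"
proof (induction p arbitrary: r)
  case Falsum
  show ?case using henkin_Falsum[OF H] by simp
next
  case (Imp p q)
  then show ?case using henkin_Imp[OF H] by simp
next
  case (Forall p)
  have "(\<forall>x. sat E (case_nat x (\<lambda>i. cls (r i))) p) \<longleftrightarrow> (\<forall>k. sat E (case_nat (cls k) (\<lambda>i. cls (r i))) p)"
    using surj by (metis surjD)
  also have "\<dots> \<longleftrightarrow> (\<forall>k. sat E (\<lambda>i. cls (case_nat k r i)) p)"
  proof -
    have "case_nat (cls k) (\<lambda>i. cls (r i)) = (\<lambda>i. cls (case_nat k r i))" for k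
      by (auto split: nat.split)
    then show ?thesis by simp
  qed
  also have "\<dots> \<longleftrightarrow> (\<forall>k. rename (case_nat k (\<lambda>i. i)) (rename (case_nat 0 (\<lambda>i. Suc (r i))) p) \<in> H)"
  proof -
    have "(\<lambda>i. case_nat k (\<lambda>i. i) (case_nat 0 (\<lambda>i. Suc (r i)) i)) = case_nat k r" for k
      by (auto split: nat.split)
    then show ?thesis by (simp add: Forall.IH rename_rename)
  qed
  finally show ?case using henkin_Forall[OF H] by simp
qed (use eq mem in auto)

text \<open>The domain of a model depends on the theory, so one fixed type can serve as a domain only
  for one fixed theory.\<close>

definition supercompact_theory :: "fm set" where
  "supercompact_theory = ZFC \<union> {exists_supercompact 0}"

text \<open>The choice is made outside any hypothesis because the type below must exist
  unconditionally; for an inconsistent theory its value is arbitrary.\<close>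

definition term_theory :: "fm set" where
  "term_theory = (SOME H. supercompact_theory \<subseteq> H \<and> henkin H)"

typedef term_model = "range (\<lambda>i. {j. Eq i j \<in> term_theory})"
  by auto

definition term_class :: "nat \<Rightarrow> term_model" where
  "term_class i = Abs_term_model {j. Eq i j \<in> term_theory}"

definition term_mem :: "term_model \<Rightarrow> term_model \<Rightarrow> bool" where
  "term_mem x y \<longleftrightarrow> (\<exists>i j. x = term_class i \<and> y = term_class j \<and> Mem i j \<in> term_theory)"

lemma term_model:
  assumes "consistent supercompact_theory" and closed: "\<And>p. p \<in> supercompact_theory \<Longrightarrow> fv_below 0 p"
    and p: "p \<in> supercompact_theory"
  shows "sat term_mem e p"
proof -
  have H: "supercompact_theory \<subseteq> term_theory" "henkin term_theory"
    using someI_ex[OF ex_henkin[OF assms(1) closed]] unfolding term_theory_def by auto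
  have eq: "term_class i = term_class j \<longleftrightarrow> Eq i j \<in> term_theory" for i j
  proof -
    have "term_class i = term_class j \<longleftrightarrow> {k. Eq i k \<in> term_theory} = {k. Eq j k \<in> term_theory}"
      unfolding term_class_def by (rule Abs_term_model_inject) auto
    also have "\<dots> \<longleftrightarrow> Eq i j \<in> term_theory"
    proof
      assume "{k. Eq i k \<in> term_theory} = {k. Eq j k \<in> term_theory}"
      then show "Eq i j \<in> term_theory" using henkin_Eq(1)[OF H(2), of j] by blast
    next
      assume "Eq i j \<in> term_theory"
      then show "{k. Eq i k \<in> term_theory} = {k. Eq j k \<in> term_theory}"
        by (metis henkin_Eq(3,4)[OF H(2)])
    qed
    finally show ?thesis .
  qed
  have surj: "surj term_class"
  proof (rule surjI)
    fix x
    have "\<exists>i. Rep_term_model x = {j. Eq i j \<in> term_theory}" using Rep_term_model[of x] by auto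
    then have "\<exists>i. term_class i = x" unfolding term_class_def by (metis Rep_term_model_inverse)
    then show "term_class (SOME i. term_class i = x) = x" by (rule someI_ex)
  qed
  have mem: "term_mem (term_class i) (term_class j) \<longleftrightarrow> Mem i j \<in> term_theory" for i j
    unfolding term_mem_def eq by (metis henkin_Eq(1,3,5)[OF H(2)])
  \<comment> \<open>Surjectivity makes every environment a renaming followed by
    \<open>term_class\<close>, and a sentence is fixed by every renaming.\<close>
  obtain r where "e = (\<lambda>i. term_class (r i))"
    using that[of "\<lambda>i. inv term_class (e i)"] surj by (simp add: surj_f_inv_f)
  then show ?thesis
    using henkin_truth[OF H(2) surj eq mem, of r p] rename_closed[OF closed[OF p]] p H(1) by auto
qed

section \<open>Evaluation of formulas with named variables\<close>

text \<open>Indices shift under a binder, levels do not. With \<open>lk_new\<close> and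
  \<open>lk_old\<close> the simplifier can therefore evaluate nested quantifiers.\<close>

definition lk :: "(nat \<Rightarrow> 'a) \<Rightarrow> nat \<Rightarrow> nat \<Rightarrow> 'a" where
  "lk e n x = e (n - 1 - x)"

named_theorems sats

lemma lk_new [sats]: "lk (case_nat a e) (Suc n) n = a"
  by (simp add: lk_def)

lemma lk_old [sats]: "x < n \<Longrightarrow> lk (case_nat a e) (Suc n) x = lk e n x"
  by (auto simp: lk_def split: nat.split intro!: arg_cong[where f=e])

lemma sat_fmem [sats]: "sat E e ((x \<^bold>\<in> y) n) \<longleftrightarrow> E (lk e n x) (lk e n y)"
  by (simp add: fmem_def lk_def)

lemma sat_feq [sats]: "sat E e ((x \<^bold>= y) n) \<longleftrightarrow> lk e n x = lk e n y"
  by (simp add: feq_def lk_def)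

lemma sat_fimp [sats]: "sat E e ((P \<^bold>\<longrightarrow> Q) n) \<longleftrightarrow> (sat E e (P n) \<longrightarrow> sat E e (Q n))"
  by (simp add: fimp_def)

lemma sat_fnot [sats]: "sat E e ((\<^bold>\<not> P) n) \<longleftrightarrow> \<not> sat E e (P n)"
  by (simp add: fnot_def)

lemma sat_fconj [sats]: "sat E e ((P \<^bold>\<and> Q) n) \<longleftrightarrow> sat E e (P n) \<and> sat E e (Q n)"
  by (simp add: fconj_def sats)

lemma sat_fdisj [sats]: "sat E e ((P \<^bold>\<or> Q) n) \<longleftrightarrow> sat E e (P n) \<or> sat E e (Q n)"
  by (auto simp add: fdisj_def sats)

lemma sat_fiff [sats]: "sat E e ((P \<^bold>\<longleftrightarrow> Q) n) \<longleftrightarrow> (sat E e (P n) \<longleftrightarrow> sat E e (Q n))"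
  by (auto simp add: fiff_def sats)

lemma sat_fall [sats]: "sat E e ((\<^bold>\<forall>x. P x) n) \<longleftrightarrow> (\<forall>a. sat E (case_nat a e) (P n (Suc n)))"
  by (simp add: fall_def)

lemma sat_fex [sats]: "sat E e ((\<^bold>\<exists>x. P x) n) \<longleftrightarrow> (\<exists>a. sat E (case_nat a e) (P n (Suc n)))"
  by (simp add: fex_def sats)

lemma sat_fex1 [sats]: "sat E e ((\<^bold>\<exists>!x. P x) n) \<longleftrightarrow> (\<exists>a. sat E (case_nat a e) (P n (Suc n)) \<and>
    (\<forall>b. sat E (case_nat b (case_nat a e)) (P (Suc n) (Suc (Suc n))) \<longrightarrow> b = a))"
  by (simp add: fex1_def sats)

lemma sat_finst: "sat E e (p\<langle>xs\<rangle> n) \<longleftrightarrow> sat E (\<lambda>i. lk e n (xs ! i)) p"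
  by (simp add: finst_def sat_rename lk_def)

lemma sat_univ_closure:
  assumes "\<And>e. sat E e (univ_closure k P)"
  shows "sat E e (P k)"
proof -
  have *: "(\<And>e. sat E e ((Forall ^^ m) p)) \<Longrightarrow> sat E e p" for m p e
  proof (induction m arbitrary: p e)
    case (Suc m)
    have "sat E e (Forall p)" for e
      by (rule Suc.IH) (use Suc.prems in \<open>simp add: funpow_swap1\<close>)
    then have "sat E (\<lambda>i. e (Suc i)) (Forall p)" by blast
    then have "sat E (case_nat (e 0) (\<lambda>i. e (Suc i))) p" by auto
    moreover have "case_nat (e 0) (\<lambda>i. e (Suc i)) = e" by (auto split: nat.split)
    ultimately show ?case by simp
  qed simp
  show ?thesis by (rule *[OF assms[unfolded univ_closure_def]])
qed

lemma sat_cong: "fv_below n p \<Longrightarrow> (\<And>i. i < n \<Longrightarrow> e i = e' i) \<Longrightarrow> sat E e p = sat E e' p"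
proof (induction p arbitrary: n e e')
  case (Forall p)
  have "sat E (case_nat x e) p = sat E (case_nat x e') p" for x
    by (rule Forall.IH[of "Suc n"]) (use Forall.prems in \<open>auto split: nat.split\<close>)
  then show ?case by simp
next
  case (Imp p q)
  then show ?case by (metis fv_below.simps(4) sat.simps(4))
qed auto

lemma fv_below_rename: "fv_below m p \<Longrightarrow> (\<And>i. i < m \<Longrightarrow> r i < n) \<Longrightarrow> fv_below n (rename r p)"
proof (induction p arbitrary: m n r)
  case (Forall p)
  have "fv_below (Suc n) (rename (case_nat 0 (\<lambda>i. Suc (r i))) p)"
    by (rule Forall.IH[of "Suc m"]) (use Forall.prems in \<open>auto split: nat.split\<close>)
  then show ?case by simp
next
  case (Imp p q)
  then show ?case by (metis fv_below.simps(4) rename.simps(4))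
qed auto

section \<open>Definability with parameters\<close>

text \<open>An assignment sends each variable of a formula either to a parameter or to a variable of the
  defined predicate.\<close>

definition val :: "(nat \<Rightarrow> 'a + nat) \<Rightarrow> (nat \<Rightarrow> 'a) \<Rightarrow> nat \<Rightarrow> 'a" where
  "val s e i = case_sum (\<lambda>c. c) e (s i)"

locale membership =
  fixes E :: "'a \<Rightarrow> 'a \<Rightarrow> bool"  (infix "\<epsilon>" 50)
begin

text \<open>The axiom schemes hold for definable predicates only, while HOL has many more on the
  domain. This is the side condition under which the schemes are applied. The argument is a whole
  environment, so that nested binders can be treated by shifting indices.\<close>

definition dfb :: "((nat \<Rightarrow> 'a) \<Rightarrow> bool) \<Rightarrow> bool" where
  "dfb P \<longleftrightarrow> (\<exists>p s. \<forall>e. P e \<longleftrightarrow> sat E (val s e) p)"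

text \<open>A term is definable if its graph is; the value sits at index 0, where
  \<open>dfb_ex\<close> can quantify over it.\<close>

definition dft :: "((nat \<Rightarrow> 'a) \<Rightarrow> 'a) \<Rightarrow> bool" where
  "dft t \<longleftrightarrow> dfb (\<lambda>e. e 0 = t (\<lambda>i. e (Suc i)))"

lemma dfb_mem_var: "dfb (\<lambda>e. e i \<epsilon> e j)"
  unfolding dfb_def
  by (rule exI[of _ "Mem 0 1"], rule exI[of _ "\<lambda>k. Inr (if k = 0 then i else j)"]) (simp add: val_def)

lemma dfb_eq_var: "dfb (\<lambda>e. e i = e j)"
  unfolding dfb_def
  by (rule exI[of _ "Eq 0 1"], rule exI[of _ "\<lambda>k. Inr (if k = 0 then i else j)"]) (simp add: val_def)

lemma dft_var: "dft (\<lambda>e. e i)"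
  unfolding dft_def by (rule dfb_eq_var)

lemma dft_const: "dft (\<lambda>e. c)"
  unfolding dft_def dfb_def
  by (rule exI[of _ "Eq 0 1"], rule exI[of _ "\<lambda>k. if k = 0 then Inr 0 else Inl c"]) (simp add: val_def)

lemma dfb_const: "dfb (\<lambda>e. b)"
  unfolding dfb_def
  by (rule exI[of _ "if b then Imp Falsum Falsum else Falsum"]) simp

lemma dfb_imp:
  assumes "dfb P" "dfb Q"
  shows "dfb (\<lambda>e. P e \<longrightarrow> Q e)"
proof -
  obtain p s q t where p: "\<And>e. P e \<longleftrightarrow> sat E (val s e) p" and q: "\<And>e. Q e \<longleftrightarrow> sat E (val t e) q"
    using assms unfolding dfb_def by blast
  \<comment> \<open>The two assignments are interleaved: even variables belong to \<open>p\<close>,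
    odd ones to \<open>q\<close>.\<close>
  define u where "u i = (if even i then s (i div 2) else t (i div 2))" for i
  have 1: "val s e = (\<lambda>i. val u e (2 * i))" "val t e = (\<lambda>i. val u e (Suc (2 * i)))" for e
    by (auto simp: val_def u_def)
  have "\<forall>e. (P e \<longrightarrow> Q e) \<longleftrightarrow> sat E (val u e) (Imp (rename (\<lambda>i. 2 * i) p) (rename (\<lambda>i. Suc (2 * i)) q))"
    by (simp add: p q 1 sat_rename)
  then show ?thesis unfolding dfb_def by blast
qed

lemma dfb_not: "dfb P \<Longrightarrow> dfb (\<lambda>e. \<not> P e)"
  using dfb_imp[of P "\<lambda>_. False"] dfb_const[of False] by simp

lemma dfb_disj: "dfb P \<Longrightarrow> dfb Q \<Longrightarrow> dfb (\<lambda>e. P e \<or> Q e)"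
  using dfb_imp[OF dfb_not, of P Q] by (simp add: disj_imp)

lemma dfb_conj: "dfb P \<Longrightarrow> dfb Q \<Longrightarrow> dfb (\<lambda>e. P e \<and> Q e)"
  using dfb_not[OF dfb_disj[OF dfb_not dfb_not], of P Q] by simp

lemma dfb_iff: "dfb P \<Longrightarrow> dfb Q \<Longrightarrow> dfb (\<lambda>e. P e \<longleftrightarrow> Q e)"
  using dfb_conj[OF dfb_imp[of P Q] dfb_imp[of Q P]] by (simp add: iff_conv_conj_imp)

lemma dfb_reindex:
  assumes "dfb P"
  shows "dfb (\<lambda>e. P (\<lambda>i. e (r i)))"
proof -
  obtain p s where p: "\<And>e. P e \<longleftrightarrow> sat E (val s e) p"
    using assms unfolding dfb_def by blast
  have "val s (\<lambda>i. e (r i)) = val (\<lambda>i. map_sum (\<lambda>c. c) r (s i)) e" for e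
    by (auto simp: val_def split: sum.split)
  with p have "\<forall>e. P (\<lambda>i. e (r i)) \<longleftrightarrow> sat E (val (\<lambda>i. map_sum (\<lambda>c. c) r (s i)) e) p"
    by simp
  then show ?thesis unfolding dfb_def by blast
qed

lemma dfb_all:
  assumes "dfb (\<lambda>e. P (e 0) (\<lambda>i. e (Suc i)))"
  shows "dfb (\<lambda>e. \<forall>x. P x e)"
proof -
  obtain p s where p: "\<And>e. P (e 0) (\<lambda>i. e (Suc i)) \<longleftrightarrow> sat E (val s e) p"
    using assms unfolding dfb_def by blast
  \<comment> \<open>Several variables of \<open>p\<close> may be assigned to index 0; all of them
    are merged into the one bound variable.\<close>
  define r where "r i = (if s i = Inr 0 then 0 else Suc i)" for i
  define u where "u i = (case s i of Inl c \<Rightarrow> Inl c | Inr j \<Rightarrow> Inr (j - 1))" for i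
  have "(\<lambda>i. case_nat x (val u e) (r i)) = val s (case_nat x e)" for x e
    by (auto simp: val_def r_def u_def fun_eq_iff split: sum.split nat.split)
  with p[of "case_nat _ _"] have "\<forall>e. (\<forall>x. P x e) \<longleftrightarrow> sat E (val u e) (Forall (rename r p))"
    by (simp add: sat_rename)
  then show ?thesis unfolding dfb_def by blast
qed

lemma dfb_ex:
  assumes "dfb (\<lambda>e. P (e 0) (\<lambda>i. e (Suc i)))"
  shows "dfb (\<lambda>e. \<exists>x. P x e)"
  using dfb_not[OF dfb_all[of "\<lambda>x e. \<not> P x e"], OF dfb_not[OF assms]] by simp

lemma dft_reindex: "dft t \<Longrightarrow> dft (\<lambda>e. t (\<lambda>i. e (r i)))"
  unfolding dft_def
  by (drule dfb_reindex[where r="case_nat 0 (\<lambda>i. Suc (r i))"]) simp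

lemma dfb_subst:
  assumes "dfb (\<lambda>e. P (e 0) (\<lambda>i. e (Suc i)))" "dft t"
  shows "dfb (\<lambda>e. P (t e) e)"
  using dfb_ex[of "\<lambda>x e. x = t e \<and> P x e"] dfb_conj[OF assms(2)[unfolded dft_def] assms(1)] by simp

lemma dft_subst:
  assumes "dft (\<lambda>e. T (e 0) (\<lambda>i. e (Suc i)))" "dft t"
  shows "dft (\<lambda>e. T (t e) e)"
  unfolding dft_def
proof (rule dfb_subst[where P="\<lambda>x e. e 0 = T x (\<lambda>i. e (Suc i))"])
  show "dft (\<lambda>e. t (\<lambda>i. e (Suc i)))" using assms(2) by (rule dft_reindex)
  show "dfb (\<lambda>e. e (Suc 0) = T (e 0) (\<lambda>i. e (Suc (Suc i))))"
    using dfb_reindex[OF assms(1)[unfolded dft_def], of "\<lambda>i. case i of 0 \<Rightarrow> Suc 0 | Suc 0 \<Rightarrow> 0 | Suc (Suc j) \<Rightarrow> Suc (Suc j)"]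
    by simp
qed

text \<open>By this rule and its analogues for more arguments and for terms, a newly defined notion
  is checked at variables only; definability at arbitrary definable terms follows.\<close>

lemma dfb1:
  assumes "dfb (\<lambda>e. P (e 0))" "dft a"
  shows "dfb (\<lambda>e. P (a e))"
  using dfb_subst[of "\<lambda>x e. P x"] assms by simp

lemma dfb2:
  assumes "dfb (\<lambda>e. P (e 0) (e (Suc 0)))" "dft a" "dft b"
  shows "dfb (\<lambda>e. P (a e) (b e))"
proof (rule dfb_subst[of "\<lambda>x e. P x (b e)"])
  show "dfb (\<lambda>e. P (e 0) (b (\<lambda>i. e (Suc i))))"
    by (rule dfb_subst[of "\<lambda>y e. P (e 0) y"])
      (use assms dfb_reindex[OF assms(1), of "\<lambda>i. 1 - i"] dft_reindex[of b Suc] in auto)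
qed (rule assms)

lemma dfb3:
  assumes "dfb (\<lambda>e. P (e 0) (e (Suc 0)) (e (Suc (Suc 0))))" "dft a" "dft b" "dft c"
  shows "dfb (\<lambda>e. P (a e) (b e) (c e))"
proof (rule dfb_subst[of "\<lambda>x e. P x (b e) (c e)"])
  show "dfb (\<lambda>e. P (e 0) (b (\<lambda>i. e (Suc i))) (c (\<lambda>i. e (Suc i))))"
  proof (rule dfb_subst[of "\<lambda>y e. P (e 0) y (c (\<lambda>i. e (Suc i)))"])
    show "dfb (\<lambda>e. P (e (Suc 0)) (e 0) (c (\<lambda>i. e (Suc (Suc i)))))"
      by (rule dfb_subst[of "\<lambda>z e. P (e (Suc 0)) (e 0) z"])
        (use dfb_reindex[OF assms(1), of "\<lambda>i. 2 - i"] dft_reindex[OF assms(4), of "\<lambda>i. Suc (Suc i)"] in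
          \<open>auto simp: numeral_2_eq_2\<close>)
  qed (use dft_reindex[of b Suc] assms in auto)
qed (rule assms)

lemma dft1:
  assumes "dft (\<lambda>e. F (e 0))" "dft a"
  shows "dft (\<lambda>e. F (a e))"
  using dft_subst[of "\<lambda>x e. F x"] assms by simp

lemma dft2:
  assumes "dft (\<lambda>e. F (e 0) (e (Suc 0)))" "dft a" "dft b"
  shows "dft (\<lambda>e. F (a e) (b e))"
proof (rule dft_subst[of "\<lambda>x e. F x (b e)"])
  show "dft (\<lambda>e. F (e 0) (b (\<lambda>i. e (Suc i))))"
    by (rule dft_subst[of "\<lambda>y e. F (e 0) y"])
      (use assms dft_reindex[OF assms(1), of "\<lambda>i. 1 - i"] dft_reindex[of b Suc] in auto)
qed (rule assms)

lemma dfb_mem: "dft a \<Longrightarrow> dft b \<Longrightarrow> dfb (\<lambda>e. a e \<epsilon> b e)"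
  by (rule dfb2[of "(\<epsilon>)"]) (rule dfb_mem_var)

lemma dfb_eq: "dft a \<Longrightarrow> dft b \<Longrightarrow> dfb (\<lambda>e. a e = b e)"
  by (rule dfb2[of "(=)"]) (rule dfb_eq_var)

lemma dfb_ex1:
  assumes "dfb (\<lambda>e. P (e 0) (\<lambda>i. e (Suc i)))"
  shows "dfb (\<lambda>e. \<exists>!x. P x e)"
proof -
  have "dfb (\<lambda>e. P (e 0) (\<lambda>i. e (Suc (Suc i))))"
    using dfb_reindex[OF assms, of "case_nat 0 (\<lambda>i. Suc (Suc i))"] by simp
  then show ?thesis unfolding Ex1_def
    by (intro dfb_ex dfb_conj dfb_all dfb_imp dfb_eq_var assms)
qed

section \<open>Definite descriptions, Separation and Replacement as definable terms\<close>

definition emp :: 'a where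
  "emp = (THE x. \<forall>z. \<not> z \<epsilon> x)"

text \<open>A definite description with a fixed default value, so that it is definable together with
  its body.\<close>

definition the1 :: "('a \<Rightarrow> bool) \<Rightarrow> 'a" where
  "the1 P = (if \<exists>!x. P x then THE x. P x else emp)"

lemma the1_eq: "P a \<Longrightarrow> (\<And>x. P x \<Longrightarrow> x = a) \<Longrightarrow> the1 P = a"
  unfolding the1_def by (metis the_equality)

lemma dft_if:
  assumes "dfb P" "dft a" "dft b"
  shows "dft (\<lambda>e. if P e then a e else b e)"
proof -
  have "dfb (\<lambda>e. (P (\<lambda>i. e (Suc i)) \<longrightarrow> e 0 = a (\<lambda>i. e (Suc i))) \<and>
      (\<not> P (\<lambda>i. e (Suc i)) \<longrightarrow> e 0 = b (\<lambda>i. e (Suc i))))"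
    using assms by (intro dfb_conj dfb_imp dfb_not) (auto simp: dft_def intro: dfb_reindex)
  then show ?thesis unfolding dft_def by (rule back_subst[of dfb]) auto
qed

lemma dft_the1:
  assumes "dfb (\<lambda>e. P (e 0) (\<lambda>i. e (Suc i)))"
  shows "dft (\<lambda>e. the1 (\<lambda>x. P x e))"
proof -
  have 1: "dfb (\<lambda>e. \<exists>!x. P x (\<lambda>i. e (Suc i)))"
    using dfb_reindex[OF dfb_ex1[OF assms], of Suc] .
  have 2: "dfb (\<lambda>e. ((\<exists>!x. P x (\<lambda>i. e (Suc i))) \<longrightarrow> P (e 0) (\<lambda>i. e (Suc i))) \<and>
     (\<not> (\<exists>!x. P x (\<lambda>i. e (Suc i))) \<longrightarrow> e 0 = emp))"
    by (intro dfb_conj dfb_imp dfb_not dfb_eq dft_var dft_const 1 assms)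
  have 3: "((\<exists>!x. Q x) \<longrightarrow> Q y) \<and> (\<not> (\<exists>!x. Q x) \<longrightarrow> y = emp) \<longleftrightarrow> y = the1 Q" for Q y
  proof (cases "\<exists>!x. Q x")
    case True
    then obtain a where a: "Q a" "\<And>x. Q x \<Longrightarrow> x = a" by blast
    then have "the1 Q = a" by (rule the1_eq)
    moreover have "Q y \<longleftrightarrow> y = a" using a by blast
    ultimately show ?thesis using True by simp
  qed (simp add: the1_def)
  show ?thesis unfolding dft_def by (rule back_subst[of dfb, OF 2]) (rule ext, rule 3)
qed

text \<open>Through \<open>the1\<close> this is a total operation of HOL that is itself a definable
  term, so comprehensions can be nested.\<close>

definition Sep :: "'a \<Rightarrow> ('a \<Rightarrow> bool) \<Rightarrow> 'a" where
  "Sep a P = the1 (\<lambda>b. \<forall>x. x \<epsilon> b \<longleftrightarrow> x \<epsilon> a \<and> P x)"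

definition Repl :: "'a \<Rightarrow> ('a \<Rightarrow> 'a) \<Rightarrow> 'a" where
  "Repl a F = the1 (\<lambda>b. \<forall>y. y \<epsilon> b \<longleftrightarrow> (\<exists>x. x \<epsilon> a \<and> y = F x))"

lemma dft_Sep:
  assumes "dft a" "dfb (\<lambda>e. P (e 0) (\<lambda>i. e (Suc i)))"
  shows "dft (\<lambda>e. Sep (a e) (\<lambda>x. P x e))"
  unfolding Sep_def
proof (rule dft_the1, rule dfb_all, intro dfb_iff dfb_conj dfb_mem dft_var)
  show "dft (\<lambda>e. a (\<lambda>i. e (Suc (Suc i))))" using assms(1) by (rule dft_reindex)
  show "dfb (\<lambda>e. P (e 0) (\<lambda>i. e (Suc (Suc i))))"
    using dfb_reindex[OF assms(2), of "case_nat 0 (\<lambda>i. Suc (Suc i))"] by simp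
qed

lemma dft_Repl:
  assumes "dft a" "dft (\<lambda>e. F (e 0) (\<lambda>i. e (Suc i)))"
  shows "dft (\<lambda>e. Repl (a e) (\<lambda>x. F x e))"
  unfolding Repl_def
proof (rule dft_the1, rule dfb_all, rule dfb_iff, intro dfb_mem dft_var,
    rule dfb_ex, intro dfb_conj dfb_mem dfb_eq dft_var)
  show "dft (\<lambda>e. a (\<lambda>i. e (Suc (Suc (Suc i)))))" using assms(1) by (rule dft_reindex)
  show "dft (\<lambda>e. F (e 0) (\<lambda>i. e (Suc (Suc (Suc i)))))"
    using dft_reindex[OF assms(2), of "case_nat 0 (\<lambda>i. Suc (Suc (Suc i)))"] by simp
qed

lemmas df = dfb_mem dfb_eq dfb_imp dfb_not dfb_disj dfb_conj dfb_iff dfb_all dfb_ex dfb_ex1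
  dfb_const dft_var dft_const dft_if dft_the1 dft_Sep dft_Repl

end

section \<open>Sets in a model of ZFC\<close>

locale zfc = membership +
  assumes zfc: "p \<in> ZFC \<Longrightarrow> sat E e p"
begin

declare df [simp]

lemma ext_eq: "(\<And>z. z \<epsilon> x \<longleftrightarrow> z \<epsilon> y) \<Longrightarrow> x = y"
  using zfc[of "extensionality 0"] by (simp add: ZFC_def extensionality_def sats)

lemma mem_the1:
  assumes "\<exists>b. \<forall>x. x \<epsilon> b \<longleftrightarrow> Q x"
  shows "x \<epsilon> the1 (\<lambda>b. \<forall>x. x \<epsilon> b \<longleftrightarrow> Q x) \<longleftrightarrow> Q x"
proof -
  obtain b where b: "\<forall>x. x \<epsilon> b \<longleftrightarrow> Q x" using assms ..
  have "the1 (\<lambda>b. \<forall>x. x \<epsilon> b \<longleftrightarrow> Q x) = b"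
    by (rule the1_eq[where P="\<lambda>b. \<forall>x. x \<epsilon> b \<longleftrightarrow> Q x", OF b], rule ext_eq) (simp add: b)
  with b show ?thesis by simp
qed

lemma separation_instance:
  assumes "dfb (\<lambda>e. P (e 0))"
  shows "\<exists>b. \<forall>x. x \<epsilon> b \<longleftrightarrow> x \<epsilon> a \<and> P x"
proof -
  obtain p s where p: "\<And>e. P (e 0) \<longleftrightarrow> sat E (val s e) p"
    using assms unfolding dfb_def by blast
  obtain m where m: "fv_below m p" using ex_fv_below ..
  \<comment> \<open>Parameters of \<open>p\<close> keep their positions below \<open>m\<close>;
    every variable read from the environment goes to position \<open>m\<close>, the element being
    tested. Level \<open>i\<close> is read at index \<open>m - 1 - i\<close>, so the environment
    \<open>e\<close> below lists the parameters backwards, with \<open>a\<close> as filler.\<close>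
  define r where "r i = (case s i of Inl c \<Rightarrow> if i < m then i else 0 | Inr j \<Rightarrow> m)" for i
  define e where "e j = (case s (m - 1 - j) of Inl c \<Rightarrow> c | Inr _ \<Rightarrow> a)" for j
  have "fv_below (m + 1) (rename r p)"
    by (rule fv_below_rename[OF m]) (auto simp: r_def split: sum.split)
  then have "separation m (rename r p) \<in> ZFC" unfolding ZFC_def by blast
  then have "sat E e (separation m (rename r p))" for e by (rule zfc)
  from sat_univ_closure[OF this[unfolded separation_def], of e]
  obtain b where b: "\<And>x. x \<epsilon> b \<longleftrightarrow> x \<epsilon> a \<and>
      sat E (\<lambda>i. lk (case_nat x (case_nat b (case_nat a e))) (Suc (Suc (Suc m)))
        (([0..<m] @ [Suc (Suc m)]) ! r i)) p"
    by (auto simp: sats sat_finst sat_rename)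
  have "sat E (\<lambda>i. lk (case_nat x (case_nat b (case_nat a e))) (Suc (Suc (Suc m)))
        (([0..<m] @ [Suc (Suc m)]) ! r i)) p \<longleftrightarrow> P x" for x
    unfolding p[of "\<lambda>_. x", simplified]
    by (rule sat_cong[OF m])
      (auto simp: r_def val_def nth_append sats lk_def[of e] e_def split: sum.split)
  with b show ?thesis by auto
qed

lemma replacement_instance:
  assumes "dfb (\<lambda>e. R (e 0) (e (Suc 0)))" and fn: "\<And>x y z. R x y \<Longrightarrow> R x z \<Longrightarrow> y = z"
  shows "\<exists>b. \<forall>y. y \<epsilon> b \<longleftrightarrow> (\<exists>x. x \<epsilon> a \<and> R x y)"
proof -
  obtain p s where p: "\<And>e. R (e 0) (e (Suc 0)) \<longleftrightarrow> sat E (val s e) p"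
    using assms unfolding dfb_def by blast
  obtain m where m: "fv_below m p" using ex_fv_below ..
  \<comment> \<open>Index 0 of the relation is its argument at position \<open>m\<close>; every
    other index is read as the value at position \<open>Suc m\<close>.\<close>
  define r where "r i = (case s i of Inl c \<Rightarrow> if i < m then i else 0 | Inr j \<Rightarrow> if j = 0 then m else Suc m)" for i
  define e where "e j = (case s (m - 1 - j) of Inl c \<Rightarrow> c | Inr _ \<Rightarrow> a)" for j
  have "fv_below (m + 2) (rename r p)"
    by (rule fv_below_rename[OF m]) (auto simp: r_def split: sum.split)
  then have "replacement m (rename r p) \<in> ZFC" unfolding ZFC_def by blast
  then have "sat E e (replacement m (rename r p))" for e by (rule zfc)
  note ax = sat_univ_closure[OF this[unfolded replacement_def], of e]
  have *: "sat E (\<lambda>i. lk e' n ((([0..<m] @ [k, l]) ! r i))) p \<longleftrightarrow> R x y"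
    if "\<And>i. i < m \<Longrightarrow> lk e' n i = lk e m i" "lk e' n k = x" "lk e' n l = y" for e' n k l x y
    unfolding p[of "case_nat x (\<lambda>_. y)", simplified]
    by (rule sat_cong[OF m])
      (use that in \<open>auto simp: r_def val_def nth_append lk_def[of e] e_def split: sum.split nat.split\<close>)
  have "\<exists>b. \<forall>y. y \<epsilon> b \<longleftrightarrow> (\<exists>x. x \<epsilon> a \<and> sat E (\<lambda>i. lk (case_nat x (case_nat y (case_nat b (case_nat a e))))
      (Suc (Suc (Suc (Suc m)))) (([0..<m] @ [Suc (Suc (Suc m)), Suc (Suc m)]) ! r i)) p)"
    using ax by (simp add: sats sat_finst sat_rename *) (use fn in blast)
  then show ?thesis by (simp add: * sats)
qed

lemma mem_Sep [simp]: "dfb (\<lambda>e. P (e 0)) \<Longrightarrow> x \<epsilon> Sep a P \<longleftrightarrow> x \<epsilon> a \<and> P x"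
  unfolding Sep_def by (rule mem_the1) (rule separation_instance)

lemma mem_Repl [simp]:
  assumes "dft (\<lambda>e. F (e 0))"
  shows "y \<epsilon> Repl a F \<longleftrightarrow> (\<exists>x. x \<epsilon> a \<and> y = F x)"
proof -
  have "dfb (\<lambda>e. e (Suc 0) = F (e 0))"
    using dfb_eq[OF dft_var assms] .
  then show ?thesis
    unfolding Repl_def by (intro mem_the1 replacement_instance) auto
qed

lemma mem_emp [simp]: "\<not> x \<epsilon> emp"
proof -
  have 1: "\<forall>z. \<not> z \<epsilon> Sep x (\<lambda>_. False)" by simp
  have "emp = Sep x (\<lambda>_. False)" unfolding emp_def
  proof (rule the_equality)
    show "\<forall>z. \<not> z \<epsilon> Sep x (\<lambda>_. False)" by (rule 1)
    show "y = Sep x (\<lambda>_. False)" if "\<forall>z. \<not> z \<epsilon> y" for y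
      by (rule ext_eq) (use that in simp)
  qed
  with 1 show ?thesis by simp
qed

lemma ex_mem: "a \<noteq> emp \<longleftrightarrow> (\<exists>x. x \<epsilon> a)"
  using ext_eq[of a emp] by auto

lemma foundation_instance: "x \<epsilon> a \<Longrightarrow> \<exists>y. y \<epsilon> a \<and> \<not> (\<exists>z. z \<epsilon> a \<and> z \<epsilon> y)"
  using zfc[of "foundation 0"]
  by (simp add: ZFC_def foundation_def nonempty_def sats) metis

section \<open>Pairs, unions, power sets and products\<close>

definition upair :: "'a \<Rightarrow> 'a \<Rightarrow> 'a" where
  "upair x y = the1 (\<lambda>p. \<forall>z. z \<epsilon> p \<longleftrightarrow> z = x \<or> z = y)"

lemma mem_upair [simp]: "z \<epsilon> upair x y \<longleftrightarrow> z = x \<or> z = y"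
proof -
  have "\<exists>p. \<forall>z. z \<epsilon> p \<longleftrightarrow> z = x \<or> z = y"
    using zfc[of "pairing 0"] by (simp add: ZFC_def pairing_def is_upair_def sats)
  then show ?thesis unfolding upair_def by (rule mem_the1)
qed

lemma df_upair [simp]: "dft a \<Longrightarrow> dft b \<Longrightarrow> dft (\<lambda>e. upair (a e) (b e))"
  by (rule dft2[of upair]) (simp_all add: upair_def)

definition union :: "'a \<Rightarrow> 'a" where
  "union a = the1 (\<lambda>u. \<forall>x. x \<epsilon> u \<longleftrightarrow> (\<exists>y. y \<epsilon> a \<and> x \<epsilon> y))"

lemma mem_union [simp]: "x \<epsilon> union a \<longleftrightarrow> (\<exists>y. y \<epsilon> a \<and> x \<epsilon> y)"
proof -
  have "\<exists>u. \<forall>x. x \<epsilon> u \<longleftrightarrow> (\<exists>y. y \<epsilon> a \<and> x \<epsilon> y)"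
    using zfc[of "union_axiom 0"] by (simp add: ZFC_def union_axiom_def sats)
  then show ?thesis unfolding union_def by (rule mem_the1)
qed

lemma df_union [simp]: "dft a \<Longrightarrow> dft (\<lambda>e. union (a e))"
  by (rule dft1[of union]) (simp_all add: union_def)

definition sub :: "'a \<Rightarrow> 'a \<Rightarrow> bool"  (infix "\<sqsubseteq>" 50) where
  "x \<sqsubseteq> y \<longleftrightarrow> (\<forall>z. z \<epsilon> x \<longrightarrow> z \<epsilon> y)"

lemma subI: "(\<And>z. z \<epsilon> x \<Longrightarrow> z \<epsilon> y) \<Longrightarrow> x \<sqsubseteq> y" by (simp add: sub_def)

lemma subD: "x \<sqsubseteq> y \<Longrightarrow> z \<epsilon> x \<Longrightarrow> z \<epsilon> y" by (simp add: sub_def)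

lemma sub_refl [simp]: "x \<sqsubseteq> x" by (simp add: sub_def)

lemma sub_antisym: "x \<sqsubseteq> y \<Longrightarrow> y \<sqsubseteq> x \<Longrightarrow> x = y"
  by (rule ext_eq) (auto simp: sub_def)

lemma df_sub [simp]: "dft a \<Longrightarrow> dft b \<Longrightarrow> dfb (\<lambda>e. a e \<sqsubseteq> b e)"
  by (rule dfb2[of "(\<sqsubseteq>)"]) (simp_all add: sub_def)

definition Pow :: "'a \<Rightarrow> 'a" where
  "Pow a = the1 (\<lambda>b. \<forall>x. x \<epsilon> b \<longleftrightarrow> x \<sqsubseteq> a)"

lemma sat_fsubset [sats]: "x < n \<Longrightarrow> y < n \<Longrightarrow> sat E e ((x \<^bold>\<subseteq> y) n) \<longleftrightarrow> lk e n x \<sqsubseteq> lk e n y"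
  by (simp add: fsubset_def sats sub_def)

lemma mem_Pow [simp]: "x \<epsilon> Pow a \<longleftrightarrow> x \<sqsubseteq> a"
proof -
  have "\<exists>b. \<forall>x. x \<epsilon> b \<longleftrightarrow> x \<sqsubseteq> a"
    using zfc[of "power_set 0"] by (simp add: ZFC_def power_set_def sats)
  then show ?thesis unfolding Pow_def by (rule mem_the1)
qed

definition pair :: "'a \<Rightarrow> 'a \<Rightarrow> 'a" where
  "pair x y = upair (upair x x) (upair x y)"

lemma df_pair [simp]: "dft a \<Longrightarrow> dft b \<Longrightarrow> dft (\<lambda>e. pair (a e) (b e))"
  by (simp add: pair_def)

lemma upair_eq: "upair a b = upair c d \<longleftrightarrow> a = c \<and> b = d \<or> a = d \<and> b = c"
proof
  assume eq: "upair a b = upair c d"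
  have "z \<epsilon> upair a b \<longleftrightarrow> z \<epsilon> upair c d" for z using eq by simp
  then have *: "z = a \<or> z = b \<longleftrightarrow> z = c \<or> z = d" for z unfolding mem_upair .
  from *[of a] *[of b] *[of c] *[of d] show "a = c \<and> b = d \<or> a = d \<and> b = c" by metis
next
  assume "a = c \<and> b = d \<or> a = d \<and> b = c"
  then show "upair a b = upair c d" by (intro ext_eq) auto
qed

lemma pair_inject [simp]: "pair x y = pair x' y' \<longleftrightarrow> x = x' \<and> y = y'"
  by (auto simp: pair_def upair_eq)

lemma is_upair_iff: "(\<forall>z. z \<epsilon> p \<longleftrightarrow> z = x \<or> z = y) \<longleftrightarrow> p = upair x y"
  by (auto intro: ext_eq)

lemma sat_nonempty [sats]: "x < n \<Longrightarrow> sat E e (nonempty x n) \<longleftrightarrow> lk e n x \<noteq> emp"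
  by (simp add: nonempty_def sats ex_mem)

lemma sat_is_upair [sats]: "p < n \<Longrightarrow> x < n \<Longrightarrow> y < n \<Longrightarrow>
    sat E e (is_upair p x y n) \<longleftrightarrow> lk e n p = upair (lk e n x) (lk e n y)"
  unfolding is_upair_iff[symmetric] by (simp add: is_upair_def sats)

lemma sat_is_opair [sats]: "p < n \<Longrightarrow> x < n \<Longrightarrow> y < n \<Longrightarrow>
    sat E e (is_opair p x y n) \<longleftrightarrow> lk e n p = pair (lk e n x) (lk e n y)"
  by (simp add: is_opair_def sats pair_def)

definition prod :: "'a \<Rightarrow> 'a \<Rightarrow> 'a" where
  "prod a b = union (Repl a (\<lambda>x. Repl b (pair x)))"

lemma mem_prod [simp]: "p \<epsilon> prod a b \<longleftrightarrow> (\<exists>x y. x \<epsilon> a \<and> y \<epsilon> b \<and> p = pair x y)"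
  by (auto simp add: prod_def)

lemma df_prod [simp]: "dft a \<Longrightarrow> dft b \<Longrightarrow> dft (\<lambda>e. prod (a e) (b e))"
  by (rule dft2[of prod]) (simp_all add: prod_def)

lemma prod_mono: "a \<sqsubseteq> a' \<Longrightarrow> b \<sqsubseteq> b' \<Longrightarrow> prod a b \<sqsubseteq> prod a' b'"
  by (auto simp: sub_def)

definition suc :: "'a \<Rightarrow> 'a" where
  "suc x = union (upair x (upair x x))"

lemma mem_suc [simp]: "z \<epsilon> suc x \<longleftrightarrow> z \<epsilon> x \<or> z = x"
  by (auto simp: suc_def)

subsection \<open>Functions\<close>

definition ap :: "'a \<Rightarrow> 'a \<Rightarrow> 'a" where
  "ap f x = the1 (\<lambda>y. pair x y \<epsilon> f)"

lemma df_ap [simp]: "dft a \<Longrightarrow> dft b \<Longrightarrow> dft (\<lambda>e. ap (a e) (b e))"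
  by (rule dft2[of ap]) (simp_all add: ap_def)

definition lam :: "'a \<Rightarrow> ('a \<Rightarrow> 'a) \<Rightarrow> 'a" where
  "lam a F = Repl a (\<lambda>x. pair x (F x))"

lemma df_lam [simp]: "dft a \<Longrightarrow> dft (\<lambda>e. F (e 0) (\<lambda>i. e (Suc i))) \<Longrightarrow> dft (\<lambda>e. lam (a e) (\<lambda>x. F x e))"
  by (simp add: lam_def)

definition Fun :: "'a \<Rightarrow> 'a \<Rightarrow> 'a \<Rightarrow> bool" where
  "Fun f a b \<longleftrightarrow> (\<forall>p. p \<epsilon> f \<longrightarrow> (\<exists>x y. x \<epsilon> a \<and> y \<epsilon> b \<and> p = pair x y)) \<and>
    (\<forall>x. x \<epsilon> a \<longrightarrow> (\<exists>!y. pair x y \<epsilon> f))"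

lemma df_Fun [simp]: "dft a \<Longrightarrow> dft b \<Longrightarrow> dft c \<Longrightarrow> dfb (\<lambda>e. Fun (a e) (b e) (c e))"
  by (rule dfb3[of Fun]) (simp_all add: Fun_def)

lemma sat_maps_to [sats]: "f < n \<Longrightarrow> x < n \<Longrightarrow> y < n \<Longrightarrow>
    sat E e (maps_to f x y n) \<longleftrightarrow> pair (lk e n x) (lk e n y) \<epsilon> lk e n f"
  by (simp add: maps_to_def sats)

lemma sat_is_function [sats]: "f < n \<Longrightarrow> a < n \<Longrightarrow> b < n \<Longrightarrow>
    sat E e (is_function f a b n) \<longleftrightarrow> Fun (lk e n f) (lk e n a) (lk e n b)"
  by (simp add: is_function_def sats Fun_def Ex1_def)

lemma Fun_dom:
  assumes "Fun f a b" "pair x y \<epsilon> f"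
  shows "x \<epsilon> a \<and> y \<epsilon> b"
proof -
  obtain x' y' where "x' \<epsilon> a" "y' \<epsilon> b" "pair x y = pair x' y'"
    using assms unfolding Fun_def by blast
  then show ?thesis by simp
qed

lemma Fun_pair:
  assumes "Fun f a b"
  shows "pair x y \<epsilon> f \<longleftrightarrow> x \<epsilon> a \<and> y = ap f x"
proof -
  have "y = ap f x \<longleftrightarrow> pair x y \<epsilon> f" if xa: "x \<epsilon> a"
  proof -
    obtain z where z: "pair x z \<epsilon> f" "\<And>y. pair x y \<epsilon> f \<Longrightarrow> y = z"
    proof -
      have "\<exists>!z. pair x z \<epsilon> f" using assms xa unfolding Fun_def by blast
      then show thesis using that by blast
    qed
    then have "ap f x = z" unfolding ap_def by (rule the1_eq)
    with z show ?thesis by blast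
  qed
  then show ?thesis using Fun_dom[OF assms] by blast
qed

lemma Fun_ap: "Fun f a b \<Longrightarrow> x \<epsilon> a \<Longrightarrow> ap f x \<epsilon> b"
  using Fun_pair[of f a b x "ap f x"] Fun_dom[of f a b] by blast

lemma mem_lam:
  assumes "dft (\<lambda>e. F (e 0))"
  shows "p \<epsilon> lam a F \<longleftrightarrow> (\<exists>x. x \<epsilon> a \<and> p = pair x (F x))"
  using assms by (simp add: lam_def)

lemma ap_lam [simp]:
  assumes "dft (\<lambda>e. F (e 0))" "x \<epsilon> a"
  shows "ap (lam a F) x = F x"
  unfolding ap_def mem_lam[OF assms(1)] by (rule the1_eq) (use assms(2) in auto)

lemma Fun_lam:
  assumes "dft (\<lambda>e. F (e 0))" "\<And>x. x \<epsilon> a \<Longrightarrow> F x \<epsilon> b"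
  shows "Fun (lam a F) a b"
  unfolding Fun_def mem_lam[OF assms(1)]
proof (intro conjI allI impI)
  show "\<exists>!y. \<exists>x'. x' \<epsilon> a \<and> pair x y = pair x' (F x')" if "x \<epsilon> a" for x
    by (rule ex1I[of _ "F x"]) (use that in auto)
qed (use assms(2) in auto)

lemma lam_cong:
  assumes "dft (\<lambda>e. F (e 0))" "dft (\<lambda>e. G (e 0))" "\<And>x. x \<epsilon> a \<Longrightarrow> F x = G x"
  shows "lam a F = lam a G"
  by (rule ext_eq, unfold mem_lam[OF assms(1)] mem_lam[OF assms(2)]) (use assms(3) in auto)

lemma Fun_eq_lam:
  assumes "Fun f a b"
  shows "f = lam a (ap f)"
proof (rule ext_eq)
  fix p
  have "dft (\<lambda>e. ap f (e 0))" by simp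
  from mem_lam[OF this, of p a] show "p \<epsilon> f \<longleftrightarrow> p \<epsilon> lam a (ap f)"
    using Fun_pair[OF assms] assms unfolding Fun_def by blast
qed

definition Bij :: "'a \<Rightarrow> 'a \<Rightarrow> 'a \<Rightarrow> bool" where
  "Bij f a b \<longleftrightarrow> Fun f a b \<and> (\<forall>y. y \<epsilon> b \<longrightarrow> (\<exists>!x. pair x y \<epsilon> f))"

lemma df_Bij [simp]: "dft a \<Longrightarrow> dft b \<Longrightarrow> dft c \<Longrightarrow> dfb (\<lambda>e. Bij (a e) (b e) (c e))"
  by (rule dfb3[of Bij]) (simp_all add: Bij_def)

lemma Bij_iff: "Bij f a b \<longleftrightarrow> Fun f a b \<and> (\<forall>y. y \<epsilon> b \<longrightarrow> (\<exists>x. x \<epsilon> a \<and> ap f x = y)) \<and>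
    (\<forall>x x'. x \<epsilon> a \<and> x' \<epsilon> a \<and> ap f x = ap f x' \<longrightarrow> x = x')"
proof (cases "Fun f a b")
  case True
  have "(\<forall>y. y \<epsilon> b \<longrightarrow> (\<exists>!x. x \<epsilon> a \<and> y = ap f x)) \<longleftrightarrow>
    (\<forall>y. y \<epsilon> b \<longrightarrow> (\<exists>x. x \<epsilon> a \<and> ap f x = y)) \<and>
    (\<forall>x x'. x \<epsilon> a \<and> x' \<epsilon> a \<and> ap f x = ap f x' \<longrightarrow> x = x')" (is "?L \<longleftrightarrow> ?R1 \<and> ?R2")
  proof
    assume L: ?L
    have "x = x'" if "x \<epsilon> a" "x' \<epsilon> a" "ap f x = ap f x'" for x x'
      using L[rule_format, OF Fun_ap[OF True that(1)]] that by blast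
    with L show "?R1 \<and> ?R2" by blast
  qed blast
  with True show ?thesis by (simp add: Bij_def Fun_pair[OF True])
qed (simp add: Bij_def)

lemma BijD:
  assumes "Bij f a b"
  shows "Fun f a b" "x \<epsilon> a \<Longrightarrow> ap f x \<epsilon> b" "y \<epsilon> b \<Longrightarrow> \<exists>x. x \<epsilon> a \<and> ap f x = y"
    "x \<epsilon> a \<Longrightarrow> x' \<epsilon> a \<Longrightarrow> ap f x = ap f x' \<longleftrightarrow> x = x'"
  using assms Fun_ap unfolding Bij_iff by blast+

definition eqp :: "'a \<Rightarrow> 'a \<Rightarrow> bool" where
  "eqp a b \<longleftrightarrow> (\<exists>f. Bij f a b)"

lemma df_eqp [simp]: "dft a \<Longrightarrow> dft b \<Longrightarrow> dfb (\<lambda>e. eqp (a e) (b e))"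
  by (rule dfb2[of eqp]) (simp_all add: eqp_def)

lemma sat_equipotent [sats]: "a < n \<Longrightarrow> b < n \<Longrightarrow>
    sat E e (equipotent a b n) \<longleftrightarrow> eqp (lk e n a) (lk e n b)"
  by (simp add: equipotent_def sats eqp_def Bij_def Ex1_def)

lemma Bij_lam:
  assumes "dft (\<lambda>e. F (e 0))" "\<And>x. x \<epsilon> a \<Longrightarrow> F x \<epsilon> b" "\<And>y. y \<epsilon> b \<Longrightarrow> \<exists>x. x \<epsilon> a \<and> F x = y"
    "\<And>x x'. x \<epsilon> a \<Longrightarrow> x' \<epsilon> a \<Longrightarrow> F x = F x' \<Longrightarrow> x = x'"
  shows "Bij (lam a F) a b"
  unfolding Bij_iff
proof (intro conjI allI impI)
  show "Fun (lam a F) a b" using assms(1,2) by (rule Fun_lam)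
  show "\<exists>x. x \<epsilon> a \<and> ap (lam a F) x = y" if "y \<epsilon> b" for y
    using assms(3)[OF that] assms(1) by auto
  show "x = x'" if "x \<epsilon> a \<and> x' \<epsilon> a \<and> ap (lam a F) x = ap (lam a F) x'" for x x'
    using that assms(4)[of x x'] ap_lam[OF assms(1), of x a] ap_lam[OF assms(1), of x' a] by simp
qed

lemma eqp_refl: "eqp a a"
  unfolding eqp_def by (rule exI, rule Bij_lam[of "\<lambda>x. x"]) auto

lemma eqp_trans:
  assumes "eqp a b" "eqp b c"
  shows "eqp a c"
proof -
  obtain f g where f: "Bij f a b" and g: "Bij g b c" using assms by (auto simp: eqp_def)
  have "Bij (lam a (\<lambda>x. ap g (ap f x))) a c"
  proof (rule Bij_lam)
    show "\<exists>x. x \<epsilon> a \<and> ap g (ap f x) = y" if "y \<epsilon> c" for y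
      using BijD(3)[OF g that] BijD(3)[OF f] by blast
    show "x = x'" if "x \<epsilon> a" "x' \<epsilon> a" "ap g (ap f x) = ap g (ap f x')" for x x'
      using that BijD(2,4)[OF f] BijD(4)[OF g] by blast
  qed (auto simp: BijD(2)[OF f] BijD(2)[OF g])
  then show ?thesis by (auto simp: eqp_def)
qed

section \<open>Forms of the axiom of choice\<close>

lemma choice_function: "\<exists>c. \<forall>x. x \<epsilon> a \<and> x \<noteq> emp \<longrightarrow> ap c x \<epsilon> x"
proof -
  have ax: "\<exists>f b. Fun f a b \<and> (\<forall>x y. x \<epsilon> a \<and> pair x y \<epsilon> f \<longrightarrow> y \<epsilon> x)"
    if "\<forall>x. x \<epsilon> a \<longrightarrow> x \<noteq> emp" for a
    using zfc[of "choice 0"] that by (simp add: ZFC_def choice_def sats)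
  obtain f b where f: "Fun f (Sep a (\<lambda>x. x \<noteq> emp)) b"
    "\<forall>x y. x \<epsilon> Sep a (\<lambda>x. x \<noteq> emp) \<and> pair x y \<epsilon> f \<longrightarrow> y \<epsilon> x"
    using ax[of "Sep a (\<lambda>x. x \<noteq> emp)"] by auto
  then show ?thesis using Fun_pair[OF f(1)] by auto
qed

text \<open>The bound \<open>b\<close> makes all sets of candidates subsets of one set, so a single
  choice function on \<open>Pow b\<close> serves every \<open>x\<close>.\<close>

lemma choose:
  assumes "dfb (\<lambda>e. R (e 0) (e (Suc 0)))" "\<And>x. x \<epsilon> a \<Longrightarrow> \<exists>y. y \<epsilon> b \<and> R x y"
  shows "\<exists>f. Fun f a b \<and> (\<forall>x. x \<epsilon> a \<longrightarrow> R x (ap f x))"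
proof -
  obtain c where c: "\<And>x. x \<sqsubseteq> b \<Longrightarrow> x \<noteq> emp \<Longrightarrow> ap c x \<epsilon> x"
    using choice_function[of "Pow b"] by auto
  have R: "dft s \<Longrightarrow> dft t \<Longrightarrow> dfb (\<lambda>e. R (s e) (t e))" for s t
    by (rule dfb2[of R]) (use assms(1) in auto)
  let ?F = "\<lambda>x. ap c (Sep b (R x))"
  have "ap c (Sep b (R x)) \<epsilon> Sep b (R x)" if "x \<epsilon> a" for x
    using assms(2)[OF that] by (intro c) (auto simp: sub_def ex_mem R)
  then have "?F x \<epsilon> b \<and> R x (?F x)" if "x \<epsilon> a" for x using that R by simp
  moreover have "dft (\<lambda>e. ?F (e 0))" using R by simp
  ultimately show ?thesis
    by (intro exI[of _ "lam a ?F"] conjI Fun_lam) auto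
qed

section \<open>Ordinals\<close>

definition Ord :: "'a \<Rightarrow> bool" where
  "Ord a \<longleftrightarrow> (\<forall>x. x \<epsilon> a \<longrightarrow> x \<sqsubseteq> a) \<and> (\<forall>x y. x \<epsilon> a \<and> y \<epsilon> a \<longrightarrow> x \<epsilon> y \<or> x = y \<or> y \<epsilon> x)"

lemma sat_ordinal [sats]: "a < n \<Longrightarrow> sat E e (ordinal a n) \<longleftrightarrow> Ord (lk e n a)"
  by (simp add: ordinal_def sats Ord_def)

lemma df_Ord [simp]: "dft a \<Longrightarrow> dfb (\<lambda>e. Ord (a e))"
  by (rule dfb1[of Ord]) (simp_all add: Ord_def)

lemma mem_irrefl: "\<not> x \<epsilon> x"
  using foundation_instance[of x "upair x x"] by auto

lemma mem_asym: "x \<epsilon> y \<Longrightarrow> \<not> y \<epsilon> x"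
  using foundation_instance[of x "upair x y"] by auto

lemma mem_acyclic3: "x \<epsilon> y \<Longrightarrow> y \<epsilon> z \<Longrightarrow> \<not> z \<epsilon> x"
proof -
  let ?s = "union (upair (upair x y) (upair z z))"
  have s: "w \<epsilon> ?s \<longleftrightarrow> w = x \<or> w = y \<or> w = z" for w by auto
  assume "x \<epsilon> y" "y \<epsilon> z"
  with foundation_instance[of x ?s] show ?thesis unfolding s by blast
qed

lemma Ord_trans: "Ord a \<Longrightarrow> x \<epsilon> a \<Longrightarrow> y \<epsilon> x \<Longrightarrow> y \<epsilon> a"
  unfolding Ord_def sub_def by blast

lemma Ord_mem:
  assumes a: "Ord a" and x: "x \<epsilon> a"
  shows "Ord x"
  unfolding Ord_def
proof (intro conjI allI impI)
  fix y assume y: "y \<epsilon> x"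
  show "y \<sqsubseteq> x"
  proof (rule subI)
    fix z assume z: "z \<epsilon> y"
    have "z \<epsilon> a" using Ord_trans[OF a] x y z by blast
    then have "z \<epsilon> x \<or> z = x \<or> x \<epsilon> z" using a x unfolding Ord_def by blast
    then show "z \<epsilon> x" using mem_asym[OF y] mem_acyclic3[OF z y] z by blast
  qed
next
  fix y z assume "y \<epsilon> x \<and> z \<epsilon> x"
  then show "y \<epsilon> z \<or> y = z \<or> z \<epsilon> y"
    using Ord_trans[OF a x] a unfolding Ord_def by blast
qed

lemma Ord_induct:
  assumes "dfb (\<lambda>e. P (e 0))" and step: "\<And>a. Ord a \<Longrightarrow> (\<And>b. b \<epsilon> a \<Longrightarrow> P b) \<Longrightarrow> P a" and "Ord a"
  shows "P a"
proof (rule ccontr)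
  assume "\<not> P a"
  \<comment> \<open>Foundation is applied inside \<open>suc a\<close>, which contains
    \<open>a\<close> itself along with everything below it.\<close>
  then have "a \<epsilon> Sep (suc a) (\<lambda>x. \<not> P x)" using assms(1) by simp
  then obtain y where "y \<epsilon> Sep (suc a) (\<lambda>x. \<not> P x)" "\<not> (\<exists>z. z \<epsilon> Sep (suc a) (\<lambda>x. \<not> P x) \<and> z \<epsilon> y)"
    using foundation_instance by blast
  then have y: "y \<epsilon> a \<or> y = a" "\<not> P y" "\<And>z. z \<epsilon> y \<Longrightarrow> z \<epsilon> a \<or> z = a \<Longrightarrow> P z"
    using assms(1) by auto
  have "Ord y" using y(1) Ord_mem[OF \<open>Ord a\<close>] \<open>Ord a\<close> by blast
  moreover have "P z" if "z \<epsilon> y" for z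
    using y(1,3) that Ord_trans[OF \<open>Ord a\<close>] by blast
  ultimately have "P y" by (rule step)
  with y(2) show False ..
qed

lemma Ord_least:
  assumes "dfb (\<lambda>e. P (e 0))" "Ord a" "P a"
  shows "\<exists>b. Ord b \<and> P b \<and> (\<forall>c. c \<epsilon> b \<longrightarrow> \<not> P c)"
proof (rule ccontr)
  assume *: "\<not> ?thesis"
  have "dfb (\<lambda>e. \<not> P (e 0))" using assms(1) by simp
  then have "\<not> P a" by (rule Ord_induct[of "\<lambda>x. \<not> P x"]) (use * assms(2) in blast)+
  with \<open>P a\<close> show False by blast
qed

text \<open>A membership-minimal element of \<open>a\<close> outside \<open>b\<close> has exactly
  the elements of \<open>b\<close>.\<close>

lemma transitive_subset_mem:
  assumes a: "Ord a" and b: "b \<sqsubseteq> a" "\<And>x y. x \<epsilon> b \<Longrightarrow> y \<epsilon> x \<Longrightarrow> y \<epsilon> b" and ne: "b \<noteq> a"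
  shows "b \<epsilon> a"
proof -
  have "\<exists>x. x \<epsilon> a \<and> \<not> x \<epsilon> b" using b(1) ne sub_antisym subI by blast
  then obtain x where "x \<epsilon> Sep a (\<lambda>x. \<not> x \<epsilon> b)" by auto
  from foundation_instance[OF this] obtain y where
    y: "y \<epsilon> a" "\<not> y \<epsilon> b" "\<And>z. z \<epsilon> y \<Longrightarrow> z \<epsilon> a \<Longrightarrow> z \<epsilon> b" by auto
  have "y = b"
  proof (rule ext_eq)
    fix z
    show "z \<epsilon> y \<longleftrightarrow> z \<epsilon> b"
    proof
      assume "z \<epsilon> y"
      then show "z \<epsilon> b" using y Ord_trans[OF a] by blast
    next
      assume z: "z \<epsilon> b"
      then have "z \<epsilon> a" using b(1) subD by blast
      then have "z \<epsilon> y \<or> z = y \<or> y \<epsilon> z" using a y(1) unfolding Ord_def by blast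
      then show "z \<epsilon> y" using z b(2) y(2) by blast
    qed
  qed
  with y show ?thesis by simp
qed

text \<open>The intersection is a transitive subset of both ordinals. It cannot be a proper part of
  both, for then it would belong to both and hence to itself.\<close>

lemma Ord_linear:
  assumes a: "Ord a" and b: "Ord b"
  shows "a \<epsilon> b \<or> a = b \<or> b \<epsilon> a"
proof -
  let ?i = "Sep a (\<lambda>x. x \<epsilon> b)"
  have t: "y \<epsilon> ?i" if "x \<epsilon> ?i" "y \<epsilon> x" for x y
    using that Ord_trans[OF a] Ord_trans[OF b] by auto
  have i: "?i \<sqsubseteq> a" "?i \<sqsubseteq> b" by (simp_all add: sub_def)
  have "?i \<epsilon> a" if "?i \<noteq> a" using i(1) t that by (rule transitive_subset_mem[OF a])
  moreover have "?i \<epsilon> b" if "?i \<noteq> b" using i(2) t that by (rule transitive_subset_mem[OF b])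
  moreover have "\<not> (?i \<epsilon> a \<and> ?i \<epsilon> b)"
    using mem_irrefl[of ?i] by simp
  ultimately show ?thesis by metis
qed

lemma Ord_sub_iff: "Ord a \<Longrightarrow> Ord b \<Longrightarrow> a \<sqsubseteq> b \<longleftrightarrow> a \<epsilon> b \<or> a = b"
  using Ord_linear[of a b] Ord_trans[of b a] mem_irrefl[of b] mem_irrefl[of a] unfolding sub_def by blast

lemma Ord_not_mem: "Ord a \<Longrightarrow> Ord b \<Longrightarrow> \<not> a \<epsilon> b \<Longrightarrow> b \<sqsubseteq> a"
  using Ord_linear[of a b] Ord_sub_iff[of b a] by blast

lemma Ord_sub_mem: "Ord a \<Longrightarrow> Ord b \<Longrightarrow> Ord c \<Longrightarrow> a \<sqsubseteq> b \<Longrightarrow> b \<epsilon> c \<Longrightarrow> a \<epsilon> c"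
  using Ord_sub_iff[of a b] Ord_trans[of c b a] by blast

lemma Ord_set: "(\<And>x. x \<epsilon> a \<Longrightarrow> Ord x) \<Longrightarrow> (\<And>x y. x \<epsilon> a \<Longrightarrow> y \<epsilon> x \<Longrightarrow> y \<epsilon> a) \<Longrightarrow> Ord a"
  unfolding Ord_def[of a] sub_def using Ord_linear by blast

text \<open>If \<open>a\<close> contained all ordinals, they would form an ordinal that belongs to
  itself. Stated for sets \<open>a\<close>, this is what makes transfinite enumerations
  stop.\<close>

lemma Burali_Forti: "\<exists>x. Ord x \<and> \<not> x \<epsilon> a"
proof (rule ccontr)
  assume *: "\<not> ?thesis"
  have "Ord (Sep a Ord)"
  proof (rule Ord_set)
    fix x y assume "x \<epsilon> Sep a Ord" "y \<epsilon> x"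
    with * show "y \<epsilon> Sep a Ord" using Ord_mem[of x y] by auto
  qed simp
  with * mem_irrefl[of "Sep a Ord"] show False by simp
qed

subsection \<open>Transfinite recursion\<close>

text \<open>The first conjunct says that \<open>f\<close> is a function with domain
  \<open>a\<close>; no codomain is at hand to express this with \<open>Fun\<close>.\<close>

definition approx :: "('a \<Rightarrow> 'a) \<Rightarrow> 'a \<Rightarrow> 'a \<Rightarrow> bool" where
  "approx G f a \<longleftrightarrow> f = lam a (ap f) \<and> (\<forall>b. b \<epsilon> a \<longrightarrow> ap f b = G (lam b (ap f)))"

definition wfrec :: "('a \<Rightarrow> 'a) \<Rightarrow> 'a \<Rightarrow> 'a" where
  "wfrec G a = G (the1 (\<lambda>f. approx G f a))"

lemma df_approx:
  assumes "dft (\<lambda>e. G (e 0))"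
  shows "dft f \<Longrightarrow> dft a \<Longrightarrow> dfb (\<lambda>e. approx G (f e) (a e))"
  by (rule dfb2[of "approx G"]) (simp_all add: approx_def dft1[of G, OF assms])

lemma df_wfrec:
  assumes "dft (\<lambda>e. G (e 0))" "dft a"
  shows "dft (\<lambda>e. wfrec G (a e))"
  by (rule dft1[of "wfrec G"]) (simp_all add: wfrec_def dft1[of G, OF assms(1)] df_approx[OF assms(1)] assms(2))

lemma lam_lam:
  assumes "dft (\<lambda>e. F (e 0))" "b \<sqsubseteq> a"
  shows "lam b (ap (lam a F)) = lam b F"
  by (rule lam_cong) (use assms subD in auto)

lemma wfrec:
  assumes G: "dft (\<lambda>e. G (e 0))" and a: "Ord a"
  shows "wfrec G a = G (lam a (wfrec G))"
proof -
  have W: "dft (\<lambda>e. wfrec G (e 0))" by (rule df_wfrec[OF G]) simp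
  have agree: "ap f b = ap g b" if "Ord a" "approx G f a" "approx G g a" "b \<epsilon> a" for f g a b
  proof -
    have "b \<epsilon> a \<longrightarrow> ap f b = ap g b"
    proof (rule Ord_induct[of "\<lambda>b. b \<epsilon> a \<longrightarrow> ap f b = ap g b"])
      show "Ord b" using that Ord_mem by blast
      fix b assume "Ord b" and IH: "\<And>c. c \<epsilon> b \<Longrightarrow> c \<epsilon> a \<longrightarrow> ap f c = ap g c"
      show "b \<epsilon> a \<longrightarrow> ap f b = ap g b"
      proof
        assume b: "b \<epsilon> a"
        have "lam b (ap f) = lam b (ap g)"
          by (rule lam_cong) (use IH Ord_trans[OF \<open>Ord a\<close> b] in simp_all)
        then show "ap f b = ap g b" using that(2,3) b unfolding approx_def by simp
      qed
    qed simp
    with that show ?thesis by blast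
  qed
  have uniq: "f = g" if "Ord a" "approx G f a" "approx G g a" for f g a
  proof -
    have "f = lam a (ap f)" "g = lam a (ap g)" using that unfolding approx_def by blast+
    moreover have "lam a (ap f) = lam a (ap g)"
      by (rule lam_cong) (use agree[OF that] in simp_all)
    ultimately show ?thesis by simp
  qed
  have the1: "wfrec G a = G f" if "Ord a" "approx G f a" for f a
  proof -
    have "the1 (\<lambda>f. approx G f a) = f"
      by (rule the1_eq) (use uniq that in blast)+
    then show ?thesis by (simp add: wfrec_def)
  qed
  \<comment> \<open>Cutting an attempt on \<open>a\<close> at \<open>b\<close> gives the attempt on
    \<open>b\<close>, whose one-step extension is the value of \<open>wfrec G\<close> at
    \<open>b\<close>.\<close>
  have eq: "f = lam a (wfrec G)" if a: "Ord a" and f: "approx G f a" for f a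
  proof -
    have *: "ap f b = wfrec G b" if b: "b \<epsilon> a" for b
    proof -
      have s: "b \<sqsubseteq> a" "\<And>c. c \<epsilon> b \<Longrightarrow> c \<sqsubseteq> b" using a Ord_mem[OF a b] b unfolding Ord_def by blast+
      have "approx G (lam b (ap f)) b"
        unfolding approx_def
      proof (intro conjI allI impI)
        show "lam b (ap f) = lam b (ap (lam b (ap f)))" by (simp add: lam_lam)
        fix c assume c: "c \<epsilon> b"
        then have "ap (lam b (ap f)) c = ap f c" by simp
        also have "\<dots> = G (lam c (ap f))" using f subD[OF s(1) c] unfolding approx_def by blast
        also have "lam c (ap f) = lam c (ap (lam b (ap f)))" using s(2)[OF c] by (simp add: lam_lam)
        finally show "ap (lam b (ap f)) c = G (lam c (ap (lam b (ap f))))" .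
      qed
      from the1[OF Ord_mem[OF a b] this] f b show ?thesis unfolding approx_def by simp
    qed
    have "f = lam a (ap f)" using f unfolding approx_def by blast
    also have "\<dots> = lam a (wfrec G)" by (rule lam_cong) (use * W in simp_all)
    finally show ?thesis .
  qed
  have "\<exists>f. approx G f a"
  proof (rule Ord_induct[of "\<lambda>a. \<exists>f. approx G f a"])
    show "dfb (\<lambda>e. \<exists>f. approx G f (e 0))" by (simp add: df_approx[OF G])
    fix a assume a: "Ord a" and IH: "\<And>b. b \<epsilon> a \<Longrightarrow> \<exists>f. approx G f b"
    have "approx G (lam a (wfrec G)) a"
      unfolding approx_def
    proof (intro conjI allI impI)
      show "lam a (wfrec G) = lam a (ap (lam a (wfrec G)))" by (simp add: lam_lam W)
      fix b assume b: "b \<epsilon> a"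
      obtain f where f: "approx G f b" using IH[OF b] ..
      have "b \<sqsubseteq> a" using a b unfolding Ord_def by blast
      then have "lam b (ap (lam a (wfrec G))) = f" using eq[OF Ord_mem[OF a b] f] by (simp add: lam_lam W)
      then show "ap (lam a (wfrec G)) b = G (lam b (ap (lam a (wfrec G))))"
        using the1[OF Ord_mem[OF a b] f] b W by simp
    qed
    then show "\<exists>f. approx G f a" ..
  qed (rule a)
  then obtain f where "approx G f a" ..
  with the1[OF a] eq[OF a] show ?thesis by simp
qed

subsection \<open>Well-ordering\<close>

text \<open>The recursion lists \<open>c\<close> of what has not been listed yet. If it never
  stopped, inverting it would map \<open>S\<close> onto all ordinals, against
  \<open>Burali_Forti\<close>. The recursion equation is part of the conclusion so that a special
  choice of \<open>c\<close> can be exploited.\<close>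

lemma enumerate:
  assumes c: "\<And>x. x \<sqsubseteq> S \<Longrightarrow> x \<noteq> emp \<Longrightarrow> ap c x \<epsilon> x"
  shows "\<exists>t f. Ord t \<and> Bij f t S \<and>
    (\<forall>b. b \<epsilon> t \<longrightarrow> ap f b = ap c (Sep S (\<lambda>y. \<not> (\<exists>x. x \<epsilon> b \<and> y = ap f x))))"
proof -
  define G where "G f = ap c (Sep S (\<lambda>y. \<not> (\<exists>x. pair x y \<epsilon> f)))" for f
  have G: "dft (\<lambda>e. G (e 0))" by (simp add: G_def)
  define F where "F = wfrec G"
  have F: "dft (\<lambda>e. F (e 0))" unfolding F_def by (rule df_wfrec[OF G]) simp
  have F1: "dft a \<Longrightarrow> dft (\<lambda>e. F (a e))" for a by (rule dft1[OF F])
  define rest where "rest b = Sep S (\<lambda>y. \<not> (\<exists>x. x \<epsilon> b \<and> y = F x))" for b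
  have rest: "y \<epsilon> rest b \<longleftrightarrow> y \<epsilon> S \<and> \<not> (\<exists>x. x \<epsilon> b \<and> y = F x)" for y b
    by (simp add: rest_def F1)
  have Frest: "F b = ap c (rest b)" if "Ord b" for b
  proof -
    have "F b = G (lam b F)" unfolding F_def by (rule wfrec[OF G that])
    moreover have "(\<lambda>y. \<not> (\<exists>x. pair x y \<epsilon> lam b F)) = (\<lambda>y. \<not> (\<exists>x. x \<epsilon> b \<and> y = F x))"
      using mem_lam[OF F] by auto
    ultimately show ?thesis by (simp only: G_def rest_def)
  qed
  have Fin: "F b \<epsilon> rest b" if "Ord b" "rest b \<noteq> emp" for b
    unfolding Frest[OF that(1)] by (rule c) (use that in \<open>auto simp: sub_def rest\<close>)
  have drest: "dft (\<lambda>e. rest (e 0))" by (simp add: rest_def F1)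
  have "\<exists>t. Ord t \<and> rest t = emp"
  proof (rule ccontr)
    assume "\<not> ?thesis"
    then have *: "F b \<epsilon> rest b" if "Ord b" for b using Fin that by blast
    have inj: "b = b'" if "Ord b" "Ord b'" "F b = F b'" for b b'
      using Ord_linear[of b b'] *[of b] *[of b'] that unfolding rest by metis
    define g where "g y = the1 (\<lambda>b. Ord b \<and> F b = y)" for y
    have g: "dft (\<lambda>e. g (e 0))" by (simp add: g_def F1)
    have gF: "g (F b) = b" if "Ord b" for b
      unfolding g_def by (rule the1_eq) (use inj that in blast)+
    have "b \<epsilon> Repl S g" if "Ord b" for b
      using gF[OF that] *[OF that] unfolding mem_Repl[OF g] rest by metis
    with Burali_Forti[of "Repl S g"] show False by blast
  qed
  then obtain t where t: "Ord t" "rest t = emp" "\<And>b. b \<epsilon> t \<Longrightarrow> rest b \<noteq> emp"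
    using Ord_least[of "\<lambda>t. rest t = emp"] drest by auto
  have Fb: "F b \<epsilon> rest b" if "b \<epsilon> t" for b
    using Fin Ord_mem[OF t(1) that] t(3)[OF that] by blast
  have "Bij (lam t F) t S"
  proof (rule Bij_lam[OF F])
    show "F x \<epsilon> S" if "x \<epsilon> t" for x using Fb[OF that] unfolding rest by blast
    show "\<exists>x. x \<epsilon> t \<and> F x = y" if "y \<epsilon> S" for y
      using t(2) that rest[of y t] by auto
    show "x = x'" if "x \<epsilon> t" "x' \<epsilon> t" "F x = F x'" for x x'
      using Ord_linear[OF Ord_mem[OF t(1) that(1)] Ord_mem[OF t(1) that(2)]] Fb[OF that(1)] Fb[OF that(2)] that(3)
      unfolding rest by metis
  qed
  moreover have "ap (lam t F) b = ap c (Sep S (\<lambda>y. \<not> (\<exists>x. x \<epsilon> b \<and> y = ap (lam t F) x)))" if b: "b \<epsilon> t" for b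
  proof -
    have "(\<lambda>y. \<not> (\<exists>x. x \<epsilon> b \<and> y = ap (lam t F) x)) = (\<lambda>y. \<not> (\<exists>x. x \<epsilon> b \<and> y = F x))"
      using Ord_trans[OF t(1) b] F by (intro ext) (metis ap_lam)
    then show ?thesis using Frest[OF Ord_mem[OF t(1) b]] b F by (simp add: rest_def)
  qed
  ultimately show ?thesis using t(1) by blast
qed

lemma well_order: "\<exists>t f. Ord t \<and> Bij f t S"
proof -
  obtain c where "\<forall>x. x \<epsilon> Pow S \<and> x \<noteq> emp \<longrightarrow> ap c x \<epsilon> x"
    using choice_function by blast
  then show ?thesis using enumerate[of S c] by auto
qed

text \<open>With the least element as choice function, the enumeration of \<open>m\<close> is
  strictly increasing. Hence every \<open>b\<close> is contained in its value, and this keeps the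
  length of the enumeration within \<open>a\<close>.\<close>

lemma subset_eqp_Ord:
  assumes a: "Ord a" and m: "m \<sqsubseteq> a"
  shows "\<exists>t. Ord t \<and> t \<sqsubseteq> a \<and> eqp t m"
proof -
  define L where "L x = the1 (\<lambda>b. b \<epsilon> x \<and> (\<forall>d. d \<epsilon> x \<longrightarrow> \<not> d \<epsilon> b))" for x
  have dL: "dft (\<lambda>e. L (e 0))" by (simp add: L_def)
  have om: "Ord x" if "x \<epsilon> m" for x using Ord_mem[OF a subD[OF m that]] .
  have L: "L x \<epsilon> x \<and> (\<forall>d. d \<epsilon> x \<longrightarrow> \<not> d \<epsilon> L x)" if x: "x \<sqsubseteq> m" "x \<noteq> emp" for x
    unfolding L_def
  proof -
    obtain b where "b \<epsilon> x" using x(2) ex_mem by blast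
    from foundation_instance[OF this] obtain b where b: "b \<epsilon> x \<and> (\<forall>d. d \<epsilon> x \<longrightarrow> \<not> d \<epsilon> b)" by blast
    moreover have "b' = b" if "b' \<epsilon> x \<and> (\<forall>d. d \<epsilon> x \<longrightarrow> \<not> d \<epsilon> b')" for b'
      using that b Ord_linear[of b b'] om subD[OF x(1)] by blast
    ultimately have "the1 (\<lambda>b. b \<epsilon> x \<and> (\<forall>d. d \<epsilon> x \<longrightarrow> \<not> d \<epsilon> b)) = b" by (rule the1_eq)
    with b show "the1 (\<lambda>b. b \<epsilon> x \<and> (\<forall>d. d \<epsilon> x \<longrightarrow> \<not> d \<epsilon> b)) \<epsilon> x \<and>
        (\<forall>d. d \<epsilon> x \<longrightarrow> \<not> d \<epsilon> the1 (\<lambda>b. b \<epsilon> x \<and> (\<forall>d. d \<epsilon> x \<longrightarrow> \<not> d \<epsilon> b)))" by simp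
  qed
  have apL: "ap (lam (Pow m) L) x = L x" if "x \<sqsubseteq> m" for x using dL that by simp
  obtain t f where t: "Ord t" and f: "Bij f t m"
    and fb: "\<And>b. b \<epsilon> t \<Longrightarrow> ap f b = ap (lam (Pow m) L) (Sep m (\<lambda>y. \<not> (\<exists>x. x \<epsilon> b \<and> y = ap f x)))"
    using enumerate[of m "lam (Pow m) L"] apL L by auto
  define rest where "rest b = Sep m (\<lambda>y. \<not> (\<exists>x. x \<epsilon> b \<and> y = ap f x))" for b
  have rest: "y \<epsilon> rest b \<longleftrightarrow> y \<epsilon> m \<and> \<not> (\<exists>x. x \<epsilon> b \<and> y = ap f x)" for y b
    by (simp add: rest_def)
  have fL: "ap f b = L (rest b)" if "b \<epsilon> t" for b
    unfolding fb[OF that] rest_def by (rule apL) (simp add: sub_def)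
  have fin: "ap f b \<epsilon> rest d" if "b \<epsilon> t" "d \<epsilon> b \<or> d = b" for b d
    unfolding rest using that BijD(2)[OF f] BijD(4)[OF f] Ord_trans[OF t] mem_irrefl mem_asym by metis
  \<comment> \<open>The value at \<open>d\<close> is least among what remains at stage
    \<open>d\<close>, and the value at \<open>b\<close> still remains then.\<close>
  have up: "ap f d \<epsilon> ap f b" if "b \<epsilon> t" "d \<epsilon> b" for b d
  proof -
    have d: "d \<epsilon> t" using Ord_trans[OF t] that by blast
    have "rest d \<sqsubseteq> m" by (simp add: sub_def rest)
    then have "\<not> ap f b \<epsilon> ap f d"
      using L[of "rest d"] fin[of b d] that fL[OF d] ex_mem by metis
    moreover have "ap f b \<noteq> ap f d"
      using BijD(4)[OF f that(1) d] that(2) mem_irrefl by blast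
    ultimately show ?thesis
      using Ord_linear[of "ap f b" "ap f d"] om BijD(2)[OF f] that(1) d by blast
  qed
  have sub: "b \<epsilon> t \<longrightarrow> b \<sqsubseteq> ap f b" if "Ord b" for b
  proof (rule Ord_induct[of "\<lambda>b. b \<epsilon> t \<longrightarrow> b \<sqsubseteq> ap f b"])
    fix b assume "Ord b" and IH: "\<And>d. d \<epsilon> b \<Longrightarrow> d \<epsilon> t \<longrightarrow> d \<sqsubseteq> ap f d"
    show "b \<epsilon> t \<longrightarrow> b \<sqsubseteq> ap f b"
    proof (intro impI subI)
      fix d assume b: "b \<epsilon> t" and d: "d \<epsilon> b"
      then have dt: "d \<epsilon> t" using Ord_trans[OF t] by blast
      show "d \<epsilon> ap f b"
        by (rule Ord_sub_mem[of d "ap f d"])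
          (use IH[OF d] dt up[OF b d] Ord_mem[OF t dt] om BijD(2)[OF f] b in blast)+
    qed
  qed (use that in simp_all)
  have "t \<sqsubseteq> a"
  proof (rule subI)
    fix b assume b: "b \<epsilon> t"
    have "ap f b \<epsilon> m" using BijD(2)[OF f b] .
    then show "b \<epsilon> a"
      using Ord_sub_mem[of b "ap f b" a] sub[OF Ord_mem[OF t b]] b Ord_mem[OF t b] om a subD[OF m] by blast
  qed
  with t f show ?thesis by (auto simp: eqp_def)
qed

text \<open>Representing each value by its least argument reduces an image to a subset of
  \<open>a\<close>.\<close>

lemma image_eqp_Ord:
  assumes a: "Ord a" and F: "dft (\<lambda>e. F (e 0))"
  shows "\<exists>t. Ord t \<and> t \<sqsubseteq> a \<and> eqp t (Repl a F)"
proof -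
  have F1: "dft a \<Longrightarrow> dft (\<lambda>e. F (a e))" for a by (rule dft1[OF F])
  define m where "m = Sep a (\<lambda>x. \<forall>y. y \<epsilon> x \<longrightarrow> F y \<noteq> F x)"
  have m: "x \<epsilon> m \<longleftrightarrow> x \<epsilon> a \<and> (\<forall>y. y \<epsilon> x \<longrightarrow> F y \<noteq> F x)" for x
    by (simp add: m_def F1)
  have "Bij (lam m F) m (Repl a F)"
  proof (rule Bij_lam[OF F])
    show "F x \<epsilon> Repl a F" if "x \<epsilon> m" for x using that m F by auto
    show "\<exists>x. x \<epsilon> m \<and> F x = y" if "y \<epsilon> Repl a F" for y
    proof -
      obtain x where x: "x \<epsilon> a" "y = F x" using \<open>y \<epsilon> Repl a F\<close> F by auto
      have "dfb (\<lambda>e. e 0 \<epsilon> a \<and> y = F (e 0))" by (simp add: F1)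
      from Ord_least[of "\<lambda>x. x \<epsilon> a \<and> y = F x", OF this Ord_mem[OF a x(1)]] x
      obtain x where "x \<epsilon> a" "y = F x" "\<And>c. c \<epsilon> x \<Longrightarrow> \<not> (c \<epsilon> a \<and> y = F c)" by blast
      then show ?thesis using m Ord_trans[OF a, of x] by metis
    qed
    show "x = x'" if "x \<epsilon> m" "x' \<epsilon> m" "F x = F x'" for x x'
      using that Ord_linear[of x x'] Ord_mem[OF a] unfolding m by metis
  qed
  moreover obtain t where "Ord t" "t \<sqsubseteq> a" "eqp t m"
    using subset_eqp_Ord[OF a, of m] m by (auto simp: sub_def)
  ultimately show ?thesis using eqp_trans[of t m] unfolding eqp_def by blast
qed

section \<open>Cardinals\<close>

definition Lim :: "'a \<Rightarrow> bool" where
  "Lim a \<longleftrightarrow> Ord a \<and> a \<noteq> emp \<and> (\<forall>x. x \<epsilon> a \<longrightarrow> (\<exists>y. y \<epsilon> a \<and> x \<epsilon> y))"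

lemma sat_limit [sats]: "a < n \<Longrightarrow> sat E e (limit a n) \<longleftrightarrow> Lim (lk e n a)"
  by (simp add: limit_def sats Lim_def)

lemma df_Lim [simp]: "dft a \<Longrightarrow> dfb (\<lambda>e. Lim (a e))"
  by (rule dfb1[of Lim]) (simp_all add: Lim_def)

definition Card :: "'a \<Rightarrow> bool" where
  "Card k \<longleftrightarrow> Ord k \<and> (\<forall>a. a \<epsilon> k \<longrightarrow> \<not> eqp a k)"

lemma sat_cardinal [sats]: "k < n \<Longrightarrow> sat E e (cardinal k n) \<longleftrightarrow> Card (lk e n k)"
  by (simp add: cardinal_def sats Card_def)

lemma df_Card [simp]: "dft a \<Longrightarrow> dfb (\<lambda>e. Card (a e))"
  by (rule dfb1[of Card]) (simp_all add: Card_def)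

definition cless :: "'a \<Rightarrow> 'a \<Rightarrow> bool" where
  "cless x k \<longleftrightarrow> (\<exists>a. a \<epsilon> k \<and> eqp a x)"

lemma sat_card_less [sats]: "x < n \<Longrightarrow> k < n \<Longrightarrow> sat E e (card_less x k n) \<longleftrightarrow> cless (lk e n x) (lk e n k)"
  by (simp add: card_less_def sats cless_def)

definition UCard :: "'a \<Rightarrow> bool" where
  "UCard k \<longleftrightarrow> Card k \<and> (\<exists>w. (Lim w \<and> (\<forall>a. a \<epsilon> w \<longrightarrow> \<not> Lim a)) \<and> w \<epsilon> k)"

lemma sat_uncountable_cardinal [sats]: "k < n \<Longrightarrow> sat E e (uncountable_cardinal k n) \<longleftrightarrow> UCard (lk e n k)"
  by (simp add: uncountable_cardinal_def is_omega_def sats UCard_def)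

definition SuccCard :: "'a \<Rightarrow> 'a \<Rightarrow> bool" where
  "SuccCard m k \<longleftrightarrow> Card m \<and> k \<epsilon> m \<and> (\<forall>v. Card v \<and> k \<epsilon> v \<longrightarrow> m \<sqsubseteq> v)"

lemma sat_is_succ_cardinal [sats]: "m < n \<Longrightarrow> k < n \<Longrightarrow>
    sat E e (is_succ_cardinal m k n) \<longleftrightarrow> SuccCard (lk e n m) (lk e n k)"
  by (simp add: is_succ_cardinal_def sats SuccCard_def)

section \<open>Existence of cardinals, Cantor's theorem and successor cardinals\<close>

lemma ex_Card: "\<exists>t. Card t \<and> eqp t S"
proof -
  obtain t where "Ord t" "eqp t S" using well_order[of S] by (auto simp: eqp_def)
  then obtain t where "Ord t" "eqp t S" "\<And>c. c \<epsilon> t \<Longrightarrow> \<not> eqp c S"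
    using Ord_least[of "\<lambda>t. eqp t S"] by auto
  then show ?thesis unfolding Card_def using eqp_trans by blast
qed

lemma Cantor:
  assumes "\<And>Y. Y \<sqsubseteq> k \<Longrightarrow> \<exists>x. x \<epsilon> k \<and> ap f x = Y"
  shows False
proof -
  define D where "D = Sep k (\<lambda>x. \<not> x \<epsilon> ap f x)"
  have D: "x \<epsilon> D \<longleftrightarrow> x \<epsilon> k \<and> \<not> x \<epsilon> ap f x" for x by (simp add: D_def)
  then have "D \<sqsubseteq> k" by (simp add: sub_def)
  then obtain x where "x \<epsilon> k" "ap f x = D" using assms by blast
  with D[of x] show False by blast
qed

text \<open>Here \<open>t\<close> is \<open>2^k\<close>. It bounds the successor cardinal from
  above, and later it is the set of indices for the fine measure.\<close>

lemma Pow_enumeration: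
  assumes "Ord k"
  shows "\<exists>t f. Card t \<and> Bij f t (Pow k) \<and> k \<epsilon> t"
proof -
  obtain t f where t: "Card t" and f: "Bij f t (Pow k)"
    using ex_Card[of "Pow k"] by (auto simp: eqp_def)
  have "k \<epsilon> t"
  proof (rule ccontr)
    assume "\<not> k \<epsilon> t"
    then have tk: "t \<sqsubseteq> k" using t assms Ord_not_mem unfolding Card_def by blast
    show False
    proof (rule Cantor[of k f])
      fix Y assume "Y \<sqsubseteq> k"
      then show "\<exists>x. x \<epsilon> k \<and> ap f x = Y" using BijD(3)[OF f, of Y] subD[OF tk] by auto
    qed
  qed
  with t f show ?thesis by blast
qed

text \<open>The successor is at most \<open>2^k\<close>, so an enumeration of \<open>Pow k\<close>
  restricts to it. The distinct sets \<open>ap X a\<close> are what tells the members of the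
  independent family apart.\<close>

lemma ex_SuccCard:
  assumes "Ord k"
  shows "\<exists>m X. SuccCard m k \<and> Fun X m (Pow k) \<and>
    (\<forall>x y. x \<epsilon> m \<longrightarrow> y \<epsilon> m \<longrightarrow> ap X x = ap X y \<longrightarrow> x = y)"
proof -
  obtain t f where t: "Card t" and f: "Bij f t (Pow k)" and k: "k \<epsilon> t"
    using Pow_enumeration[OF assms] by blast
  have "Ord t" using t by (simp add: Card_def)
  from Ord_least[of "\<lambda>m. Card m \<and> k \<epsilon> m", OF _ this] t k
  obtain m where m: "Card m" "k \<epsilon> m" "\<And>c. c \<epsilon> m \<Longrightarrow> \<not> (Card c \<and> k \<epsilon> c)" by auto
  have s: "m \<sqsubseteq> v" if "Card v" "k \<epsilon> v" for v
    using m that Ord_not_mem[of v m] unfolding Card_def by blast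
  have mt: "m \<sqsubseteq> t" using s t k by blast
  have "Fun (lam m (ap f)) m (Pow k)"
    by (rule Fun_lam) (use BijD(2)[OF f] subD[OF mt] in auto)
  moreover have "x = y" if "x \<epsilon> m" "y \<epsilon> m" "ap (lam m (ap f)) x = ap (lam m (ap f)) y" for x y
    using that BijD(4)[OF f subD[OF mt that(1)] subD[OF mt that(2)]] by simp
  ultimately show ?thesis using m s unfolding SuccCard_def by blast
qed

end

section \<open>Complete ultrafilters\<close>

context zfc
begin

definition Filt :: "'a \<Rightarrow> 'a \<Rightarrow> bool" where
  "Filt F S \<longleftrightarrow> (\<forall>X. X \<epsilon> F \<longrightarrow> X \<sqsubseteq> S \<and> X \<noteq> emp) \<and> S \<epsilon> F \<and>
    (\<forall>X Y. X \<epsilon> F \<and> X \<sqsubseteq> Y \<and> Y \<sqsubseteq> S \<longrightarrow> Y \<epsilon> F) \<and>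
    (\<forall>X Y. X \<epsilon> F \<and> Y \<epsilon> F \<longrightarrow> (\<exists>Z. Z \<epsilon> F \<and> (\<forall>x. x \<epsilon> Z \<longleftrightarrow> x \<epsilon> X \<and> x \<epsilon> Y)))"

lemma sat_filter_on [sats]: "F < n \<Longrightarrow> S < n \<Longrightarrow> sat E e (filter_on F S n) \<longleftrightarrow> Filt (lk e n F) (lk e n S)"
  by (simp add: filter_on_def sats Filt_def)

definition Ultra :: "'a \<Rightarrow> 'a \<Rightarrow> bool" where
  "Ultra U S \<longleftrightarrow> Filt U S \<and>
    (\<forall>X. X \<sqsubseteq> S \<longrightarrow> X \<epsilon> U \<or> (\<exists>Y. Y \<epsilon> U \<and> (\<forall>x. x \<epsilon> Y \<longleftrightarrow> x \<epsilon> S \<and> \<not> x \<epsilon> X)))"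

lemma sat_ultrafilter_on [sats]: "U < n \<Longrightarrow> S < n \<Longrightarrow>
    sat E e (ultrafilter_on U S n) \<longleftrightarrow> Ultra (lk e n U) (lk e n S)"
  by (simp add: ultrafilter_on_def is_Diff_def sats Ultra_def)

definition Compl :: "'a \<Rightarrow> 'a \<Rightarrow> bool" where
  "Compl k F \<longleftrightarrow> (\<forall>W. W \<sqsubseteq> F \<and> W \<noteq> emp \<and> cless W k \<longrightarrow>
    (\<exists>X. X \<epsilon> F \<and> (\<forall>x. x \<epsilon> X \<longleftrightarrow> (\<forall>Y. Y \<epsilon> W \<longrightarrow> x \<epsilon> Y))))"

lemma sat_complete_filter [sats]: "k < n \<Longrightarrow> F < n \<Longrightarrow>
    sat E e (complete_filter k F n) \<longleftrightarrow> Compl (lk e n k) (lk e n F)"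
  by (simp add: complete_filter_def is_Inter_def sats Compl_def)

definition Club :: "'a \<Rightarrow> 'a \<Rightarrow> bool" where
  "Club C k \<longleftrightarrow> C \<sqsubseteq> k \<and> (\<forall>a. a \<epsilon> k \<longrightarrow> (\<exists>b. b \<epsilon> C \<and> a \<epsilon> b)) \<and>
    (\<forall>a. a \<epsilon> k \<and> Lim a \<and> (\<forall>b. b \<epsilon> a \<longrightarrow> (\<exists>c. c \<epsilon> C \<and> c \<epsilon> a \<and> b \<epsilon> c)) \<longrightarrow> a \<epsilon> C)"

lemma sat_is_club [sats]: "C < n \<Longrightarrow> k < n \<Longrightarrow> sat E e (is_club C k n) \<longleftrightarrow> Club (lk e n C) (lk e n k)"
  by (simp add: is_club_def sats Club_def)

lemma df_Club [simp]: "dft a \<Longrightarrow> dft b \<Longrightarrow> dfb (\<lambda>e. Club (a e) (b e))"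
  by (rule dfb2[of Club]) (simp_all add: Club_def)

lemma ClubD:
  assumes "Club C k"
  shows "C \<sqsubseteq> k" "a \<epsilon> k \<Longrightarrow> \<exists>b. b \<epsilon> C \<and> a \<epsilon> b"
    "a \<epsilon> k \<Longrightarrow> Lim a \<Longrightarrow> (\<And>b. b \<epsilon> a \<Longrightarrow> \<exists>c. c \<epsilon> C \<and> c \<epsilon> a \<and> b \<epsilon> c) \<Longrightarrow> a \<epsilon> C"
  using assms unfolding Club_def by blast+

end

locale complete_ultrafilter = zfc +
  fixes k U S :: 'a
  assumes Ord_k: "Ord k" and ultra: "Ultra U S" and complete: "Compl k U"
begin

text \<open>The measure quantifier "for almost all \<open>x\<close> in \<open>S\<close>". It takes
  the place of the ultrapower in the arguments below.\<close>

definition Um :: "('a \<Rightarrow> bool) \<Rightarrow> bool" where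
  "Um P \<longleftrightarrow> Sep S P \<epsilon> U"

lemma df_Um [simp]: "dfb (\<lambda>e. P (e 0) (\<lambda>i. e (Suc i))) \<Longrightarrow> dfb (\<lambda>e. Um (\<lambda>x. P x e))"
  unfolding Um_def by simp

lemma Um_True: "Um (\<lambda>x. True)"
proof -
  have "Sep S (\<lambda>x. True) = S" by (rule ext_eq) simp
  then show ?thesis using ultra unfolding Um_def Ultra_def Filt_def by simp
qed

lemma Um_mono:
  assumes "Um P" "dfb (\<lambda>e. P (e 0))" "dfb (\<lambda>e. Q (e 0))" "\<And>x. x \<epsilon> S \<Longrightarrow> P x \<Longrightarrow> Q x"
  shows "Um Q"
proof -
  have "Sep S P \<sqsubseteq> Sep S Q" "Sep S Q \<sqsubseteq> S" using assms by (auto simp: sub_def)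
  then show ?thesis using ultra assms(1) unfolding Um_def Ultra_def Filt_def by blast
qed

lemma Um_I: "dfb (\<lambda>e. Q (e 0)) \<Longrightarrow> (\<And>x. x \<epsilon> S \<Longrightarrow> Q x) \<Longrightarrow> Um Q"
  by (rule Um_mono[OF Um_True]) auto

lemma Um_conj:
  assumes "Um P" "Um Q" "dfb (\<lambda>e. P (e 0))" "dfb (\<lambda>e. Q (e 0))"
  shows "Um (\<lambda>x. P x \<and> Q x)"
proof -
  obtain Z where Z: "Z \<epsilon> U" "\<And>x. x \<epsilon> Z \<longleftrightarrow> x \<epsilon> Sep S P \<and> x \<epsilon> Sep S Q"
    using ultra assms(1,2) unfolding Um_def Ultra_def Filt_def by blast
  have "Z = Sep S (\<lambda>x. P x \<and> Q x)"
    by (rule ext_eq) (use Z(2) assms(3,4) in auto)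
  with Z(1) show ?thesis by (simp add: Um_def)
qed

lemma Um_not:
  assumes "\<not> Um P" "dfb (\<lambda>e. P (e 0))"
  shows "Um (\<lambda>x. \<not> P x)"
proof -
  have "Sep S P \<sqsubseteq> S" using assms(2) by (simp add: sub_def)
  then obtain Y where Y: "Y \<epsilon> U" "\<And>x. x \<epsilon> Y \<longleftrightarrow> x \<epsilon> S \<and> \<not> x \<epsilon> Sep S P"
    using ultra assms(1) unfolding Um_def Ultra_def by blast
  have "Y = Sep S (\<lambda>x. \<not> P x)"
    by (rule ext_eq) (use Y(2) assms(2) in auto)
  with Y(1) show ?thesis by (simp add: Um_def)
qed

lemma Um_ex:
  assumes "Um P" "dfb (\<lambda>e. P (e 0))"
  shows "\<exists>x. x \<epsilon> S \<and> P x"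
proof -
  have "Sep S P \<noteq> emp" using ultra assms(1) unfolding Um_def Ultra_def Filt_def by blast
  then show ?thesis using assms(2) by (simp add: ex_mem)
qed

text \<open>The sets for different \<open>i\<close> may coincide, so the family is only an image of
  \<open>a\<close>; \<open>image_eqp_Ord\<close> still gives it a size below \<open>k\<close>. The
  case of an empty \<open>a\<close> is separate because \<open>Compl\<close> speaks of nonempty
  families.\<close>

lemma Um_all:
  assumes a: "a \<epsilon> k" and P: "dfb (\<lambda>e. P (e 0) (e (Suc 0)))" and all: "\<And>i. i \<epsilon> a \<Longrightarrow> Um (P i)"
  shows "Um (\<lambda>x. \<forall>i. i \<epsilon> a \<longrightarrow> P i x)"
proof (cases "a = emp")
  case True
  then show ?thesis by (intro Um_I) simp_all
next
  case False
  have P2: "dft s \<Longrightarrow> dft t \<Longrightarrow> dfb (\<lambda>e. P (s e) (t e))" for s t by (rule dfb2[of P, OF P])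
  have F: "dft (\<lambda>e. Sep S (P (e 0)))" by (simp add: P2)
  let ?W = "Repl a (\<lambda>i. Sep S (P i))"
  obtain t where t: "Ord t" "t \<sqsubseteq> a" "eqp t ?W"
    using image_eqp_Ord[OF Ord_mem[OF Ord_k a] F] by blast
  have "t \<epsilon> k" using Ord_sub_mem[OF t(1) Ord_mem[OF Ord_k a] Ord_k t(2) a] .
  with t have "cless ?W k" unfolding cless_def by blast
  moreover have "?W \<sqsubseteq> U" using all F unfolding sub_def Um_def by auto
  moreover have "?W \<noteq> emp" using False F unfolding ex_mem by auto
  ultimately obtain X where X: "X \<epsilon> U" "\<And>x. x \<epsilon> X \<longleftrightarrow> (\<forall>Y. Y \<epsilon> ?W \<longrightarrow> x \<epsilon> Y)"
    using complete unfolding Compl_def by blast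
  have "X = Sep S (\<lambda>x. \<forall>i. i \<epsilon> a \<longrightarrow> P i x)"
  proof (rule ext_eq)
    fix x
    have "x \<epsilon> X \<longleftrightarrow> (\<forall>i. i \<epsilon> a \<longrightarrow> x \<epsilon> S \<and> P i x)"
      unfolding X(2) mem_Repl[OF F] using P2 by auto
    then show "x \<epsilon> X \<longleftrightarrow> x \<epsilon> Sep S (\<lambda>x. \<forall>i. i \<epsilon> a \<longrightarrow> P i x)"
      using False P2 unfolding ex_mem by auto
  qed
  with X(1) show ?thesis by (simp add: Um_def)
qed

lemma Um_ex_bounded:
  assumes a: "a \<epsilon> k" and P: "dfb (\<lambda>e. P (e 0) (e (Suc 0)))" and ex: "Um (\<lambda>x. \<exists>i. i \<epsilon> a \<and> P i x)"
  shows "\<exists>i. i \<epsilon> a \<and> Um (P i)"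
proof (rule ccontr)
  assume *: "\<not> ?thesis"
  have P2: "dft s \<Longrightarrow> dft t \<Longrightarrow> dfb (\<lambda>e. P (s e) (t e))" for s t by (rule dfb2[of P, OF P])
  have "Um (\<lambda>x. \<forall>i. i \<epsilon> a \<longrightarrow> \<not> P i x)"
    by (rule Um_all[OF a]) (use * in \<open>auto intro: Um_not simp: P2\<close>)
  from Um_ex[OF Um_conj[OF ex this]] show False by (auto simp: P2)
qed

end

section \<open>Normal measures\<close>

text \<open>Normality appears as pressing down for definable functions, and \<open>tail\<close>
  makes the measure nonprincipal. Completeness is inherited.\<close>

locale normal_measure = complete_ultrafilter E k U k for E :: "'a \<Rightarrow> 'a \<Rightarrow> bool" (infix "\<epsilon>" 50) and k U +
  assumes tail: "a \<epsilon> k \<Longrightarrow> Um (\<lambda>x. a \<epsilon> x)"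
    and regressive: "dft (\<lambda>e. F (e 0)) \<Longrightarrow> Um (\<lambda>x. F x \<epsilon> x) \<Longrightarrow> \<exists>a. a \<epsilon> k \<and> Um (\<lambda>x. F x = a)"
begin

text \<open>Taking the least witness turns the relation into a regressive function.\<close>

lemma regressive_rel:
  assumes R: "dfb (\<lambda>e. R (e 0) (e (Suc 0)))" and ex: "Um (\<lambda>x. \<exists>b. b \<epsilon> x \<and> R b x)"
  shows "\<exists>b. b \<epsilon> k \<and> Um (R b)"
proof -
  have R2: "dft s \<Longrightarrow> dft t \<Longrightarrow> dfb (\<lambda>e. R (s e) (t e))" for s t by (rule dfb2[of R, OF R])
  define F where "F x = the1 (\<lambda>b. Ord b \<and> (b \<epsilon> x \<and> R b x) \<and> (\<forall>d. d \<epsilon> b \<longrightarrow> \<not> (d \<epsilon> x \<and> R d x)))" for x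
  have F: "dft (\<lambda>e. F (e 0))" by (simp add: F_def R2)
  have F1: "dft a \<Longrightarrow> dft (\<lambda>e. F (a e))" for a by (rule dft1[OF F])
  have FR: "F x \<epsilon> x \<and> R (F x) x" if "x \<epsilon> k" "\<exists>b. b \<epsilon> x \<and> R b x" for x
  proof -
    have "Ord x" using Ord_mem[OF Ord_k] that by blast
    have "dfb (\<lambda>e. e 0 \<epsilon> x \<and> R (e 0) x)" by (simp add: R2)
    from Ord_least[of "\<lambda>b. b \<epsilon> x \<and> R b x", OF this] that(2) Ord_mem[OF \<open>Ord x\<close>]
    obtain b where b: "Ord b \<and> (b \<epsilon> x \<and> R b x) \<and> (\<forall>d. d \<epsilon> b \<longrightarrow> \<not> (d \<epsilon> x \<and> R d x))" by blast
    have "F x = b" unfolding F_def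
      by (rule the1_eq) (use b Ord_linear in blast)+
    with b show ?thesis by blast
  qed
  have "Um (\<lambda>x. F x \<epsilon> x \<and> R (F x) x)"
    by (rule Um_mono[OF ex]) (simp_all add: R2 F1 FR)
  then have both: "Um (\<lambda>x. F x \<epsilon> x)" "Um (\<lambda>x. R (F x) x)"
    by (rule Um_mono; simp add: R2 F1)+
  obtain a where a: "a \<epsilon> k" "Um (\<lambda>x. F x = a)" using regressive[OF F both(1)] by blast
  have "Um (R a)"
    by (rule Um_mono[OF Um_conj[OF both(2) a(2)]]) (auto simp: R2 F1)
  with a(1) show ?thesis by blast
qed

text \<open>Otherwise almost every \<open>x\<close> has some \<open>b\<close> below it with no point
  of \<open>C\<close> between \<open>b\<close> and \<open>x\<close>. Pressing \<open>b\<close> down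
  to a constant contradicts the point of \<open>C\<close> above it, which lies below almost every
  \<open>x\<close>.\<close>

lemma Um_limit_point:
  assumes "\<And>a. a \<epsilon> k \<Longrightarrow> \<exists>b. b \<epsilon> C \<and> a \<epsilon> b" and sub: "C \<sqsubseteq> k"
  shows "Um (\<lambda>x. \<forall>b. b \<epsilon> x \<longrightarrow> (\<exists>c. c \<epsilon> C \<and> c \<epsilon> x \<and> b \<epsilon> c))"
proof (rule ccontr)
  assume "\<not> ?thesis"
  then have "Um (\<lambda>x. \<not> (\<forall>b. b \<epsilon> x \<longrightarrow> (\<exists>c. c \<epsilon> C \<and> c \<epsilon> x \<and> b \<epsilon> c)))"
    by (rule Um_not) simp
  then have "Um (\<lambda>x. \<exists>b. b \<epsilon> x \<and> \<not> (\<exists>c. c \<epsilon> C \<and> c \<epsilon> x \<and> b \<epsilon> c))"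
    by (rule Um_mono) auto
  then obtain b where b: "b \<epsilon> k" "Um (\<lambda>x. \<not> (\<exists>c. c \<epsilon> C \<and> c \<epsilon> x \<and> b \<epsilon> c))"
    using regressive_rel[of "\<lambda>b x. \<not> (\<exists>c. c \<epsilon> C \<and> c \<epsilon> x \<and> b \<epsilon> c)"] by auto
  obtain c where c: "c \<epsilon> C" "b \<epsilon> c" using assms(1)[OF b(1)] by blast
  have "Um (\<lambda>x. c \<epsilon> x)" using tail subD[OF sub c(1)] by blast
  from Um_ex[OF Um_conj[OF b(2) this]] c show False by auto
qed

lemma nonempty_k: "\<exists>x. x \<epsilon> k"
  using Um_ex[OF Um_True] by simp

lemma Um_Club:
  assumes C: "Club C k"
  shows "Um (\<lambda>x. x \<epsilon> C)"
proof -
  obtain a where "a \<epsilon> k" using nonempty_k ..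
  \<comment> \<open>The element \<open>a\<close> excludes \<open>x = emp\<close>, at which the limit
    condition holds vacuously.\<close>
  have "Um (\<lambda>x. a \<epsilon> x \<and> (\<forall>b. b \<epsilon> x \<longrightarrow> (\<exists>c. c \<epsilon> C \<and> c \<epsilon> x \<and> b \<epsilon> c)))"
    by (rule Um_conj[OF tail[OF \<open>a \<epsilon> k\<close>] Um_limit_point]) (use ClubD[OF C] in auto)
  then show ?thesis
  proof (rule Um_mono)
    fix x
    assume x: "x \<epsilon> k" and *: "a \<epsilon> x \<and> (\<forall>b. b \<epsilon> x \<longrightarrow> (\<exists>c. c \<epsilon> C \<and> c \<epsilon> x \<and> b \<epsilon> c))"
    then have "Lim x" unfolding Lim_def ex_mem using Ord_mem[OF Ord_k x] by blast
    with x * show "x \<epsilon> C" using ClubD(3)[OF C] by blast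
  qed simp_all
qed

text \<open>Unboundedness comes from the measure: fewer than \<open>k\<close> clubs hold almost
  everywhere at once, and so does every tail.\<close>

lemma Club_Inter:
  assumes a: "a \<epsilon> k" and C: "\<And>i. i \<epsilon> a \<Longrightarrow> Club (ap f i) k"
  shows "Club (Sep k (\<lambda>x. \<forall>i. i \<epsilon> a \<longrightarrow> x \<epsilon> ap f i)) k" (is "Club ?C k")
  unfolding Club_def
proof (intro conjI allI impI)
  show "?C \<sqsubseteq> k" by (simp add: sub_def)
  have "Um (\<lambda>x. \<forall>i. i \<epsilon> a \<longrightarrow> x \<epsilon> ap f i)"
    by (rule Um_all[OF a]) (use Um_Club[OF C] in auto)
  then show "\<exists>b. b \<epsilon> ?C \<and> d \<epsilon> b" if "d \<epsilon> k" for d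
    using Um_ex[OF Um_conj[OF _ tail[OF that]]] by auto
  fix d
  assume d: "d \<epsilon> k \<and> Lim d \<and> (\<forall>b. b \<epsilon> d \<longrightarrow> (\<exists>c. c \<epsilon> ?C \<and> c \<epsilon> d \<and> b \<epsilon> c))"
  have "d \<epsilon> ap f i" if "i \<epsilon> a" for i
    by (rule ClubD(3)[OF C[OF that]]) (use d that in auto)
  with d show "d \<epsilon> ?C" by simp
qed

text \<open>Stationary sets reflect almost everywhere: clubs of almost all \<open>x\<close> avoiding \<open>T\<close> would
  induce a club of \<open>k\<close> avoiding \<open>T\<close>.\<close>

lemma stationary_reflection:
  assumes T: "\<And>C. Club C k \<Longrightarrow> \<exists>y. y \<epsilon> C \<and> y \<epsilon> T"
  shows "Um (\<lambda>x. \<forall>c. Club c x \<longrightarrow> (\<exists>y. y \<epsilon> c \<and> y \<epsilon> T))"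
proof (rule ccontr)
  assume "\<not> ?thesis"
  then have bad: "Um (\<lambda>x. \<not> (\<forall>c. Club c x \<longrightarrow> (\<exists>y. y \<epsilon> c \<and> y \<epsilon> T)))"
    by (rule Um_not) simp
  let ?R = "\<lambda>x c. Club c x \<and> (\<forall>y. y \<epsilon> c \<longrightarrow> \<not> y \<epsilon> T)"
  have "\<exists>f. Fun f (Sep k (\<lambda>x. \<exists>c. ?R x c)) (Pow k) \<and>
      (\<forall>x. x \<epsilon> Sep k (\<lambda>x. \<exists>c. ?R x c) \<longrightarrow> ?R x (ap f x))"
  proof (rule choose)
    fix x assume "x \<epsilon> Sep k (\<lambda>x. \<exists>c. ?R x c)"
    then obtain c where x: "x \<epsilon> k" and c: "?R x c" by auto
    have "x \<sqsubseteq> k" using Ord_k x unfolding Ord_def by blast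
    with c have "c \<epsilon> Pow k" using ClubD(1)[of c x] by (auto simp: sub_def)
    with c show "\<exists>c. c \<epsilon> Pow k \<and> ?R x c" by blast
  qed simp
  then obtain f where f: "\<And>x. x \<epsilon> k \<Longrightarrow> \<exists>c. ?R x c \<Longrightarrow> ?R x (ap f x)" by auto
  have "Um (\<lambda>x. ?R x (ap f x))"
    by (rule Um_mono[OF bad]) (simp, simp, rule f, blast, blast)
  then have cl: "Um (\<lambda>x. Club (ap f x) x)" and dis: "Um (\<lambda>x. \<forall>y. y \<epsilon> ap f x \<longrightarrow> \<not> y \<epsilon> T)"
    by (rule Um_mono; simp)+
  \<comment> \<open>In the ultrapower, \<open>f\<close> represents a club of \<open>k\<close>, and
    \<open>D\<close> is that club. Unboundedness follows by pressing down, closure by completeness,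
    since the point \<open>a\<close> has fewer than \<open>k\<close> elements.\<close>
  define D where "D = Sep k (\<lambda>y. Um (\<lambda>x. y \<epsilon> ap f x))"
  have D: "y \<epsilon> D \<longleftrightarrow> y \<epsilon> k \<and> Um (\<lambda>x. y \<epsilon> ap f x)" for y by (simp add: D_def)
  have "Club D k"
    unfolding Club_def
  proof (intro conjI allI impI)
    show "D \<sqsubseteq> k" by (simp add: sub_def D)
    fix a assume a: "a \<epsilon> k"
    have "Um (\<lambda>x. \<exists>b. b \<epsilon> x \<and> (b \<epsilon> ap f x \<and> a \<epsilon> b))"
    proof (rule Um_mono[OF Um_conj[OF cl tail[OF a]]])
      show "\<exists>b. b \<epsilon> x \<and> (b \<epsilon> ap f x \<and> a \<epsilon> b)" if "Club (ap f x) x \<and> a \<epsilon> x" for x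
        using that ClubD(1,2)[of "ap f x" x] subD by blast
    qed simp_all
    from regressive_rel[of "\<lambda>b x. b \<epsilon> ap f x \<and> a \<epsilon> b", OF _ this]
    obtain b where b: "b \<epsilon> k" "Um (\<lambda>x. b \<epsilon> ap f x \<and> a \<epsilon> b)" by auto
    from b(2) have "Um (\<lambda>x. b \<epsilon> ap f x)" by (rule Um_mono) simp_all
    moreover have "a \<epsilon> b" using Um_ex[OF b(2)] by auto
    ultimately show "\<exists>b. b \<epsilon> D \<and> a \<epsilon> b" using b(1) D by blast
  next
    fix a assume a: "a \<epsilon> k \<and> Lim a \<and> (\<forall>b. b \<epsilon> a \<longrightarrow> (\<exists>c. c \<epsilon> D \<and> c \<epsilon> a \<and> b \<epsilon> c))"
    have "Um (\<lambda>x. \<forall>c. c \<epsilon> a \<longrightarrow> (c \<epsilon> D \<longrightarrow> c \<epsilon> ap f x))"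
    proof (rule Um_all)
      show "Um (\<lambda>x. c \<epsilon> D \<longrightarrow> c \<epsilon> ap f x)" if "c \<epsilon> a" for c
      proof (cases "c \<epsilon> D")
        case True
        then show ?thesis using D by simp
      next
        case False
        then show ?thesis by (intro Um_I) simp_all
      qed
    qed (use a in simp_all)
    from Um_conj[OF Um_conj[OF cl tail[of a]] this]
    have "Um (\<lambda>x. a \<epsilon> ap f x)"
    proof (rule Um_mono)
      fix x assume "(Club (ap f x) x \<and> a \<epsilon> x) \<and> (\<forall>c. c \<epsilon> a \<longrightarrow> (c \<epsilon> D \<longrightarrow> c \<epsilon> ap f x))"
      then show "a \<epsilon> ap f x" using a ClubD(3)[of "ap f x" x a] by blast
    qed (use a in simp_all)
    with a show "a \<epsilon> D" using D by blast
  qed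
  then obtain y where y: "y \<epsilon> D" "y \<epsilon> T" using T by blast
  with D have "Um (\<lambda>x. y \<epsilon> ap f x)" by blast
  from Um_ex[OF Um_conj[OF this dis]] y(2) show False by auto
qed

section \<open>A function with stationary fibres\<close>

definition cube :: "'a \<Rightarrow> 'a" where
  "cube b = prod b (prod b b)"

lemma df_cube [simp]: "dft a \<Longrightarrow> dft (\<lambda>e. cube (a e))"
  by (simp add: cube_def)

lemma mem_cube: "p \<epsilon> cube b \<longleftrightarrow> (\<exists>i z w. i \<epsilon> b \<and> z \<epsilon> b \<and> w \<epsilon> b \<and> p = pair i (pair z w))"
  by (auto simp: cube_def)

lemma cube_mono: "a \<sqsubseteq> b \<Longrightarrow> cube a \<sqsubseteq> cube b"
  unfolding cube_def by (intro prod_mono)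

text \<open>The value at \<open>x\<close> is some bounded \<open>t\<close> whose fibre below \<open>x\<close> is not stationary in \<open>x\<close>. If
  there is one almost everywhere, the function is almost everywhere constant (press down the
  bound and decide membership of each triple), which contradicts reflection.\<close>

theorem stationary_fibres:
  "\<exists>h. \<forall>t b C. b \<epsilon> k \<longrightarrow> t \<sqsubseteq> cube b \<longrightarrow> Club C k \<longrightarrow> (\<exists>x. x \<epsilon> C \<and> ap h x = t)"
proof -
  obtain ch where ch: "\<And>x. x \<sqsubseteq> Pow (cube k) \<Longrightarrow> x \<noteq> emp \<Longrightarrow> ap ch x \<epsilon> x"
    using choice_function[of "Pow (Pow (cube k))"] by auto
  define bad where "bad x f = Sep (Pow (cube k)) (\<lambda>t. (\<exists>b. b \<epsilon> x \<and> t \<sqsubseteq> cube b) \<and>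
      (\<exists>c. Club c x \<and> (\<forall>y. y \<epsilon> c \<longrightarrow> ap f y \<noteq> t)))" for x f
  have bad: "t \<epsilon> bad x f \<longleftrightarrow> t \<sqsubseteq> cube k \<and> (\<exists>b. b \<epsilon> x \<and> t \<sqsubseteq> cube b) \<and>
      (\<exists>c. Club c x \<and> (\<forall>y. y \<epsilon> c \<longrightarrow> ap f y \<noteq> t))" for t x f
    by (simp add: bad_def)
  \<comment> \<open>The recursion sees only the restriction \<open>f\<close> of the function to
    \<open>x\<close>; its domain recovers the stage \<open>x\<close>.\<close>
  define dm where "dm f = Sep (union (union f)) (\<lambda>y. \<exists>z. pair y z \<epsilon> f)" for f
  define G where "G f = ap ch (bad (dm f) f)" for f
  have G: "dft (\<lambda>e. G (e 0))" by (simp add: G_def bad_def dm_def)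
  define H where "H = wfrec G"
  have H: "dft (\<lambda>e. H (e 0))" unfolding H_def by (rule df_wfrec[OF G]) simp
  define h where "h = lam k H"
  have dm: "dm (lam x H) = x" for x
  proof (rule ext_eq)
    fix y
    have 1: "y \<epsilon> union (union f)" if "pair y z \<epsilon> f" for z f
      unfolding mem_union using that by (intro exI[of _ "upair y y"] exI[of _ "pair y z"]) (auto simp: pair_def)
    have "y \<epsilon> dm f \<longleftrightarrow> y \<epsilon> union (union f) \<and> (\<exists>z. pair y z \<epsilon> f)" for f
      by (simp add: dm_def)
    with 1 have "y \<epsilon> dm f \<longleftrightarrow> (\<exists>z. pair y z \<epsilon> f)" for f by blast
    then show "y \<epsilon> dm (lam x H) \<longleftrightarrow> y \<epsilon> x"
      using mem_lam[OF H] by auto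
  qed
  have h: "ap h x = ap ch (bad x h)" if x: "x \<epsilon> k" for x
  proof -
    have xk: "x \<sqsubseteq> k" using Ord_k x unfolding Ord_def by blast
    have "bad x (lam x H) = bad x h"
    proof (rule ext_eq)
      fix t
      have "(\<forall>y. y \<epsilon> c \<longrightarrow> ap (lam x H) y \<noteq> t) \<longleftrightarrow> (\<forall>y. y \<epsilon> c \<longrightarrow> ap h y \<noteq> t)" if "Club c x" for c
        using subD[OF ClubD(1)[OF that]] subD[OF xk] H unfolding h_def by auto
      then show "t \<epsilon> bad x (lam x H) \<longleftrightarrow> t \<epsilon> bad x h" unfolding bad by blast
    qed
    moreover have "ap h x = G (lam x H)"
      unfolding h_def ap_lam[OF H x] using wfrec[OF G Ord_mem[OF Ord_k x]] by (simp add: H_def)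
    ultimately show ?thesis by (simp add: G_def dm)
  qed
  have h_in: "ap h x \<epsilon> bad x h" if "x \<epsilon> k" "bad x h \<noteq> emp" for x
    unfolding h[OF that(1)] by (rule ch) (use that(2) in \<open>auto simp: sub_def bad\<close>)
  have db: "dft (\<lambda>e. bad (e 0) h)" by (simp add: bad_def)
  have none: "Um (\<lambda>x. bad x h = emp)"
  proof (rule ccontr)
    assume "\<not> ?thesis"
    then have "Um (\<lambda>x. bad x h \<noteq> emp)" by (rule Um_not) (simp add: db)
    then have hb: "Um (\<lambda>x. ap h x \<epsilon> bad x h)" by (rule Um_mono) (simp_all add: db h_in)
    then have "Um (\<lambda>x. \<exists>b. b \<epsilon> x \<and> ap h x \<sqsubseteq> cube b)"
      by (rule Um_mono) (simp_all add: db, simp add: bad)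
    from regressive_rel[of "\<lambda>b x. ap h x \<sqsubseteq> cube b", OF _ this]
    obtain b where b: "b \<epsilon> k" and hc: "Um (\<lambda>x. ap h x \<sqsubseteq> cube b)" by auto
    define t where "t = Sep (cube b) (\<lambda>p. Um (\<lambda>x. p \<epsilon> ap h x))"
    have bit: "Um (\<lambda>x. p \<epsilon> ap h x \<longleftrightarrow> p \<epsilon> t)" if "p \<epsilon> cube b" for p
    proof (cases "Um (\<lambda>x. p \<epsilon> ap h x)")
      case True
      with that have "p \<epsilon> t" by (simp add: t_def)
      with True show ?thesis by simp
    next
      case False
      then have "Um (\<lambda>x. \<not> p \<epsilon> ap h x)" by (rule Um_not) simp
      moreover have "\<not> p \<epsilon> t" using False by (simp add: t_def)
      ultimately show ?thesis by simp
    qed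
    \<comment> \<open>Nesting \<open>Um_all\<close> over the three coordinates replaces a count of
      the elements of \<open>cube b\<close>.\<close>
    have "Um (\<lambda>x. \<forall>i. i \<epsilon> b \<longrightarrow> (\<forall>z. z \<epsilon> b \<longrightarrow> (\<forall>w. w \<epsilon> b \<longrightarrow>
        (pair i (pair z w) \<epsilon> ap h x \<longleftrightarrow> pair i (pair z w) \<epsilon> t))))"
      by (intro Um_all[OF b] bit) (simp_all add: cube_def)
    from Um_conj[OF hc this]
    have ht: "Um (\<lambda>x. ap h x = t)"
    proof (rule Um_mono)
      fix x
      assume *: "ap h x \<sqsubseteq> cube b \<and> (\<forall>i. i \<epsilon> b \<longrightarrow> (\<forall>z. z \<epsilon> b \<longrightarrow> (\<forall>w. w \<epsilon> b \<longrightarrow>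
        (pair i (pair z w) \<epsilon> ap h x \<longleftrightarrow> pair i (pair z w) \<epsilon> t))))"
      have "t \<sqsubseteq> cube b" by (simp add: t_def sub_def)
      moreover have "p \<epsilon> ap h x \<longleftrightarrow> p \<epsilon> t" if "p \<epsilon> cube b" for p
        using that * unfolding mem_cube by blast
      ultimately show "ap h x = t" using * subD by (intro ext_eq) blast
    qed simp_all
    \<comment> \<open>If the fibre of \<open>t\<close> were stationary, it would reflect to almost
      every \<open>x\<close>. But there the value \<open>t\<close> was chosen for a fibre that
      misses a club of \<open>x\<close>.\<close>
    have "\<exists>C. Club C k \<and> \<not> (\<exists>y. y \<epsilon> C \<and> y \<epsilon> Sep k (\<lambda>x. ap h x = t))"
    proof (rule ccontr)
      assume "\<not> ?thesis"
      then have "Um (\<lambda>x. \<forall>c. Club c x \<longrightarrow> (\<exists>y. y \<epsilon> c \<and> y \<epsilon> Sep k (\<lambda>x. ap h x = t)))"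
        by (intro stationary_reflection) blast
      from Um_ex[OF Um_conj[OF Um_conj[OF hb ht] this]]
      obtain x where x: "ap h x \<epsilon> bad x h" "ap h x = t"
        "\<And>c. Club c x \<Longrightarrow> \<exists>y. y \<epsilon> c \<and> y \<epsilon> Sep k (\<lambda>x. ap h x = t)" by (auto simp: db)
      from x(1) obtain c where "Club c x" "\<And>y. y \<epsilon> c \<Longrightarrow> ap h y \<noteq> t" unfolding bad x(2) by blast
      with x(3)[of c] show False by auto
    qed
    then obtain C where C: "Club C k" "\<And>y. y \<epsilon> C \<Longrightarrow> \<not> y \<epsilon> Sep k (\<lambda>x. ap h x = t)" by blast
    from Um_ex[OF Um_conj[OF Um_Club[OF C(1)] ht]] C(2) show False by auto
  qed
  have "\<exists>x. x \<epsilon> C \<and> ap h x = t" if b: "b \<epsilon> k" and t: "t \<sqsubseteq> cube b" and C: "Club C k" for t b C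
  proof (rule ccontr)
    assume no: "\<not> ?thesis"
    have lp: "Um (\<lambda>x. \<forall>b. b \<epsilon> x \<longrightarrow> (\<exists>c. c \<epsilon> C \<and> c \<epsilon> x \<and> b \<epsilon> c))"
      by (rule Um_limit_point) (use ClubD[OF C] in auto)
    \<comment> \<open>Take \<open>x\<close> above \<open>b\<close> that is a limit point of
      \<open>C\<close> and has nothing bad. Then \<open>C\<close> cut at \<open>x\<close> is a club
      of \<open>x\<close>, and if it missed the fibre of \<open>t\<close>, this would make
      \<open>t\<close> bad.\<close>
    from Um_ex[OF Um_conj[OF Um_conj[OF none tail[OF b]] lp]]
    obtain x where x: "x \<epsilon> k" "bad x h = emp" "b \<epsilon> x"
      "\<And>b. b \<epsilon> x \<Longrightarrow> \<exists>c. c \<epsilon> C \<and> c \<epsilon> x \<and> b \<epsilon> c" by (auto simp: db)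
    have "Club (Sep C (\<lambda>y. y \<epsilon> x)) x"
      unfolding Club_def
    proof (intro conjI allI impI)
      show "Sep C (\<lambda>y. y \<epsilon> x) \<sqsubseteq> x" by (simp add: sub_def)
      show "\<exists>b. b \<epsilon> Sep C (\<lambda>y. y \<epsilon> x) \<and> a \<epsilon> b" if "a \<epsilon> x" for a using x(4)[OF that] by auto
      fix a
      assume a: "a \<epsilon> x \<and> Lim a \<and> (\<forall>b. b \<epsilon> a \<longrightarrow> (\<exists>c. c \<epsilon> Sep C (\<lambda>y. y \<epsilon> x) \<and> c \<epsilon> a \<and> b \<epsilon> c))"
      have "a \<epsilon> C"
        by (rule ClubD(3)[OF C]) (use a Ord_trans[OF Ord_k x(1)] in auto)
      with a show "a \<epsilon> Sep C (\<lambda>y. y \<epsilon> x)" by simp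
    qed
    moreover have "\<forall>y. y \<epsilon> Sep C (\<lambda>y. y \<epsilon> x) \<longrightarrow> ap h y \<noteq> t" using no by auto
    moreover have "t \<sqsubseteq> cube k"
      using subD[OF cube_mono[of b k]] subD[OF t] Ord_k b unfolding Ord_def by (intro subI) blast
    ultimately have "t \<epsilon> bad x h" unfolding bad using x(3) t by blast
    with x(2) show False by simp
  qed
  then show ?thesis by blast
qed

end

section \<open>The independent family\<close>

context normal_measure
begin

text \<open>These sets generate the same filter as the clubs, the sets \<open>ap A a\<close> and the complements of
  the intersections of \<open>k\<close> many of them.\<close>

definition gen :: "'a \<Rightarrow> 'a \<Rightarrow> 'a" where
  "gen m A = Sep (Pow k) (\<lambda>B. \<exists>C a I. Club C k \<and> a \<epsilon> m \<and> I \<sqsubseteq> m \<and> eqp k I \<and>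
    (\<forall>x. x \<epsilon> C \<and> x \<epsilon> ap A a \<and> \<not> (\<forall>b. b \<epsilon> I \<longrightarrow> x \<epsilon> ap A b) \<longrightarrow> x \<epsilon> B))"

lemma mem_gen: "B \<epsilon> gen m A \<longleftrightarrow> B \<sqsubseteq> k \<and> (\<exists>C a I. Club C k \<and> a \<epsilon> m \<and> I \<sqsubseteq> m \<and> eqp k I \<and>
    (\<forall>x. x \<epsilon> C \<and> x \<epsilon> ap A a \<and> \<not> (\<forall>b. b \<epsilon> I \<longrightarrow> x \<epsilon> ap A b) \<longrightarrow> x \<epsilon> B))"
  by (simp add: gen_def)

text \<open>If every value of an enumeration \<open>g\<close> of \<open>I\<close> were some
  \<open>ap f j\<close>, completeness would fix one \<open>j\<close> for almost all arguments. An
  injective \<open>g\<close> takes each value only once, whereas a set of measure one has more than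
  one element.\<close>

lemma not_covered:
  assumes a: "a \<epsilon> k" and I: "eqp k I"
  shows "\<exists>b. b \<epsilon> I \<and> (\<forall>j. j \<epsilon> a \<longrightarrow> b \<noteq> ap f j)"
proof (rule ccontr)
  assume *: "\<not> ?thesis"
  obtain g where g: "Bij g k I" using I by (auto simp: eqp_def)
  have "Um (\<lambda>x. \<exists>j. j \<epsilon> a \<and> ap g x = ap f j)"
    by (rule Um_I) (use * BijD(2)[OF g] in auto)
  from Um_ex_bounded[of a "\<lambda>j x. ap g x = ap f j", OF a _ this]
  obtain j where j: "Um (\<lambda>x. ap g x = ap f j)" by auto
  obtain x where x: "x \<epsilon> k" "ap g x = ap f j" using Um_ex[OF j] by auto
  obtain y where y: "y \<epsilon> k" "ap g y = ap f j" "x \<epsilon> y"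
    using Um_ex[OF Um_conj[OF j tail[OF x(1)]]] by auto
  have "x = y" using BijD(4)[OF g x(1) y(1)] x(2) y(2) by simp
  with y(3) mem_irrefl show False by blast
qed

lemma emp_mem_Ord:
  assumes "Ord b" "u \<epsilon> b"
  shows "emp \<epsilon> b"
proof -
  have "Ord emp" by (simp add: Ord_def)
  from Ord_linear[OF this assms(1)] assms(2) show ?thesis by auto
qed

text \<open>A point \<open>x\<close> codes the table \<open>ap h x\<close> and belongs to
  \<open>ap A a\<close> if some row agrees with \<open>ap X a\<close>. One bounded table meets fewer
  than \<open>k\<close> requirements on the family, and because its fibre is stationary it has a
  code in the intersection of the given clubs.\<close>

theorem independent_family:
  assumes X: "Fun X m (Pow k)" and inj: "\<And>x y. x \<epsilon> m \<Longrightarrow> y \<epsilon> m \<Longrightarrow> ap X x = ap X y \<Longrightarrow> x = y"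
  shows "\<exists>A. Fun A m (Pow k) \<and>
    (\<forall>a e. a \<epsilon> k \<longrightarrow> Fun e a (gen m A) \<longrightarrow> (\<exists>x. x \<epsilon> k \<and> (\<forall>i. i \<epsilon> a \<longrightarrow> x \<epsilon> ap e i)))"
proof -
  obtain h where h: "\<And>t b C. b \<epsilon> k \<Longrightarrow> t \<sqsubseteq> cube b \<Longrightarrow> Club C k \<Longrightarrow> \<exists>x. x \<epsilon> C \<and> ap h x = t"
    using stationary_fibres by blast
  \<comment> \<open>In row \<open>i\<close>, the flag \<open>w = emp\<close> says that
    \<open>z\<close> belongs to the set and any other \<open>w\<close> that it does not. The row
    must be nonempty, since an empty one would agree with every set.\<close>
  define match where "match t Y \<longleftrightarrow> (\<exists>i. (\<exists>p. pair i p \<epsilon> t) \<and>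
      (\<forall>z w. pair i (pair z w) \<epsilon> t \<longrightarrow> (z \<epsilon> Y \<longleftrightarrow> w = emp)))" for t Y
  define A where "A = lam m (\<lambda>a. Sep k (\<lambda>x. match (ap h x) (ap X a)))"
  have dA: "dft (\<lambda>e. Sep k (\<lambda>x. match (ap h x) (ap X (e 0))))" by (simp add: match_def)
  have "dfb (\<lambda>e. match (ap h (e 0)) (ap X a))" for a by (simp add: match_def)
  then have A: "x \<epsilon> ap A a \<longleftrightarrow> x \<epsilon> k \<and> match (ap h x) (ap X a)" if "a \<epsilon> m" for a x
    unfolding A_def ap_lam[OF dA that] by simp
  have FA: "Fun A m (Pow k)"
    unfolding A_def by (rule Fun_lam[OF dA]) (simp add: sub_def match_def)
  have "\<exists>x. x \<epsilon> k \<and> (\<forall>i. i \<epsilon> a \<longrightarrow> x \<epsilon> ap e i)" if a: "a \<epsilon> k" and e: "Fun e a (gen m A)" for a e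
  proof -
    let ?Q = "\<lambda>i al C I. Club C k \<and> al \<epsilon> m \<and> I \<sqsubseteq> m \<and> eqp k I \<and>
      (\<forall>x. x \<epsilon> C \<and> x \<epsilon> ap A al \<and> \<not> (\<forall>b. b \<epsilon> I \<longrightarrow> x \<epsilon> ap A b) \<longrightarrow> x \<epsilon> ap e i)"
    have Q: "\<exists>al C I. ?Q i al C I" if "i \<epsilon> a" for i
      using Fun_ap[OF e that] unfolding mem_gen by blast
    \<comment> \<open>As \<open>choose\<close> picks one object at a time, index, club and index set
      of each requirement are selected in three rounds, earlier choices entering as
      parameters.\<close>
    have "\<exists>f. Fun f a m \<and> (\<forall>i. i \<epsilon> a \<longrightarrow> (\<exists>C I. ?Q i (ap f i) C I))"
      by (rule choose[of "\<lambda>i al. \<exists>C I. ?Q i al C I"]) (simp, use Q in blast)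
    then obtain f1 where f1: "\<And>i. i \<epsilon> a \<Longrightarrow> \<exists>C I. ?Q i (ap f1 i) C I" by blast
    have "\<exists>f. Fun f a (Pow k) \<and> (\<forall>i. i \<epsilon> a \<longrightarrow> (\<exists>I. ?Q i (ap f1 i) (ap f i) I))"
      by (rule choose[of "\<lambda>i C. \<exists>I. ?Q i (ap f1 i) C I"]) (simp, use f1 ClubD(1) mem_Pow in blast)
    then obtain f2 where f2: "\<And>i. i \<epsilon> a \<Longrightarrow> \<exists>I. ?Q i (ap f1 i) (ap f2 i) I" by blast
    have "\<exists>f. Fun f a (Pow m) \<and> (\<forall>i. i \<epsilon> a \<longrightarrow> ?Q i (ap f1 i) (ap f2 i) (ap f i))"
      by (rule choose[of "\<lambda>i I. ?Q i (ap f1 i) (ap f2 i) I"]) (simp, use f2 mem_Pow in blast)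
    then obtain f3 where f3: "\<And>i. i \<epsilon> a \<Longrightarrow> ?Q i (ap f1 i) (ap f2 i) (ap f3 i)" by blast
    \<comment> \<open>For each requirement, \<open>f4\<close> names a set to be avoided. It differs
      from every index in \<open>f1\<close>, so that no set has to be both entered and
      avoided.\<close>
    have "\<exists>f. Fun f a m \<and> (\<forall>i. i \<epsilon> a \<longrightarrow> ap f i \<epsilon> ap f3 i \<and> (\<forall>j. j \<epsilon> a \<longrightarrow> ap f i \<noteq> ap f1 j))"
    proof (rule choose[of "\<lambda>i b. b \<epsilon> ap f3 i \<and> (\<forall>j. j \<epsilon> a \<longrightarrow> b \<noteq> ap f1 j)"])
      fix i assume "i \<epsilon> a"
      then show "\<exists>b. b \<epsilon> m \<and> (b \<epsilon> ap f3 i \<and> (\<forall>j. j \<epsilon> a \<longrightarrow> b \<noteq> ap f1 j))"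
        using not_covered[OF a, of "ap f3 i" f1] f3[of i] subD by blast
    qed simp
    then obtain f4 where f4: "Fun f4 a m"
      "\<And>i. i \<epsilon> a \<Longrightarrow> ap f4 i \<epsilon> ap f3 i \<and> (\<forall>j. j \<epsilon> a \<longrightarrow> ap f4 i \<noteq> ap f1 j)" by blast
    have m: "ap f1 i \<epsilon> m" "ap f4 i \<epsilon> m" if "i \<epsilon> a" for i
      using f3[OF that] Fun_ap[OF f4(1) that] by blast+
    let ?d = "\<lambda>i j z. \<not> (z \<epsilon> ap X (ap f1 i) \<longleftrightarrow> z \<epsilon> ap X (ap f4 j))"
    have diff: "\<exists>z. z \<epsilon> k \<and> ?d i j z" if i: "i \<epsilon> a" and j: "j \<epsilon> a" for i j
    proof -
      have "ap X (ap f1 i) \<noteq> ap X (ap f4 j)"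
        using inj[OF m(1)[OF i] m(2)[OF j]] f4(2)[OF j] i by force
      then have "\<exists>z. ?d i j z" using ext_eq by blast
      then show ?thesis using Fun_ap[OF X m(1)[OF i]] Fun_ap[OF X m(2)[OF j]] unfolding mem_Pow sub_def by blast
    qed
    \<comment> \<open>Almost every \<open>b\<close> lies above a given difference; by completeness
      one \<open>b\<close> serves all pairs.\<close>
    have "Um (\<lambda>b. \<exists>z. z \<epsilon> b \<and> ?d i j z)" if ij: "i \<epsilon> a" "j \<epsilon> a" for i j
    proof -
      obtain z where z: "z \<epsilon> k" "?d i j z" using diff[OF ij] by blast
      show ?thesis by (rule Um_mono[OF tail[OF z(1)]]) (simp, simp, use z(2) in blast)
    qed
    then have all: "Um (\<lambda>b. \<forall>i. i \<epsilon> a \<longrightarrow> (\<forall>j. j \<epsilon> a \<longrightarrow> (\<exists>z. z \<epsilon> b \<and> ?d i j z)))"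
      by (intro Um_all[OF a]) simp_all
    \<comment> \<open>A nonempty \<open>u\<close> is needed as a flag for non-membership.\<close>
    obtain u where u: "u \<epsilon> k" "u \<noteq> emp"
    proof -
      obtain v where "v \<epsilon> k" using nonempty_k ..
      from Um_ex[OF tail[OF this]] obtain u where "u \<epsilon> k" "v \<epsilon> u" by auto
      then have "u \<noteq> emp" by auto
      with \<open>u \<epsilon> k\<close> show thesis using that by blast
    qed
    from Um_ex[OF Um_conj[OF Um_conj[OF all tail[OF a]] tail[OF u(1)]]]
    obtain b where b: "b \<epsilon> k" "a \<epsilon> b" "u \<epsilon> b" and
      bd: "\<And>i j. i \<epsilon> a \<Longrightarrow> j \<epsilon> a \<Longrightarrow> \<exists>z. z \<epsilon> b \<and> ?d i j z" by auto
    have ob: "Ord b" using Ord_mem[OF Ord_k b(1)] .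
    have eb: "emp \<epsilon> b" using emp_mem_Ord[OF ob b(3)] .
    have ab: "i \<epsilon> b" if "i \<epsilon> a" for i using Ord_trans[OF ob b(2) that] .
    \<comment> \<open>Row \<open>i\<close> is the trace on \<open>b\<close> of the set with index
      \<open>ap f1 i\<close>: elements carry the flag \<open>emp\<close>, non-elements all nonempty
      flags from \<open>b\<close>.\<close>
    define t where "t = Sep (cube b) (\<lambda>p. \<exists>i z w. p = pair i (pair z w) \<and> i \<epsilon> a \<and>
        (z \<epsilon> ap X (ap f1 i) \<longleftrightarrow> w = emp))"
    have t: "pair i (pair z w) \<epsilon> t \<longleftrightarrow> i \<epsilon> a \<and> z \<epsilon> b \<and> w \<epsilon> b \<and> (z \<epsilon> ap X (ap f1 i) \<longleftrightarrow> w = emp)" for i z w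
      using ab by (auto simp: t_def mem_cube)
    have tc: "t \<sqsubseteq> cube b" by (simp add: t_def sub_def)
    have "Club (Sep k (\<lambda>x. \<forall>i. i \<epsilon> a \<longrightarrow> x \<epsilon> ap f2 i)) k"
      by (rule Club_Inter[OF a]) (use f3 in blast)
    from h[OF b(1) tc this] obtain x where x: "x \<epsilon> k" "\<And>i. i \<epsilon> a \<Longrightarrow> x \<epsilon> ap f2 i" "ap h x = t"
      by auto
    have 1: "match t (ap X (ap f1 i))" if "i \<epsilon> a" for i
      unfolding match_def
    proof (intro exI conjI allI impI)
      show "pair i (pair u (if u \<epsilon> ap X (ap f1 i) then emp else u)) \<epsilon> t"
        unfolding t using that u(2) b(3) eb by simp
    qed (use t in blast)
    \<comment> \<open>Row \<open>i\<close> decides every \<open>z\<close> in \<open>b\<close>, among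
      them one at which the sets with indices \<open>ap f1 i\<close> and \<open>ap f4 j\<close>
      differ.\<close>
    have 2: "\<not> match t (ap X (ap f4 j))" if j: "j \<epsilon> a" for j
    proof
      assume "match t (ap X (ap f4 j))"
      then obtain i p where i: "pair i p \<epsilon> t"
        "\<And>z w. pair i (pair z w) \<epsilon> t \<Longrightarrow> z \<epsilon> ap X (ap f4 j) \<longleftrightarrow> w = emp"
        unfolding match_def by blast
      have "i \<epsilon> a" using i(1) by (auto simp: t_def)
      then obtain z where z: "z \<epsilon> b" "?d i j z" using bd j by blast
      show False
      proof (cases "z \<epsilon> ap X (ap f1 i)")
        case True
        then have "pair i (pair z emp) \<epsilon> t" using t \<open>i \<epsilon> a\<close> z(1) eb by blast
        with i(2) True z(2) show False by blast
      next
        case False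
        then have "pair i (pair z u) \<epsilon> t" using t \<open>i \<epsilon> a\<close> z(1) b(3) u(2) by blast
        with i(2) False z(2) u(2) show False by blast
      qed
    qed
    have "x \<epsilon> ap e i" if i: "i \<epsilon> a" for i
      using f3[OF i] f4(2)[OF i] x(1) x(2)[OF i] A[OF m(1)[OF i], of x] A[OF m(2)[OF i], of x] 1[OF i] 2[OF i] x(3)
      by blast
    with x(1) show ?thesis by blast
  qed
  with FA show ?thesis by blast
qed

lemma Club_k: "Club k k"
  unfolding Club_def using Um_ex[OF tail] by auto

end

section \<open>Supercompact cardinals\<close>

context complete_ultrafilter
begin

text \<open>Applied with the identity, to read a measure concentrating on \<open>k\<close> as one on
  \<open>k\<close>, and with a function that picks common points of small families.\<close>

lemma pushforward:
  assumes F: "dft (\<lambda>e. F (e 0))" and T: "Um (\<lambda>x. F x \<epsilon> T)"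
  defines "N \<equiv> Sep (Pow T) (\<lambda>X. Um (\<lambda>x. F x \<epsilon> X))"
  shows "complete_ultrafilter E k N T" and "\<And>X. X \<epsilon> N \<longleftrightarrow> X \<sqsubseteq> T \<and> Um (\<lambda>x. F x \<epsilon> X)"
proof -
  have F1 [simp]: "dft a \<Longrightarrow> dft (\<lambda>e. F (a e))" for a by (rule dft1[OF F])
  show N: "X \<epsilon> N \<longleftrightarrow> X \<sqsubseteq> T \<and> Um (\<lambda>x. F x \<epsilon> X)" for X
    by (simp add: N_def)
  have "Filt N T"
    unfolding Filt_def
  proof (intro conjI allI impI)
    fix X assume X: "X \<epsilon> N"
    then show "X \<sqsubseteq> T" using N by blast
    show "X \<noteq> emp" using X Um_ex[of "\<lambda>x. F x \<epsilon> X"] unfolding N ex_mem by auto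
  next
    show "T \<epsilon> N" using T N by simp
  next
    fix X Y assume *: "X \<epsilon> N \<and> X \<sqsubseteq> Y \<and> Y \<sqsubseteq> T"
    then have "Um (\<lambda>x. F x \<epsilon> X)" using N by blast
    then have "Um (\<lambda>x. F x \<epsilon> Y)" by (rule Um_mono) (simp, simp, use * subD in blast)
    with * show "Y \<epsilon> N" unfolding N by blast
  next
    fix X Y assume *: "X \<epsilon> N \<and> Y \<epsilon> N"
    have "Um (\<lambda>x. F x \<epsilon> X \<and> F x \<epsilon> Y)" using * unfolding N by (intro Um_conj) simp_all
    then have "Sep X (\<lambda>x. x \<epsilon> Y) \<epsilon> N" using * unfolding N by (simp add: sub_def)
    then show "\<exists>Z. Z \<epsilon> N \<and> (\<forall>x. x \<epsilon> Z \<longleftrightarrow> x \<epsilon> X \<and> x \<epsilon> Y)"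
      by (intro exI[of _ "Sep X (\<lambda>x. x \<epsilon> Y)"]) simp
  qed
  moreover have "X \<epsilon> N \<or> (\<exists>Y. Y \<epsilon> N \<and> (\<forall>x. x \<epsilon> Y \<longleftrightarrow> x \<epsilon> T \<and> \<not> x \<epsilon> X))" if X: "X \<sqsubseteq> T" for X
  proof (cases "Um (\<lambda>x. F x \<epsilon> X)")
    case True
    with X N show ?thesis by blast
  next
    case False
    then have "Um (\<lambda>x. \<not> F x \<epsilon> X)" by (rule Um_not) simp
    with T have "Um (\<lambda>x. F x \<epsilon> T \<and> \<not> F x \<epsilon> X)" by (rule Um_conj) simp_all
    then have "Sep T (\<lambda>x. \<not> x \<epsilon> X) \<epsilon> N" unfolding N by (simp add: sub_def)
    then show ?thesis by (intro disjI2 exI[of _ "Sep T (\<lambda>x. \<not> x \<epsilon> X)"]) simp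
  qed
  ultimately have "Ultra N T" by (simp add: Ultra_def)
  moreover have "Compl k N"
    unfolding Compl_def
  proof (intro allI impI)
    fix W assume W: "W \<sqsubseteq> N \<and> W \<noteq> emp \<and> cless W k"
    then obtain a q where a: "a \<epsilon> k" and q: "Bij q a W" unfolding cless_def eqp_def by blast
    have "Um (\<lambda>x. \<forall>i. i \<epsilon> a \<longrightarrow> F x \<epsilon> ap q i)"
      by (rule Um_all[OF a]) (use W BijD(2)[OF q] subD N in \<open>simp, blast\<close>)
    then have "Um (\<lambda>x. \<forall>Y. Y \<epsilon> W \<longrightarrow> F x \<epsilon> Y)"
      by (rule Um_mono) (simp, simp, use BijD(3)[OF q] in blast)
    with T have "Um (\<lambda>x. F x \<epsilon> T \<and> (\<forall>Y. Y \<epsilon> W \<longrightarrow> F x \<epsilon> Y))" by (rule Um_conj) simp_all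
    then have 1: "Sep T (\<lambda>x. \<forall>Y. Y \<epsilon> W \<longrightarrow> x \<epsilon> Y) \<epsilon> N" unfolding N by (simp add: sub_def)
    obtain Y where "Y \<epsilon> W" using W ex_mem by blast
    moreover from this have "Y \<sqsubseteq> T" using W subD N by blast
    ultimately have "x \<epsilon> Sep T (\<lambda>x. \<forall>Y. Y \<epsilon> W \<longrightarrow> x \<epsilon> Y) \<longleftrightarrow> (\<forall>Y. Y \<epsilon> W \<longrightarrow> x \<epsilon> Y)" for x
      using subD by auto
    with 1 show "\<exists>X. X \<epsilon> N \<and> (\<forall>x. x \<epsilon> X \<longleftrightarrow> (\<forall>Y. Y \<epsilon> W \<longrightarrow> x \<epsilon> Y))" by blast
  qed
  ultimately show "complete_ultrafilter E k N T" using Ord_k by unfold_locales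
qed

end

context zfc
begin

section \<open>Fine and normal measures on the small subsets of an ordinal\<close>

definition Pkl :: "'a \<Rightarrow> 'a \<Rightarrow> 'a \<Rightarrow> bool" where
  "Pkl P k l \<longleftrightarrow> (\<forall>x. x \<epsilon> P \<longleftrightarrow> x \<sqsubseteq> l \<and> cless x k)"

definition Fine :: "'a \<Rightarrow> 'a \<Rightarrow> 'a \<Rightarrow> bool" where
  "Fine U P l \<longleftrightarrow> (\<forall>a. a \<epsilon> l \<longrightarrow> (\<exists>X. X \<epsilon> U \<and> (\<forall>x. x \<epsilon> X \<longleftrightarrow> x \<epsilon> P \<and> a \<epsilon> x)))"

definition Normal :: "'a \<Rightarrow> 'a \<Rightarrow> 'a \<Rightarrow> bool" where
  "Normal U P l \<longleftrightarrow> (\<forall>f. Fun f P l \<and>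
    (\<exists>X. X \<epsilon> U \<and> (\<forall>x. x \<epsilon> X \<longleftrightarrow> x \<epsilon> P \<and> (\<exists>y. pair x y \<epsilon> f \<and> y \<epsilon> x))) \<longrightarrow>
    (\<exists>a. a \<epsilon> l \<and> (\<exists>X. X \<epsilon> U \<and> (\<forall>x. x \<epsilon> X \<longleftrightarrow> x \<epsilon> P \<and> pair x a \<epsilon> f))))"

definition Super :: "'a \<Rightarrow> bool" where
  "Super k \<longleftrightarrow> UCard k \<and> (\<forall>l. Ord l \<and> k \<sqsubseteq> l \<longrightarrow>
    (\<exists>P U. Pkl P k l \<and> Ultra U P \<and> Compl k U \<and> Fine U P l \<and> Normal U P l))"

lemma sat_supercompact [sats]: "k < n \<Longrightarrow> sat E e (supercompact k n) \<longleftrightarrow> Super (lk e n k)"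
  by (simp add: supercompact_def is_Pkl_def fine_def normal_def sats Super_def Pkl_def Fine_def Normal_def)

end

context complete_ultrafilter
begin

lemma Fine_Um:
  assumes "Fine U S l" "a \<epsilon> l"
  shows "Um (\<lambda>x. a \<epsilon> x)"
proof -
  obtain X where X: "X \<epsilon> U" "\<And>x. x \<epsilon> X \<longleftrightarrow> x \<epsilon> S \<and> a \<epsilon> x" using assms unfolding Fine_def by blast
  have "X = Sep S (\<lambda>x. a \<epsilon> x)" by (rule ext_eq) (simp add: X(2))
  with X(1) show ?thesis by (simp add: Um_def)
qed

lemma Normal_Um:
  assumes n: "Normal U S l" and F: "dft (\<lambda>e. F (e 0))" "\<And>x. x \<epsilon> S \<Longrightarrow> F x \<epsilon> l" and r: "Um (\<lambda>x. F x \<epsilon> x)"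
  shows "\<exists>a. a \<epsilon> l \<and> Um (\<lambda>x. F x = a)"
proof -
  have F1 [simp]: "dft a \<Longrightarrow> dft (\<lambda>e. F (a e))" for a by (rule dft1[OF F(1)])
  have L: "Fun (lam S F) S l" by (rule Fun_lam) (use F in auto)
  have p: "pair x y \<epsilon> lam S F \<longleftrightarrow> x \<epsilon> S \<and> y = F x" for x y
    unfolding mem_lam[OF F(1)] by auto
  have "\<forall>x. x \<epsilon> Sep S (\<lambda>x. F x \<epsilon> x) \<longleftrightarrow> x \<epsilon> S \<and> (\<exists>y. pair x y \<epsilon> lam S F \<and> y \<epsilon> x)"
    by (auto simp: p)
  with n L r obtain a X where a: "a \<epsilon> l" "X \<epsilon> U" "\<And>x. x \<epsilon> X \<longleftrightarrow> x \<epsilon> S \<and> pair x a \<epsilon> lam S F"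
    unfolding Normal_def Um_def by blast
  have "X = Sep S (\<lambda>x. F x = a)" by (rule ext_eq) (auto simp: a(3) p)
  with a show ?thesis by (auto simp: Um_def)
qed

end

context zfc
begin

text \<open>For \<open>l = k\<close> almost every small subset of \<open>k\<close> is transitive,
  hence an ordinal below \<open>k\<close>. The measure therefore concentrates on \<open>k\<close>,
  and there fineness becomes \<open>tail\<close> and normality becomes
  \<open>regressive\<close>.\<close>

lemma supercompact_normal_measure:
  assumes k: "Super k"
  shows "\<exists>N. normal_measure E k N"
proof -
  have c: "Card k" and Ok: "Ord k" using k by (auto simp: Super_def UCard_def Card_def)
  obtain e0 where e0: "e0 \<epsilon> k" using k by (auto simp: Super_def UCard_def)
  obtain P U where P: "Pkl P k k" and U: "Ultra U P" "Compl k U" and fn: "Fine U P k" "Normal U P k"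
    using k Ok unfolding Super_def by (meson sub_refl)
  interpret V: complete_ultrafilter E k U P
    using Ok U by unfold_locales
  note fine = V.Fine_Um[OF fn(1)]
  have Pk: "x \<sqsubseteq> k" "cless x k" if "x \<epsilon> P" for x using P that unfolding Pkl_def by blast+
  \<comment> \<open>Otherwise a member not contained in \<open>x\<close> can be chosen regressively
    and is almost everywhere one \<open>a\<close>; but fineness and completeness put all elements of
    \<open>a\<close> into almost every \<open>x\<close>.\<close>
  have tr: "V.Um (\<lambda>x. \<forall>y. y \<epsilon> x \<longrightarrow> y \<sqsubseteq> x)"
  proof (rule ccontr)
    assume "\<not> ?thesis"
    then have bad: "V.Um (\<lambda>x. \<not> (\<forall>y. y \<epsilon> x \<longrightarrow> y \<sqsubseteq> x))" by (rule V.Um_not) simp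
    have "\<exists>f. Fun f (Sep P (\<lambda>x. \<exists>y. y \<epsilon> x \<and> \<not> y \<sqsubseteq> x)) k \<and>
        (\<forall>x. x \<epsilon> Sep P (\<lambda>x. \<exists>y. y \<epsilon> x \<and> \<not> y \<sqsubseteq> x) \<longrightarrow> ap f x \<epsilon> x \<and> \<not> ap f x \<sqsubseteq> x)"
    proof (rule choose[of "\<lambda>x y. y \<epsilon> x \<and> \<not> y \<sqsubseteq> x"])
      fix x assume "x \<epsilon> Sep P (\<lambda>x. \<exists>y. y \<epsilon> x \<and> \<not> y \<sqsubseteq> x)"
      then have "x \<epsilon> P" "\<exists>y. y \<epsilon> x \<and> \<not> y \<sqsubseteq> x" by simp_all
      then show "\<exists>y. y \<epsilon> k \<and> y \<epsilon> x \<and> \<not> y \<sqsubseteq> x" using subD[OF Pk(1)] by blast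
    qed simp
    then obtain f where f: "\<And>x. x \<epsilon> P \<Longrightarrow> \<exists>y. y \<epsilon> x \<and> \<not> y \<sqsubseteq> x \<Longrightarrow> ap f x \<epsilon> x \<and> \<not> ap f x \<sqsubseteq> x" by auto
    \<comment> \<open>The default \<open>e0\<close> keeps the values in \<open>k\<close> on all of
      \<open>P\<close>, as \<open>V.Normal_Um\<close> demands.\<close>
    define F where "F x = (if \<exists>y. y \<epsilon> x \<and> \<not> y \<sqsubseteq> x then ap f x else e0)" for x
    have F: "dft (\<lambda>e. F (e 0))" by (simp add: F_def)
    have F1 [simp]: "dft a \<Longrightarrow> dft (\<lambda>e. F (a e))" for a by (rule dft1[OF F])
    have Fr: "V.Um (\<lambda>x. F x \<epsilon> x \<and> \<not> F x \<sqsubseteq> x)"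
      by (rule V.Um_mono[OF bad]) (simp, simp, use f in \<open>auto simp: F_def\<close>)
    then have "V.Um (\<lambda>x. F x \<epsilon> x)" by (rule V.Um_mono) simp_all
    moreover have "F x \<epsilon> k" if "x \<epsilon> P" for x using f[OF that] Pk(1)[OF that] subD e0 by (auto simp: F_def)
    ultimately obtain a where a: "a \<epsilon> k" "V.Um (\<lambda>x. F x = a)"
      using V.Normal_Um[OF fn(2) F] by blast
    have "V.Um (\<lambda>x. \<forall>b. b \<epsilon> a \<longrightarrow> b \<epsilon> x)"
      by (rule V.Um_all[OF a(1)]) (simp, use fine Ord_trans[OF Ok a(1)] in blast)
    from V.Um_ex[OF V.Um_conj[OF V.Um_conj[OF Fr a(2)] this]]
    show False by (auto simp: sub_def)
  qed
  have K: "V.Um (\<lambda>x. x \<epsilon> k)"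
  proof (rule V.Um_mono[OF tr])
    fix x assume x: "x \<epsilon> P" and "\<forall>y. y \<epsilon> x \<longrightarrow> y \<sqsubseteq> x"
    moreover have "x \<noteq> k" using Pk(2)[OF x] c unfolding cless_def Card_def by blast
    ultimately show "x \<epsilon> k" using transitive_subset_mem[OF Ok Pk(1)[OF x]] subD by blast
  qed simp_all
  define N where "N = Sep (Pow k) (\<lambda>X. V.Um (\<lambda>x. x \<epsilon> X))"
  have id: "dft (\<lambda>e. e 0)" by simp
  interpret N: complete_ultrafilter E k N k
    unfolding N_def by (rule V.pushforward(1)[OF id K])
  have mem_N: "X \<epsilon> N \<longleftrightarrow> X \<sqsubseteq> k \<and> V.Um (\<lambda>x. x \<epsilon> X)" for X
    unfolding N_def by (rule V.pushforward(2)[OF id K])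
  have NV: "N.Um Q \<longleftrightarrow> V.Um Q" if Q: "dfb (\<lambda>e. Q (e 0))" for Q
  proof -
    have "N.Um Q \<longleftrightarrow> V.Um (\<lambda>x. x \<epsilon> k \<and> Q x)"
      unfolding N.Um_def mem_N using Q by (simp add: sub_def)
    also have "\<dots> \<longleftrightarrow> V.Um Q"
      using V.Um_mono[of "\<lambda>x. x \<epsilon> k \<and> Q x" Q] V.Um_conj[OF K, of Q] Q by auto
    finally show ?thesis .
  qed
  have "normal_measure E k N"
  proof
    show "N.Um (\<lambda>x. a \<epsilon> x)" if "a \<epsilon> k" for a using fine[OF that] NV by simp
    fix F :: "'a \<Rightarrow> 'a" assume F: "dft (\<lambda>e. F (e 0))" and r: "N.Um (\<lambda>x. F x \<epsilon> x)"
    have F1 [simp]: "dft a \<Longrightarrow> dft (\<lambda>e. F (a e))" for a by (rule dft1[OF F])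
    \<comment> \<open>Off \<open>P\<close>, or where \<open>F\<close> is not regressive, the value
      is reset to \<open>e0\<close>, so that all values lie in \<open>k\<close>.\<close>
    define F' where "F' x = (if F x \<epsilon> x \<and> x \<epsilon> P then F x else e0)" for x
    have "V.Um (\<lambda>x. F x \<epsilon> x)" using r NV by simp
    then have r': "V.Um (\<lambda>x. F' x \<epsilon> x \<and> F' x = F x)" by (rule V.Um_mono) (simp_all add: F'_def)
    then have "V.Um (\<lambda>x. F' x \<epsilon> x)" by (rule V.Um_mono) (simp add: F'_def, simp add: F'_def, blast)
    moreover have "F' x \<epsilon> k" for x using e0 Pk(1) subD unfolding F'_def by auto
    moreover have "dft (\<lambda>e. F' (e 0))" by (simp add: F'_def)
    ultimately obtain a where a: "a \<epsilon> k" "V.Um (\<lambda>x. F' x = a)"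
      using V.Normal_Um[OF fn(2)] by blast
    from V.Um_conj[OF a(2) r'] have "V.Um (\<lambda>x. (F' x = a) \<and> F' x \<epsilon> x \<and> F' x = F x)"
      by (simp add: F'_def)
    then have "V.Um (\<lambda>x. F x = a)" by (rule V.Um_mono) (auto simp: F'_def)
    with a(1) NV show "\<exists>a. a \<epsilon> k \<and> N.Um (\<lambda>x. F x = a)" by auto
  qed
  then show ?thesis ..
qed

text \<open>Index \<open>G\<close> by \<open>t = 2^k\<close>. A small set \<open>x\<close> of
  indices names fewer than \<open>k\<close> members of \<open>G\<close>; let \<open>r\<close> send
  it to a common point of theirs. By fineness almost every \<open>x\<close> contains a given index,
  so the image of the measure under \<open>r\<close> contains every member of
  \<open>G\<close>.\<close>

lemma supercompact_extension:
  assumes k: "Super k" and G: "\<And>B. B \<epsilon> G \<Longrightarrow> B \<sqsubseteq> k" "k \<epsilon> G"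
    and fip: "\<And>a e. a \<epsilon> k \<Longrightarrow> Fun e a G \<Longrightarrow> \<exists>x. x \<epsilon> k \<and> (\<forall>i. i \<epsilon> a \<longrightarrow> x \<epsilon> ap e i)"
  shows "\<exists>V. Ultra V k \<and> Compl k V \<and> G \<sqsubseteq> V"
proof -
  have Ok: "Ord k" using k by (auto simp: Super_def UCard_def Card_def)
  obtain t f where t: "Card t" and f: "Bij f t (Pow k)" and kt: "k \<epsilon> t"
    using Pow_enumeration[OF Ok] by blast
  have ot: "Ord t" using t by (simp add: Card_def)
  then have "k \<sqsubseteq> t" using kt unfolding Ord_def by blast
  with ot k obtain P U where P: "Pkl P k t" and U: "Ultra U P" "Compl k U" and fn: "Fine U P t"
    unfolding Super_def by blast
  interpret V: complete_ultrafilter E k U P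
    using Ok U by unfold_locales
  \<comment> \<open>Indices of sets outside \<open>G\<close> are redirected to \<open>k\<close>,
    which is why \<open>k\<close> is required to be in \<open>G\<close>.\<close>
  define g where "g i = (if ap f i \<epsilon> G then ap f i else k)" for i
  have dg: "dft a \<Longrightarrow> dft (\<lambda>e. g (a e))" for a by (simp add: g_def)
  have gG: "g i \<epsilon> G" for i using G(2) by (simp add: g_def)
  have "\<exists>r. Fun r P k \<and> (\<forall>x. x \<epsilon> P \<longrightarrow> (\<forall>i. i \<epsilon> x \<longrightarrow> ap r x \<epsilon> g i))"
  proof (rule choose[of "\<lambda>x z. \<forall>i. i \<epsilon> x \<longrightarrow> z \<epsilon> g i"])
    show "dfb (\<lambda>e. \<forall>i. i \<epsilon> e 0 \<longrightarrow> e (Suc 0) \<epsilon> g i)" by (simp add: dg)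
    fix x assume "x \<epsilon> P"
    then obtain a q where a: "a \<epsilon> k" and q: "Bij q a x" using P unfolding Pkl_def cless_def eqp_def by blast
    have d: "dft (\<lambda>e. g (ap q (e 0)))" by (simp add: dg)
    have "Fun (lam a (\<lambda>j. g (ap q j))) a G" by (rule Fun_lam[OF d]) (rule gG)
    from fip[OF a this] obtain z where z: "z \<epsilon> k" "\<And>j. j \<epsilon> a \<Longrightarrow> z \<epsilon> g (ap q j)"
      using d by auto
    then show "\<exists>z. z \<epsilon> k \<and> (\<forall>i. i \<epsilon> x \<longrightarrow> z \<epsilon> g i)" using BijD(3)[OF q] by blast
  qed
  then obtain r where r: "Fun r P k" "\<And>x i. x \<epsilon> P \<Longrightarrow> i \<epsilon> x \<Longrightarrow> ap r x \<epsilon> g i" by blast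
  have dr: "dft (\<lambda>e. ap r (e 0))" by simp
  have rk: "V.Um (\<lambda>x. ap r x \<epsilon> k)" by (rule V.Um_I) (use Fun_ap[OF r(1)] in auto)
  define N where "N = Sep (Pow k) (\<lambda>X. V.Um (\<lambda>x. ap r x \<epsilon> X))"
  interpret N: complete_ultrafilter E k N k
    unfolding N_def by (rule V.pushforward(1)[OF dr rk])
  have "G \<sqsubseteq> N"
  proof (rule subI)
    fix B assume B: "B \<epsilon> G"
    then obtain i where i: "i \<epsilon> t" "ap f i = B" using BijD(3)[OF f, of B] G(1) by auto
    have "V.Um (\<lambda>x. i \<epsilon> x)" by (rule V.Fine_Um[OF fn i(1)])
    then have "V.Um (\<lambda>x. ap r x \<epsilon> B)"
      by (rule V.Um_mono) (simp, simp, use r(2)[of _ i] i(2) B in \<open>simp add: g_def\<close>)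
    with G(1)[OF B] show "B \<epsilon> N" by (simp add: N_def)
  qed
  with N.ultra N.complete show ?thesis by blast
qed

section \<open>The non-Galvin ultrafilter\<close>

definition Meas :: "'a \<Rightarrow> bool" where
  "Meas k \<longleftrightarrow> UCard k \<and> (\<exists>U. Ultra U k \<and> Compl k U \<and>
    (\<forall>x. x \<epsilon> k \<longrightarrow> \<not> (\<exists>X. X \<epsilon> U \<and> X = upair x x)))"

lemma sat_measurable_cardinal [sats]: "k < n \<Longrightarrow> sat E e (measurable_cardinal k n) \<longleftrightarrow> Meas (lk e n k)"
  by (simp add: measurable_cardinal_def nonprincipal_def sats Meas_def)

definition Galvin :: "'a \<Rightarrow> 'a \<Rightarrow> 'a \<Rightarrow> bool" where
  "Galvin F k m \<longleftrightarrow> (\<forall>A. Fun A m F \<longrightarrow> (\<exists>I. I \<sqsubseteq> m \<and> eqp k I \<and>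
    (\<exists>X. X \<epsilon> F \<and> (\<forall>x. x \<epsilon> X \<longleftrightarrow> (\<forall>a Y. a \<epsilon> I \<and> pair a Y \<epsilon> A \<longrightarrow> x \<epsilon> Y)))))"

lemma sat_galvin [sats]: "F < n \<Longrightarrow> k < n \<Longrightarrow> m < n \<Longrightarrow>
    sat E e (galvin F k m n) \<longleftrightarrow> Galvin (lk e n F) (lk e n k) (lk e n m)"
  by (simp add: galvin_def sats Galvin_def)

definition Club_filter :: "'a \<Rightarrow> 'a" where
  "Club_filter k = Sep (Pow k) (\<lambda>X. \<exists>C. Club C k \<and> C \<sqsubseteq> X)"

lemma mem_Club_filter: "X \<epsilon> Club_filter k \<longleftrightarrow> X \<sqsubseteq> k \<and> (\<exists>C. Club C k \<and> C \<sqsubseteq> X)"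
  by (simp add: Club_filter_def)

lemma sat_is_club_filter [sats]: "D < n \<Longrightarrow> k < n \<Longrightarrow>
    sat E e (is_club_filter D k n) \<longleftrightarrow> lk e n D = Club_filter (lk e n k)"
proof -
  have "(\<forall>X. X \<epsilon> D \<longleftrightarrow> X \<sqsubseteq> k \<and> (\<exists>C. Club C k \<and> C \<sqsubseteq> X)) \<longleftrightarrow> D = Club_filter k" for D k
    unfolding mem_Club_filter[symmetric] by (auto intro: ext_eq)
  then show "D < n \<Longrightarrow> k < n \<Longrightarrow> sat E e (is_club_filter D k n) \<longleftrightarrow> lk e n D = Club_filter (lk e n k)"
    by (simp add: is_club_filter_def sats)
qed

theorem supercompact_non_Galvin:
  assumes k: "Super k"
  shows "\<exists>U. Meas k \<and> Ultra U k \<and> Compl k U \<and> Club_filter k \<sqsubseteq> U \<and> (\<exists>m. SuccCard m k \<and> \<not> Galvin U k m)"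
proof -
  obtain N where "normal_measure E k N" using supercompact_normal_measure[OF k] ..
  then interpret N: normal_measure E k N .
  have "\<not> upair x x \<epsilon> N" if x: "x \<epsilon> k" for x
  proof
    assume *: "upair x x \<epsilon> N"
    have "Sep k (\<lambda>y. y = x) = upair x x" by (rule ext_eq) (use x in auto)
    with * have "N.Um (\<lambda>y. y = x)" by (simp add: N.Um_def)
    from N.Um_ex[OF N.Um_conj[OF this N.tail[OF x]]] show False using mem_irrefl by auto
  qed
  moreover have "UCard k" using k unfolding Super_def by blast
  ultimately have meas: "Meas k"
    unfolding Meas_def using N.ultra N.complete by blast
  obtain m X where m: "SuccCard m k" and X: "Fun X m (Pow k)"
    "\<And>x y. x \<epsilon> m \<Longrightarrow> y \<epsilon> m \<Longrightarrow> ap X x = ap X y \<Longrightarrow> x = y"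
    using ex_SuccCard[OF N.Ord_k] by blast
  have km: "k \<epsilon> m" "k \<sqsubseteq> m" using m unfolding SuccCard_def Card_def Ord_def by blast+
  obtain A where A: "Fun A m (Pow k)" and
    fip: "\<And>a e. a \<epsilon> k \<Longrightarrow> Fun e a (N.gen m A) \<Longrightarrow> \<exists>x. x \<epsilon> k \<and> (\<forall>i. i \<epsilon> a \<longrightarrow> x \<epsilon> ap e i)"
    using N.independent_family[OF X] by blast
  have gen: "B \<epsilon> N.gen m A" if "B \<sqsubseteq> k" "Club C k" "a \<epsilon> m" "I \<sqsubseteq> m" "eqp k I"
    "\<And>x. x \<epsilon> C \<Longrightarrow> x \<epsilon> ap A a \<Longrightarrow> \<not> (\<forall>b. b \<epsilon> I \<longrightarrow> x \<epsilon> ap A b) \<Longrightarrow> x \<epsilon> B" for B C a I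
    unfolding N.mem_gen using that by blast
  \<comment> \<open>The index and the index set are both filled with \<open>k\<close>, as
    \<open>C\<close> alone already lies within \<open>B\<close>.\<close>
  have club: "B \<epsilon> N.gen m A" if "B \<sqsubseteq> k" "Club C k" "C \<sqsubseteq> B" for B C
    using gen[OF that(1,2) km eqp_refl] subD[OF that(3)] by blast
  have Aa: "ap A a \<epsilon> N.gen m A" if a: "a \<epsilon> m" for a
    using gen[OF _ N.Club_k a km(2) eqp_refl] Fun_ap[OF A a] by simp
  have inter: "Sep k (\<lambda>x. \<not> (\<forall>b. b \<epsilon> I \<longrightarrow> x \<epsilon> ap A b)) \<epsilon> N.gen m A" if I: "I \<sqsubseteq> m" "eqp k I" for I
    by (rule gen[OF _ N.Club_k km(1) I]) (simp_all add: sub_def)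
  obtain V where V: "Ultra V k" "Compl k V" "N.gen m A \<sqsubseteq> V"
    using supercompact_extension[OF k _ club[OF sub_refl N.Club_k sub_refl] fip] N.mem_gen by blast
  have "Club_filter k \<sqsubseteq> V"
    using club subD[OF V(3)] by (auto simp: mem_Club_filter intro!: subI)
  moreover have "\<not> Galvin V k m"
  proof
    have Ap: "pair a Y \<epsilon> A \<longleftrightarrow> a \<epsilon> m \<and> Y = ap A a" for a Y by (rule Fun_pair[OF A])
    have "Fun (lam m (ap A)) m V" by (rule Fun_lam) (use Aa subD[OF V(3)] in auto)
    then have "Fun A m V" by (simp only: Fun_eq_lam[OF A, symmetric])
    moreover assume "Galvin V k m"
    ultimately obtain I Y where I: "I \<sqsubseteq> m" "eqp k I" and Y: "Y \<epsilon> V"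
      "\<And>x. x \<epsilon> Y \<longleftrightarrow> (\<forall>a Y. a \<epsilon> I \<and> pair a Y \<epsilon> A \<longrightarrow> x \<epsilon> Y)"
      unfolding Galvin_def by blast
    let ?B = "Sep k (\<lambda>x. \<not> (\<forall>b. b \<epsilon> I \<longrightarrow> x \<epsilon> ap A b))"
    \<comment> \<open>The Galvin property would put the intersection \<open>Y\<close> into
      \<open>V\<close>, but its complement \<open>?B\<close> was placed there by
      construction.\<close>
    have "?B \<epsilon> V" using inter[OF I] subD[OF V(3)] by blast
    with Y(1) V(1) obtain Z where Z: "Z \<epsilon> V" "\<And>x. x \<epsilon> Z \<longleftrightarrow> x \<epsilon> Y \<and> x \<epsilon> ?B"
      unfolding Ultra_def Filt_def by blast
    have "Z \<noteq> emp" using Z(1) V(1) unfolding Ultra_def Filt_def by blast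
    then obtain x where "x \<epsilon> Z" unfolding ex_mem by blast
    then have x: "x \<epsilon> Y" "x \<epsilon> ?B" unfolding Z(2) by blast+
    have "x \<epsilon> ap A b" if "b \<epsilon> I" for b
      using x(1) that subD[OF I(1) that] unfolding Y(2) Ap by blast
    then show False using x(2) by auto
  qed
  ultimately show ?thesis using meas V m by blast
qed

end

section \<open>The relative consistency result\<close>

named_theorems fvs

lemma fv_below_fmem [fvs]: "x < n \<Longrightarrow> y < n \<Longrightarrow> fv_below n ((x \<^bold>\<in> y) n)"
  by (simp add: fmem_def)

lemma fv_below_feq [fvs]: "x < n \<Longrightarrow> y < n \<Longrightarrow> fv_below n ((x \<^bold>= y) n)"
  by (simp add: feq_def)

lemma fv_below_connectives [fvs]:
  "fv_below n ((P \<^bold>\<longrightarrow> Q) n) \<longleftrightarrow> fv_below n (P n) \<and> fv_below n (Q n)"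
  "fv_below n ((\<^bold>\<not> P) n) \<longleftrightarrow> fv_below n (P n)"
  "fv_below n ((P \<^bold>\<and> Q) n) \<longleftrightarrow> fv_below n (P n) \<and> fv_below n (Q n)"
  "fv_below n ((P \<^bold>\<or> Q) n) \<longleftrightarrow> fv_below n (P n) \<and> fv_below n (Q n)"
  "fv_below n ((P \<^bold>\<longleftrightarrow> Q) n) \<longleftrightarrow> fv_below n (P n) \<and> fv_below n (Q n)"
  by (auto simp: fimp_def fnot_def fconj_def fdisj_def fiff_def)

lemma fv_below_quantifiers [fvs]:
  "fv_below n (fall R n) \<longleftrightarrow> fv_below (Suc n) (R n (Suc n))"
  "fv_below n (fex R n) \<longleftrightarrow> fv_below (Suc n) (R n (Suc n))"
  "fv_below n (fex1 R n) \<longleftrightarrow> fv_below (Suc n) (R n (Suc n)) \<and>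
    fv_below (Suc (Suc n)) (R (Suc n) (Suc (Suc n))) \<and> fv_below (Suc (Suc n)) ((Suc n \<^bold>= n) (Suc (Suc n)))"
  by (auto simp: fall_def fex_def fex1_def fvs)

lemma fv_below_finst [fvs]:
  "fv_below (length xs) p \<Longrightarrow> (\<And>x. x \<in> set xs \<Longrightarrow> x < n) \<Longrightarrow> fv_below n (p\<langle>xs\<rangle> n)"
proof -
  assume "fv_below (length xs) p" and xs: "\<And>x. x \<in> set xs \<Longrightarrow> x < n"
  then show "fv_below n (p\<langle>xs\<rangle> n)"
    unfolding finst_def by (elim fv_below_rename) (use xs[OF nth_mem] in fastforce)
qed

lemma fv_below_univ_closure: "fv_below k (P k) \<Longrightarrow> fv_below 0 (univ_closure k P)"
proof -
  have "fv_below (n + k) p \<Longrightarrow> fv_below n ((Forall ^^ k) p)" for n p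
    by (induction k arbitrary: n) auto
  from this[of 0] show "fv_below k (P k) \<Longrightarrow> fv_below 0 (univ_closure k P)"
    by (simp add: univ_closure_def)
qed

lemma fv_below_functions [fvs]:
  "x < n \<Longrightarrow> y < n \<Longrightarrow> fv_below n ((x \<^bold>\<subseteq> y) n)"
  "x < n \<Longrightarrow> fv_below n (nonempty x n)"
  "x < n \<Longrightarrow> y < n \<Longrightarrow> z < n \<Longrightarrow> fv_below n (is_upair x y z n)"
  "x < n \<Longrightarrow> y < n \<Longrightarrow> z < n \<Longrightarrow> fv_below n (is_opair x y z n)"
  "x < n \<Longrightarrow> y < n \<Longrightarrow> z < n \<Longrightarrow> fv_below n (maps_to x y z n)"
  "x < n \<Longrightarrow> y < n \<Longrightarrow> z < n \<Longrightarrow> fv_below n (is_function x y z n)"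
  "x < n \<Longrightarrow> y < n \<Longrightarrow> fv_below n (equipotent x y n)"
  "x < n \<Longrightarrow> y < n \<Longrightarrow> fv_below n (card_less x y n)"
  "x < n \<Longrightarrow> fv_below n (ordinal x n)"
  by (simp_all add: fvs fsubset_def nonempty_def is_upair_def is_opair_def maps_to_def is_function_def
      equipotent_def card_less_def ordinal_def)

text \<open>Being sentences is what leaves fresh indices for the witnesses in
  \<open>ex_henkin\<close> and makes truth in the term model independent of the environment.\<close>

lemma closed_supercompact_theory:
  assumes "p \<in> supercompact_theory"
  shows "fv_below 0 p"
proof -
  have "fv_below 0 (separation k p)" if "fv_below (k + 1) p" for k p
    unfolding separation_def
    by (rule fv_below_univ_closure) (use that in \<open>auto simp: fvs intro!: fv_below_finst\<close>)
  moreover have "fv_below 0 (replacement k p)" if "fv_below (k + 2) p" for k p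
    unfolding replacement_def
    by (rule fv_below_univ_closure) (use that in \<open>auto simp: fvs intro!: fv_below_finst\<close>)
  moreover have "fv_below 0 (exists_supercompact 0)"
    by (simp add: fvs exists_supercompact_def supercompact_def is_Pkl_def fine_def normal_def ultrafilter_on_def
        filter_on_def complete_filter_def is_Inter_def is_Diff_def uncountable_cardinal_def cardinal_def
        is_omega_def limit_def)
  ultimately show ?thesis
    using assms unfolding supercompact_theory_def ZFC_def
    by (auto simp: fvs extensionality_def foundation_def pairing_def union_axiom_def power_set_def
        infinity_def choice_def is_succ_def)
qed

theorem corollary3p6:
  assumes "consistent (ZFC \<union> {exists_supercompact 0})"
  shows "consistent (ZFC \<union> {exists_non_Galvin_ultrafilter 0})"
proof -
  have model: "sat term_mem e p" if "p \<in> supercompact_theory" for e p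
    using term_model[OF _ closed_supercompact_theory that] assms by (simp add: supercompact_theory_def)
  interpret zfc term_mem
    by unfold_locales (rule model, simp add: supercompact_theory_def)
  fix e :: "nat \<Rightarrow> term_model"
  have "sat term_mem e (exists_supercompact 0)"
    by (rule model) (simp add: supercompact_theory_def)
  then obtain k where "Super k" by (auto simp: exists_supercompact_def sats)
  from supercompact_non_Galvin[OF this]
  have "sat term_mem e (exists_non_Galvin_ultrafilter 0)"
    by (auto simp: exists_non_Galvin_ultrafilter_def sats)
  moreover have "\<forall>p\<in>ZFC. sat term_mem e p" using zfc by blast
  ultimately show ?thesis
    unfolding consistent_def using soundness[of _ Falsum term_mem e] by auto
qed

end
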